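(* The following statements hold. (i) If $0<H<1/4$, then $I_q(H)=-\infty$ for every $q\in\mathbb Z$. (ii) At $H=1/4$, if $\boldsymbol m\in\mathcal A$ and $Q(\boldsymbol m)\neq0$, then $E_{1/4}(\boldsymbol m)\ge b_*/2$. (iii) There exists a family $(\boldsymbol w_R)_{R\gg1}\subset\mathcal A_0$ (indexed by all sufficiently large real $R$) such that $$\liminf_{R\to\infty}\|\boldsymbol w_R-\boldsymbol e_3\|_{H^2(\mathbb R^2)}>0,\qquad E_{1/4}(\boldsymbol w_R)=O(R^{-2})\ \text{ as }R\to\infty,$$ and, for every fixed radius $A>0$, $$\sup_{y\in\mathbb R^2}\int_{B_A(y)}\big(|\boldsymbol w_R-\boldsymbol e_3|^2+|\nabla\boldsymbol w_R|^2+|D^2\boldsymbol w_R|^2\big)dx\to0\quad\text{as }R\to\infty.$$ (iv) The function $H\mapsto I_{-1}(H)$ is continuous from the coercive side at the threshold: $$\lim_{H\downarrow1/4}I_{-1}(H)=I_{-1}(1/4)\ge b_*/2>0.$$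
   Context: Let $\boldsymbol e_3=(0,0,1)$ and $\mathcal A=\{\boldsymbol m:\mathbb R^2\to\mathbb S^2:\ \boldsymbol m-\boldsymbol e_3\in H^2(\mathbb R^2;\mathbb R^3)\}$; each $\boldsymbol m=(m_1,m_2,m_3)\in\mathcal A$ is identified with its uniformly continuous representative, which tends to $\boldsymbol e_3$ at infinity. The topological degree of $\boldsymbol m\in\mathcal A$ is $$Q(\boldsymbol m)=\frac1{4\pi}\int_{\mathbb R^2}\boldsymbol m\cdot(\partial_1\boldsymbol m\times\partial_2\boldsymbol m)\,dx\in\mathbb Z,$$ and $\mathcal A_q=\{\boldsymbol m\in\mathcal A: Q(\boldsymbol m)=q\}$ for $q\in\mathbb Z$. For $H>0$, $$E_H(\boldsymbol m)=\int_{\mathbb R^2}\Big(-\tfrac12|\nabla\boldsymbol m|^2+\tfrac12|\Delta\boldsymbol m|^2+H(1-m_3)\Big)dx,\qquad I_q(H)=\inf_{\boldsymbol m\in\mathcal A_q}E_H(\boldsymbol m).$$ $B_A(y)$ is the open disk of radius $A$ centered at $y$. $J_0,J_1$ are the Bessel functions of the first kind of orders $0,1$, $r_*$ is the first positive zero of $J_1$, and $$b_*=\frac{8\pi J_0(r_* )^2}{1-J_0(r_* )^2}.$$ *)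

theory Defs
  imports
    "HOL-Analysis.Analysis"
    "HOL-Library.Landau_Symbols"
begin

section \<open>Sobolev functions\<close>

definition partial_deriv :: "'n \<Rightarrow> (real^'n \<Rightarrow> real) \<Rightarrow> real^'n \<Rightarrow> real" where
  "partial_deriv i f x = frechet_derivative f (at x) (axis i 1)"

primrec C_k :: "nat \<Rightarrow> (real^'n \<Rightarrow> real) \<Rightarrow> bool" where
  "C_k 0 f \<longleftrightarrow> continuous_on UNIV f"
| "C_k (Suc k) f \<longleftrightarrow> (\<forall>x. f differentiable (at x)) \<and> (\<forall>i. C_k k (partial_deriv i f))"

definition test_function :: "(real^'n \<Rightarrow> real) \<Rightarrow> bool" where
  "test_function \<phi> \<longleftrightarrow> (\<forall>k. C_k k \<phi>) \<and> (\<exists>K. compact K \<and> (\<forall>x. x \<notin> K \<longrightarrow> \<phi> x = 0))"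

definition locally_integrable :: "(real^'n \<Rightarrow> 'b::euclidean_space) \<Rightarrow> bool" where
  "locally_integrable u \<longleftrightarrow> (\<forall>K. compact K \<longrightarrow> set_integrable lborel K u)"

definition has_weak_partial ::
    "'n \<Rightarrow> (real^'n \<Rightarrow> 'b::euclidean_space) \<Rightarrow> (real^'n \<Rightarrow> 'b) \<Rightarrow> bool" where
  "has_weak_partial i u v \<longleftrightarrow> locally_integrable u \<and> locally_integrable v \<and>
     (\<forall>\<phi>. test_function \<phi> \<longrightarrow>
        (LINT x|lborel. partial_deriv i \<phi> x *\<^sub>R u x) = - (LINT x|lborel. \<phi> x *\<^sub>R v x))"

text \<open>A weak derivative is unique up to null sets, and it is only used under integrals or in
  conditions that do not depend on the representative chosen here.\<close>

definition weak_partial :: "'n \<Rightarrow> (real^'n \<Rightarrow> 'b::euclidean_space) \<Rightarrow> real^'n \<Rightarrow> 'b" where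
  "weak_partial i u = (SOME v. has_weak_partial i u v)"

definition weakly_differentiable :: "(real^'n \<Rightarrow> 'b::euclidean_space) \<Rightarrow> bool" where
  "weakly_differentiable u \<longleftrightarrow> (\<forall>i. \<exists>v. has_weak_partial i u v)"

definition in_L2 :: "(real^'n \<Rightarrow> 'b::euclidean_space) \<Rightarrow> bool" where
  "in_L2 u \<longleftrightarrow> u \<in> borel_measurable lborel \<and> integrable lborel (\<lambda>x. (norm (u x))\<^sup>2)"

definition in_H2 :: "(real^'n \<Rightarrow> 'b::euclidean_space) \<Rightarrow> bool" where
  "in_H2 u \<longleftrightarrow> in_L2 u \<and> weakly_differentiable u \<and>
     (\<forall>j. in_L2 (weak_partial j u) \<and> weakly_differentiable (weak_partial j u) \<and>
        (\<forall>i. in_L2 (weak_partial i (weak_partial j u))))"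

definition grad_sq :: "(real^'n \<Rightarrow> 'b::euclidean_space) \<Rightarrow> real^'n \<Rightarrow> real" where
  "grad_sq u x = (\<Sum>i\<in>UNIV. (norm (weak_partial i u x))\<^sup>2)"

definition hess_sq :: "(real^'n \<Rightarrow> 'b::euclidean_space) \<Rightarrow> real^'n \<Rightarrow> real" where
  "hess_sq u x = (\<Sum>i\<in>UNIV. \<Sum>j\<in>UNIV. (norm (weak_partial i (weak_partial j u) x))\<^sup>2)"

definition weak_laplacian :: "(real^'n \<Rightarrow> 'b::euclidean_space) \<Rightarrow> real^'n \<Rightarrow> 'b" where
  "weak_laplacian u x = (\<Sum>i\<in>UNIV. weak_partial i (weak_partial i u) x)"

definition H2_norm :: "(real^'n \<Rightarrow> 'b::euclidean_space) \<Rightarrow> real" where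
  "H2_norm u = sqrt (LINT x|lborel. (norm (u x))\<^sup>2 + grad_sq u x + hess_sq u x)"

section \<open>Admissible maps, degree and energy\<close>

definition e3 :: "real^3" where
  "e3 = vector [0, 0, 1]"

text \<open>By the Sobolev embedding, every class of maps into the sphere with \<open>m - e3\<close> in \<open>H\<^sup>2\<close>
  contains exactly one continuous map; it is uniformly continuous and tends to \<open>e3\<close>.
  The class is identified with that map.\<close>

definition admissible :: "(real^2 \<Rightarrow> real^3) set" where
  "admissible = {m. (\<forall>x. m x \<in> sphere 0 1) \<and> in_H2 (\<lambda>x. m x - e3) \<and>
     uniformly_continuous_on UNIV m \<and> (m \<longlongrightarrow> e3) at_infinity}"

definition degree_Q :: "(real^2 \<Rightarrow> real^3) \<Rightarrow> real" where
  "degree_Q m = 1 / (4 * pi) *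
     (LINT x|lborel. m x \<bullet> cross3 (weak_partial 1 m x) (weak_partial 2 m x))"

definition admissible_deg :: "int \<Rightarrow> (real^2 \<Rightarrow> real^3) set" where
  "admissible_deg q = {m \<in> admissible. degree_Q m = of_int q}"

definition energy :: "real \<Rightarrow> (real^2 \<Rightarrow> real^3) \<Rightarrow> real" where
  "energy H m = (LINT x|lborel.
     - (1/2) * grad_sq m x + 1/2 * (norm (weak_laplacian m x))\<^sup>2 + H * (1 - m x $ 3))"

definition min_energy :: "int \<Rightarrow> real \<Rightarrow> ereal" where
  "min_energy q H = (INF m\<in>admissible_deg q. ereal (energy H m))"

section \<open>The constant\<close>

definition bessel_J :: "nat \<Rightarrow> real \<Rightarrow> real" where
  "bessel_J n x = (\<Sum>k. (- 1) ^ k / (fact k * fact (k + n)) * (x / 2) ^ (2 * k + n))"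

definition r_star :: real where
  "r_star = (LEAST r. 0 < r \<and> bessel_J 1 r = 0)"

definition b_star :: real where
  "b_star = 8 * pi * (bessel_J 0 r_star)\<^sup>2 / (1 - (bessel_J 0 r_star)\<^sup>2)"

end

theory Submission
  imports Defs
begin

text \<open>With \<open>u = m - e3\<close> one has \<open>|u|\<^sup>2 = 2 (1 - m\<^sub>3)\<close>, so integration by parts gives
  \<open>E\<^sub>H(m) = 1/2 \<integral> |\<Delta>u + u/2|\<^sup>2 + (H - 1/4) \<integral> (1 - m\<^sub>3)\<close>.

  Lower bound at \<open>H = 1/4\<close>: if \<open>m\<close> avoids \<open>- e3\<close>, its degree density is the sum of Jacobians
  \<open>J(m\<^sub>1 g, m\<^sub>2) - J(m\<^sub>2 g, m\<^sub>1)\<close> with \<open>g = 1 / (1 + m\<^sub>3)\<close>, whose integral vanishes. So nonzero degree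
  forces \<open>v = 1 - m\<^sub>3\<close>, which is nonnegative, to take the value \<open>2\<close> at some \<open>x\<^sub>0\<close>. Testing
  \<open>\<Delta>v + v/2\<close> against the radial solution of \<open>\<Delta>\<psi> + \<psi>/2 = 4 \<pi> \<delta>\<close> around \<open>x\<^sub>0\<close> that vanishes on the
  circle where \<open>J\<^sub>1\<close> first vanishes, cut off by \<open>0\<close> outside, gives at least \<open>4 \<pi> v(x\<^sub>0)\<close>, since the
  kink of \<open>\<psi>\<close> on that circle contributes with the favourable sign; the Cauchy--Schwarz inequality and
  the explicit value of the \<open>L\<^sup>2\<close> norm of \<open>\<psi>\<close> yield exactly \<open>b_star\<close>.

  The other parts use \<open>m = (sin f, 0, cos f)\<close>, of degree zero, where \<open>f\<close> is a wave
  \<open>\<epsilon> cos (x\<^sub>1 / \<surd>2)\<close> modulated on the scale \<open>R\<close>: then \<open>\<Delta>f + f/2 = O(\<epsilon> / R)\<close>. Glued to a distant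
  compactly supported map of degree \<open>q\<close> it drives the energy to \<open>-\<infinity>\<close> when \<open>H < 1/4\<close>, and with
  \<open>\<epsilon> = 1 / R\<close> it is the vanishing family at \<open>H = 1/4\<close>.

  All Sobolev calculus is done with difference quotients, which converge weakly in \<open>L\<^sup>2\<close>.\<close>

text \<open>Why the circle at the first zero of J_1: let F(t) = J_0(2 sqrt t). A radial solution psi
  ~ ln t that vanishes at t = T satisfies T psi'(T) = 1 / F(T) by the Wronskian, and its squared
  norm on the disk is 8 pi (1 / F(T)^2 - 1). The kink helps only if F(T) < 0, and the norm is
  smallest where J_0 is most negative, which is that zero. With v(x0) = 2 the Cauchy--Schwarz
  inequality reads (8 pi)^2 <= 8 pi (1 / F(T)^2 - 1) |Delta v + v/2|^2, and this is where
  \<open>b_star\<close> comes from.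

  The obstacle: psi is singular at x0 and its gradient jumps on the circle, whereas the weak
  calculus handles Lipschitz functions. So psi is replaced by its tangent for t < d and the jump by
  a ramp of slope k; first k tends to infinity, then d to 0.

  The variable t = |x - x0|^2 / 8 is r^2 / 4 for r = |x - x0| / sqrt 2; it turns area into 8 pi dt.

  Continuity at the threshold: each energy is affine and nondecreasing in H, so the infimum is
  monotone and upper semicontinuous.\<close>

section \<open>Smooth functions\<close>

lemma C_k_SucD: "C_k (Suc k) f \<Longrightarrow> C_k k f"
proof (induction k arbitrary: f)
  case 0
  then show ?case
    by (auto simp: continuous_on_eq_continuous_at intro: differentiable_imp_continuous_within)
next
  case (Suc k)
  then show ?case by auto
qed

lemma partial_deriv_eqI:
  assumes "(f has_derivative D) (at x)"
  shows "partial_deriv i f x = D (axis i 1)"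
  using assms frechet_derivative_at unfolding partial_deriv_def by metis

lemma partial_deriv_add:
  assumes "f differentiable (at x)" "g differentiable (at x)"
  shows "partial_deriv i (\<lambda>x. f x + g x) x = partial_deriv i f x + partial_deriv i g x"
  by (subst partial_deriv_eqI[OF has_derivative_add[OF assms[unfolded frechet_derivative_works]]])
    (simp add: partial_deriv_def)

lemma partial_deriv_mult:
  assumes "f differentiable (at x)" "g differentiable (at x)"
  shows "partial_deriv i (\<lambda>x. f x * g x) x = f x * partial_deriv i g x + partial_deriv i f x * g x"
  by (subst partial_deriv_eqI[OF has_derivative_mult[OF assms[unfolded frechet_derivative_works]]])
    (simp add: partial_deriv_def)

lemma C_k_add: "C_k k f \<Longrightarrow> C_k k g \<Longrightarrow> C_k k (\<lambda>x. f x + g x)"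
proof (induction k arbitrary: f g)
  case 0
  then show ?case by (auto intro: continuous_intros)
next
  case (Suc k)
  then have "partial_deriv i (\<lambda>x. f x + g x) = (\<lambda>x. partial_deriv i f x + partial_deriv i g x)" for i
    by (auto simp: partial_deriv_add)
  with Suc show ?case by (auto intro: derivative_intros)
qed

lemma C_k_mult: "C_k k f \<Longrightarrow> C_k k g \<Longrightarrow> C_k k (\<lambda>x. f x * g x)"
proof (induction k arbitrary: f g)
  case 0
  then show ?case by (auto intro: continuous_intros)
next
  case (Suc k)
  then have "partial_deriv i (\<lambda>x. f x * g x) = (\<lambda>x. f x * partial_deriv i g x + partial_deriv i f x * g x)" for i
    by (auto simp: partial_deriv_mult)
  moreover have "C_k k f" "C_k k g" using Suc.prems C_k_SucD by blast+
  ultimately show ?case using Suc by (auto intro!: derivative_intros C_k_add)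
qed

lemma C_k_const: "C_k k (\<lambda>x. c)"
proof (induction k arbitrary: c)
  case (Suc k)
  have "partial_deriv i (\<lambda>x::real^'a. c) = (\<lambda>x. 0)" for i
    by (auto intro!: partial_deriv_eqI[OF has_derivative_const, THEN trans])
  with Suc show ?case by simp
qed simp

lemma C_k_linear: "bounded_linear f \<Longrightarrow> C_k k f"
proof (induction k)
  case 0
  then show ?case by (auto intro: linear_continuous_on)
next
  case (Suc k)
  have "partial_deriv i f = (\<lambda>x. f (axis i 1))" for i
    using Suc.prems by (auto intro!: partial_deriv_eqI bounded_linear_imp_has_derivative)
  with Suc C_k_const show ?case by (auto intro: bounded_linear_imp_differentiable)
qed

lemma C_k_polynomial: "real_polynomial_function f \<Longrightarrow> C_k k f"
  by (induction rule: real_polynomial_function.induct)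
    (auto intro: C_k_linear C_k_const C_k_add C_k_mult)

text \<open>A class G closed under differentiation stands for the smooth functions of one variable:
  the induction on k has to be applied to the derivative of g, which must lie in G again. The class
  used below is the range of \<open>flat_exp\<close>.\<close>

lemma C_k_compose:
  assumes G: "\<And>g. g \<in> G \<Longrightarrow> \<exists>g'\<in>G. \<forall>y. (g has_real_derivative g' y) (at y)"
  shows "g \<in> G \<Longrightarrow> (\<And>k. C_k k f) \<Longrightarrow> C_k k (\<lambda>x. g (f x))"
proof (induction k arbitrary: g)
  case 0
  obtain g' where g': "\<And>y. (g has_real_derivative g' y) (at y)" using G 0 by blast
  then have "continuous_on UNIV g" by (meson DERIV_isCont continuous_at_imp_continuous_on)
  moreover have "continuous_on UNIV f" using 0(2)[of 0] by simp
  ultimately show ?case by (auto intro: continuous_on_compose2)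
next
  case (Suc k)
  obtain g' where g': "g' \<in> G" "\<And>y. (g has_real_derivative g' y) (at y)" using G Suc by blast
  have f: "(f has_derivative frechet_derivative f (at x)) (at x)" for x
    using Suc.prems(2)[of 1] by (simp add: frechet_derivative_works)
  have d: "((\<lambda>x. g (f x)) has_derivative (\<lambda>h. frechet_derivative f (at x) h * g' (f x))) (at x)" for x
    by (rule DERIV_compose_FDERIV[OF g'(2) f])
  have "partial_deriv i (\<lambda>x. g (f x)) = (\<lambda>x. partial_deriv i f x * g' (f x))" for i
    using partial_deriv_eqI[OF d] by (auto simp: partial_deriv_def)
  moreover have "C_k k (partial_deriv i f)" for i using Suc.prems(2)[of "Suc k"] by simp
  ultimately show ?case using Suc d g'
    by (simp add: C_k_mult) (metis differentiable_def)
qed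

section \<open>Smooth bump functions from exp(-1/y)\<close>

definition flat_exp :: "real poly \<Rightarrow> real \<Rightarrow> real" where
  "flat_exp p y = (if y > 0 then poly p (1/y) * exp (- 1/y) else 0)"

lemma flat_exp_tendsto: "(flat_exp p \<longlongrightarrow> 0) (at 0)"
proof -
  have m: "((\<lambda>y. c * (1/y)^n * exp (- 1/y)) \<longlongrightarrow> 0) (at_right 0)" for c::real and n
  proof -
    have "((\<lambda>x. c * (x ^ n / exp x)) \<longlongrightarrow> c * 0) at_top"
      by (intro tendsto_intros tendsto_power_div_exp_0)
    then have "((\<lambda>y. c * (inverse y ^ n / exp (inverse y))) \<longlongrightarrow> c * 0) (at_right 0)"
      using filterlim_inverse_at_top_right by (rule filterlim_compose)
    then show ?thesis by (simp add: exp_minus field_simps)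
  qed
  have "((\<lambda>y. \<Sum>n\<le>degree p. coeff p n * (1/y)^n * exp (- 1/y)) \<longlongrightarrow> (\<Sum>n\<le>degree p. 0)) (at_right 0)"
    by (intro tendsto_sum m)
  then have "((\<lambda>y. poly p (1/y) * exp (- 1/y)) \<longlongrightarrow> 0) (at_right 0)"
    by (simp add: poly_altdef sum_distrib_right)
  then have "(flat_exp p \<longlongrightarrow> 0) (at_right 0)"
    by (rule Lim_transform_eventually) (auto simp: flat_exp_def eventually_at_filter)
  moreover have "(flat_exp p \<longlongrightarrow> 0) (at_left 0)"
    by (rule Lim_transform_eventually[OF tendsto_const]) (auto simp: flat_exp_def eventually_at_filter)
  ultimately show ?thesis by (simp add: filterlim_split_at_real)
qed

text \<open>In the variable z = 1/y one has d/dy = - z^2 d/dz, which sends p(z) exp(-z) to z^2 (p -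
  p') exp(-z); the polynomial \<open>[:0,0,1:]\<close> is z^2. So the family is closed under
  differentiation, also across the origin.\<close>

lemma flat_exp_deriv:
  "(flat_exp p has_real_derivative flat_exp ([:0,0,1:] * (p - pderiv p)) y) (at y)"
proof -
  consider "y > 0" | "y < 0" | "y = 0" by linarith
  then show ?thesis
  proof cases
    case 1
    have "((\<lambda>y. poly p (1/y) * exp (- 1/y)) has_real_derivative
        (poly (pderiv p) (1/y) * (-1/y^2)) * exp (- 1/y) + poly p (1/y) * (exp (- 1/y) * (1/y^2))) (at y)"
      using 1 by (auto intro!: derivative_eq_intros DERIV_chain2[OF poly_DERIV] simp: power2_eq_square)
    also have "(poly (pderiv p) (1/y) * (-1/y^2)) * exp (- 1/y) + poly p (1/y) * (exp (- 1/y) * (1/y^2))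
       = flat_exp ([:0,0,1:] * (p - pderiv p)) y"
      using 1 by (simp add: flat_exp_def field_simps power2_eq_square)
    finally show ?thesis
      by (rule DERIV_cong_ev[THEN iffD1, OF refl _ refl, rotated])
        (use 1 in \<open>auto simp: flat_exp_def eventually_nhds intro!: exI[of _ "{0<..}"]\<close>)
  next
    case 2
    have "((\<lambda>y. 0) has_real_derivative flat_exp ([:0,0,1:] * (p - pderiv p)) y) (at y)"
      using 2 by (simp add: flat_exp_def)
    then show ?thesis
      by (rule DERIV_cong_ev[THEN iffD1, OF refl _ refl, rotated])
        (use 2 in \<open>auto simp: flat_exp_def eventually_nhds intro!: exI[of _ "{..<0}"]\<close>)
  next
    case 3
    \<comment> \<open>Division by h multiplies the polynomial by z = 1/h, so the difference quotient
      at 0 is again a \<open>flat_exp\<close>.\<close>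
    have "((\<lambda>h. flat_exp p h / h) \<longlongrightarrow> 0) (at 0)"
      by (rule Lim_transform_eventually[OF flat_exp_tendsto[of "[:0,1:] * p"]])
        (auto simp: flat_exp_def eventually_at_filter field_simps)
    then show ?thesis using 3 by (simp add: DERIV_def flat_exp_def)
  qed
qed

text \<open>The function exp(-1/y) at y = R^2 - |x|^2, a polynomial in the coordinates; smoothness
  then follows from \<open>C_k_polynomial\<close> and \<open>C_k_compose\<close>.\<close>

lemma bump_exists:
  fixes R :: real
  assumes R: "R > 0"
  obtains \<beta> :: "real^'n \<Rightarrow> real" where "test_function \<beta>"
    "\<And>x. norm x < R \<Longrightarrow> \<beta> x > 0" "\<And>x. norm x \<ge> R \<Longrightarrow> \<beta> x = 0"
proof -
  let ?g = "\<lambda>x::real^'n. R^2 - (\<Sum>i\<in>UNIV. (x$i)^2)"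
  have nrm: "norm x ^2 = (\<Sum>i\<in>UNIV. (x$i)^2)" for x :: "real^'n"
    by (simp add: norm_vec_def L2_set_def sum_nonneg)
  have comp: "real_polynomial_function (\<lambda>x::real^'n. x$i)" for i
    by (intro real_polynomial_function.intros(1) bounded_linear_vec_nth)
  have "real_polynomial_function ?g"
    by (intro real_polynomial_function_diff real_polynomial_function_sum real_polynomial_function_power
        comp real_polynomial_function.intros(2)) auto
  then have "C_k k ?g" for k by (rule C_k_polynomial)
  then have C: "C_k k (\<lambda>x. flat_exp 1 (?g x))" for k
    by (rule C_k_compose[of "range flat_exp", rotated 2]) (use flat_exp_deriv in blast)+
  have z: "flat_exp 1 (?g x) = 0" if "norm x \<ge> R" for x
    using that R unfolding nrm[symmetric] flat_exp_def by (auto simp: not_less intro: power_mono)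
  have p: "flat_exp 1 (?g x) > 0" if "norm x < R" for x
  proof -
    have "norm x ^2 < R^2" using that by (simp add: power_strict_mono)
    then show ?thesis unfolding nrm[symmetric] flat_exp_def by simp
  qed
  have "test_function (\<lambda>x. flat_exp 1 (?g x))"
    unfolding test_function_def using C z by (auto intro!: exI[of _ "cball 0 R"])
  with z p that show ?thesis by blast
qed

section \<open>Test functions and weak derivatives\<close>

lemma C_k_translate: "C_k k f \<Longrightarrow> C_k k (\<lambda>x. f (x + a))"
proof (induction k arbitrary: f)
  case 0
  then show ?case by (auto intro!: continuous_on_compose2[of UNIV f] continuous_intros)
next
  case (Suc k)
  have "(f has_derivative frechet_derivative f (at (x + a))) (at (x + a))" for x
    using Suc.prems by (simp add: frechet_derivative_works)
  then have d: "((\<lambda>x. f (x + a)) has_derivative frechet_derivative f (at (x + a))) (at x)" for x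
    by (rule has_derivative_compose[where g = f and f = "\<lambda>x. x + a" and f' = "\<lambda>h. h", rotated])
      (auto intro!: derivative_eq_intros)
  have "partial_deriv i (\<lambda>x. f (x + a)) = (\<lambda>x. partial_deriv i f (x + a))" for i
    using partial_deriv_eqI[OF d] by (auto simp: partial_deriv_def)
  then show ?case using Suc d by (auto simp: differentiable_def)
qed

lemma test_function_support:
  assumes "test_function \<phi>"
  obtains R where "R > 0" "\<And>x. norm x \<ge> R \<Longrightarrow> \<phi> x = 0"
proof -
  obtain K where K: "compact K" "\<And>x. x \<notin> K \<Longrightarrow> \<phi> x = 0"
    using assms unfolding test_function_def by blast
  obtain b where b: "\<And>x. x \<in> K \<Longrightarrow> norm x \<le> b" "b > 0"
    using compact_imp_bounded[OF K(1)] bounded_pos by metis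
  show ?thesis by (rule that[of "b + 1"]) (use b K in force)+
qed

lemma test_functionI:
  "(\<And>k. C_k k \<phi>) \<Longrightarrow> (\<And>x. norm x \<ge> R \<Longrightarrow> \<phi> x = 0) \<Longrightarrow> test_function \<phi>"
  unfolding test_function_def by (auto intro!: exI[of _ "cball 0 R"])

lemma test_function_continuous: "test_function \<phi> \<Longrightarrow> continuous_on UNIV \<phi>"
  unfolding test_function_def by (metis C_k.simps(1))

lemma test_function_measurable [measurable_dest]: "test_function \<phi> \<Longrightarrow> \<phi> \<in> borel_measurable borel"
  by (intro borel_measurable_continuous_onI test_function_continuous)

lemma test_function_differentiable: "test_function \<phi> \<Longrightarrow> \<phi> differentiable (at x)"
  unfolding test_function_def using C_k.simps(2) by blast

lemma test_function_partial:
  assumes "test_function \<phi>" shows "test_function (partial_deriv i \<phi>)"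
proof -
  obtain R where R: "R > 0" "\<And>x. norm x \<ge> R \<Longrightarrow> \<phi> x = 0"
    using test_function_support[OF assms] by blast
  show ?thesis
  proof (rule test_functionI)
    show "C_k k (partial_deriv i \<phi>)" for k
      using assms C_k.simps(2) unfolding test_function_def by blast
    fix x :: "real^'a" assume x: "norm x \<ge> R + 1"
    have "(\<phi> has_derivative (\<lambda>h. 0)) (at x)"
    proof (rule has_derivative_transform_within_open[of "\<lambda>_. 0" _ _ _ "- cball 0 R"])
      show "((\<lambda>_. 0) has_derivative (\<lambda>h. 0)) (at x)" by simp
    qed (use x R in auto)
    then show "partial_deriv i \<phi> x = 0" by (rule partial_deriv_eqI)
  qed
qed

lemma test_function_translate:
  assumes "test_function \<phi>" shows "test_function (\<lambda>x. \<phi> (x + a))"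
proof -
  obtain R where R: "R > 0" "\<And>x. norm x \<ge> R \<Longrightarrow> \<phi> x = 0"
    using test_function_support[OF assms] by blast
  show ?thesis
  proof (rule test_functionI)
    show "C_k k (\<lambda>x. \<phi> (x + a))" for k
      using assms C_k_translate unfolding test_function_def by blast
    show "\<phi> (x + a) = 0" if "norm x \<ge> R + norm a" for x
      by (rule R(2)) (use that norm_diff_ineq[of x a] in linarith)
  qed
qed

lemma test_function_bounded:
  assumes "test_function \<phi>"
  obtains B where "B \<ge> 0" "\<And>x. \<bar>\<phi> x\<bar> \<le> B"
proof -
  obtain R where R: "R > 0" "\<And>x. norm x \<ge> R \<Longrightarrow> \<phi> x = 0"
    using test_function_support[OF assms] by blast
  have "compact (\<phi> ` cball 0 R)"
    by (intro compact_continuous_image) (auto intro: continuous_on_subset[OF test_function_continuous[OF assms]])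
  then obtain B where "\<And>y. y \<in> \<phi> ` cball 0 R \<Longrightarrow> norm y \<le> B" "B > 0"
    using compact_imp_bounded bounded_pos by metis
  then have "\<bar>\<phi> x\<bar> \<le> B" for x
    using R(2)[of x] by (cases "norm x \<le> R") auto
  then show ?thesis using \<open>B > 0\<close> by (intro that[of B]) auto
qed

lemma test_function_has_derivative_line:
  assumes "test_function \<phi>"
  shows "((\<lambda>t. \<phi> (x + t *\<^sub>R axis i 1)) has_real_derivative partial_deriv i \<phi> (x + t *\<^sub>R axis i 1)) (at t)"
proof -
  let ?y = "x + t *\<^sub>R axis i 1"
  have d: "(\<phi> has_derivative frechet_derivative \<phi> (at ?y)) (at ?y)"
    using test_function_differentiable[OF assms] by (simp add: frechet_derivative_works)
  have "((\<lambda>t. \<phi> (x + t *\<^sub>R axis i 1)) has_derivative (\<lambda>h. frechet_derivative \<phi> (at ?y) (h *\<^sub>R axis i 1))) (at t)"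
    by (rule has_derivative_compose[where f = "\<lambda>t. x + t *\<^sub>R axis i 1" and g = \<phi>, OF _ d])
      (auto intro!: derivative_eq_intros)
  moreover have "frechet_derivative \<phi> (at ?y) (h *\<^sub>R axis i 1) = partial_deriv i \<phi> ?y * h" for h
    using linear_scale[OF has_derivative_linear[OF d]] by (simp add: partial_deriv_def mult.commute)
  ultimately show ?thesis by (simp add: has_field_derivative_def)
qed

lemma lipschitz_of_line_derivative:
  fixes f :: "real \<Rightarrow> 'b::real_normed_vector"
  assumes "\<And>t. (f has_vector_derivative f' t) (at t)" "\<And>t. norm (f' t) \<le> L"
  shows "norm (f t - f s) \<le> L * \<bar>t - s\<bar>"
proof -
  have o: "onorm (\<lambda>h. h *\<^sub>R f' x) \<le> L" for x
    by (rule onorm_le) (use mult_right_mono[OF assms(2)[of x] abs_ge_zero] in \<open>simp add: mult.commute\<close>)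
  have "norm (f t - f s) \<le> L * norm (t - s)"
    by (rule differentiable_bound[of UNIV f "\<lambda>x h. h *\<^sub>R f' x"])
      (use assms(1) o in \<open>auto simp: has_vector_derivative_def\<close>)
  then show ?thesis by simp
qed

lemma test_function_lipschitz:
  assumes "test_function \<phi>"
  obtains L where "L \<ge> 0" "\<And>x t. \<bar>\<phi> (x + t *\<^sub>R axis i 1) - \<phi> x\<bar> \<le> L * \<bar>t\<bar>"
proof -
  obtain L where L: "L \<ge> 0" "\<And>x. \<bar>partial_deriv i \<phi> x\<bar> \<le> L"
    using test_function_bounded[OF test_function_partial[OF assms]] by metis
  show ?thesis
  proof (rule that[OF L(1)])
    fix x t
    have "norm (\<phi> (x + t *\<^sub>R axis i 1) - \<phi> (x + 0 *\<^sub>R axis i 1)) \<le> L * \<bar>t - 0\<bar>"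
      by (rule lipschitz_of_line_derivative[where f = "\<lambda>t. \<phi> (x + t *\<^sub>R axis i 1)"])
        (use test_function_has_derivative_line[OF assms] L in
          \<open>auto simp: has_real_derivative_iff_has_vector_derivative\<close>)
    then show "\<bar>\<phi> (x + t *\<^sub>R axis i 1) - \<phi> x\<bar> \<le> L * \<bar>t\<bar>" by simp
  qed
qed

text \<open>The cut-offs of u to the balls of radius n are integrable, hence measurable, and
  converge pointwise to u.\<close>

lemma locally_integrable_measurable:
  fixes u :: "real^'n \<Rightarrow> 'b::euclidean_space"
  assumes "locally_integrable u" shows "u \<in> borel_measurable borel"
proof -
  have "(\<lambda>x. indicator (cball 0 (real n)) x *\<^sub>R u x) \<in> borel_measurable borel" for n
  proof -
    have "integrable lborel (\<lambda>x. indicator (cball 0 (real n)) x *\<^sub>R u x)"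
      using assms compact_cball unfolding locally_integrable_def set_integrable_def by blast
    from borel_measurable_integrable[OF this] show ?thesis by simp
  qed
  moreover have "(\<lambda>n. indicator (cball 0 (real n)) x *\<^sub>R u x) \<longlonglongrightarrow> u x" for x :: "real^'n"
  proof (rule tendsto_eventually)
    show "\<forall>\<^sub>F n in sequentially. indicator (cball 0 (real n)) x *\<^sub>R u x = u x"
      using eventually_ge_at_top[of "nat \<lceil>norm x\<rceil>"]
    proof eventually_elim
      case (elim n)
      then have "x \<in> cball 0 (real n)" by (simp add: nat_le_iff ceiling_le_iff)
      then show ?case by simp
    qed
  qed
  ultimately show ?thesis by (rule borel_measurable_LIMSEQ_metric)
qed

lemma integrable_compact_support:
  fixes u :: "real^'n \<Rightarrow> 'b::euclidean_space"
  assumes u: "locally_integrable u" and [measurable]: "\<phi> \<in> borel_measurable borel"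
    and b: "\<And>x. \<bar>\<phi> x\<bar> \<le> B" and s: "\<And>x. norm x \<ge> R \<Longrightarrow> \<phi> x = 0"
  shows "integrable lborel (\<lambda>x. \<phi> x *\<^sub>R u x)"
proof (rule Bochner_Integration.integrable_bound)
  show "integrable lborel (\<lambda>x. B *\<^sub>R (indicator (cball 0 R) x *\<^sub>R u x))"
    using u unfolding locally_integrable_def set_integrable_def by (intro integrable_scaleR_right) auto
  note [measurable] = locally_integrable_measurable[OF u]
  show "(\<lambda>x. \<phi> x *\<^sub>R u x) \<in> borel_measurable lborel" by measurable
  show "AE x in lborel. norm (\<phi> x *\<^sub>R u x) \<le> norm (B *\<^sub>R (indicator (cball 0 R) x *\<^sub>R u x))"
  proof (rule AE_I2)
    fix x
    have "B \<ge> 0" using b[of 0] by linarith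
    then show "norm (\<phi> x *\<^sub>R u x) \<le> norm (B *\<^sub>R (indicator (cball 0 R) x *\<^sub>R u x))"
      using b[of x] s[of x] by (cases "norm x \<le> R") (auto simp: mult_right_mono)
  qed
qed

lemma integrable_test_function:
  fixes u :: "real^'n \<Rightarrow> 'b::euclidean_space"
  assumes "test_function \<phi>" "locally_integrable u"
  shows "integrable lborel (\<lambda>x. \<phi> x *\<^sub>R u x)"
proof -
  obtain R where "\<And>x. norm x \<ge> R \<Longrightarrow> \<phi> x = 0" using test_function_support[OF assms(1)] by blast
  moreover obtain B where "\<And>x. \<bar>\<phi> x\<bar> \<le> B" using test_function_bounded[OF assms(1)] by blast
  ultimately show ?thesis
    using integrable_compact_support[OF assms(2) test_function_measurable[OF assms(1)]] by blast
qed

lemma locally_integrable_bounded: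
  fixes u :: "real^'n \<Rightarrow> 'b::euclidean_space"
  assumes [measurable]: "u \<in> borel_measurable borel" and "\<And>x. norm (u x) \<le> B"
  shows "locally_integrable u"
  unfolding locally_integrable_def set_integrable_def
proof (intro allI impI)
  fix K :: "(real^'n) set" assume "compact K"
  then have [measurable]: "K \<in> sets borel" by (simp add: borel_compact)
  have "emeasure lborel K < \<infinity>" by (intro emeasure_compact_finite \<open>compact K\<close>)
  then have "integrable lborel (\<lambda>x. B * indicator K x)" by (intro integrable_mult_right integrable_real_indicator) auto
  then show "integrable lborel (\<lambda>x. indicator K x *\<^sub>R u x)"
  proof (rule Bochner_Integration.integrable_bound)
    show "(\<lambda>x. indicator K x *\<^sub>R u x) \<in> borel_measurable lborel" by measurable
    show "AE x in lborel. norm (indicator K x *\<^sub>R u x) \<le> norm (B * indicator K x)"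
      using order_trans[OF assms(2) abs_ge_self] by (auto simp: indicator_def)
  qed
qed

section \<open>Square integrable functions and translation invariance\<close>

lemma in_L2_measurable: "in_L2 u \<Longrightarrow> u \<in> borel_measurable borel"
  unfolding in_L2_def by simp

lemma in_L2_integrable_mult:
  fixes f g :: "real^'n \<Rightarrow> real"
  assumes "in_L2 f" "in_L2 g" shows "integrable lborel (\<lambda>x. f x * g x)"
proof (rule Bochner_Integration.integrable_bound)
  show "integrable lborel (\<lambda>x. (norm (f x))\<^sup>2 + (norm (g x))\<^sup>2)"
    using assms unfolding in_L2_def by auto
  show "(\<lambda>x. f x * g x) \<in> borel_measurable lborel" using assms unfolding in_L2_def by auto
  have "\<bar>a * b\<bar> \<le> a^2 + b^2" for a b :: real
    using sum_squares_bound[of "\<bar>a\<bar>" "\<bar>b\<bar>"] mult_nonneg_nonneg[OF abs_ge_zero[of a] abs_ge_zero[of b]]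
    unfolding abs_mult power2_abs by linarith
  then show "AE x in lborel. norm (f x * g x) \<le> norm ((norm (f x))\<^sup>2 + (norm (g x))\<^sup>2)" by auto
qed

lemma in_L2_locally_integrable:
  fixes u :: "real^'n \<Rightarrow> 'b::euclidean_space"
  assumes "in_L2 u" shows "locally_integrable u"
  unfolding locally_integrable_def set_integrable_def
proof (intro allI impI)
  fix K :: "(real^'n) set" assume "compact K"
  then have [measurable]: "K \<in> sets borel" by (simp add: borel_compact)
  have "emeasure lborel K < \<infinity>" by (intro emeasure_compact_finite \<open>compact K\<close>)
  then have "integrable lborel (\<lambda>x. indicator K x + (norm (u x))^2)"
    using assms unfolding in_L2_def by (intro Bochner_Integration.integrable_add integrable_real_indicator) auto
  then show "integrable lborel (\<lambda>x. indicator K x *\<^sub>R u x)"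
  proof (rule Bochner_Integration.integrable_bound)
    show "(\<lambda>x. indicator K x *\<^sub>R u x) \<in> borel_measurable lborel"
      using in_L2_measurable[OF assms] by measurable
    have "a \<le> 1 + a^2" for a :: real using zero_le_power2[of "a - 1/2"] by (simp add: power2_eq_square algebra_simps)
    then show "AE x in lborel. norm (indicator K x *\<^sub>R u x) \<le> norm (indicator K x + (norm (u x))\<^sup>2)"
      by (auto simp: indicator_def)
  qed
qed

lemma integral_translate:
  fixes f :: "real^'n \<Rightarrow> 'b::euclidean_space"
  assumes "f \<in> borel_measurable borel"
  shows "(LINT x|lborel. f (x + a)) = (LINT x|lborel. f x)"
    and "integrable lborel (\<lambda>x. f (x + a)) \<longleftrightarrow> integrable lborel f"
proof -
  have *: "lborel = distr lborel borel (\<lambda>x. x + a)" 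
  proof -
    have "(\<lambda>x. x + a) = (+) a" by (auto simp: add.commute)
    then show ?thesis using lborel_distr_plus[of a] by simp
  qed
  show "(LINT x|lborel. f (x + a)) = (LINT x|lborel. f x)"
    by (subst (2) *, subst integral_distr) (use assms in auto)
  show "integrable lborel (\<lambda>x. f (x + a)) \<longleftrightarrow> integrable lborel f"
    by (subst (2) *, subst integrable_distr_eq) (use assms in auto)
qed

text \<open>The difference quotients of \<open>f\<close> have integral zero by translation invariance, and they
  converge to \<open>g\<close>.\<close>

lemma integral_line_derivative_eq_0:
  fixes f g :: "real^'n \<Rightarrow> 'b::euclidean_space"
  assumes f: "integrable lborel f" and g [measurable]: "g \<in> borel_measurable borel"
    and w: "integrable lborel w"
    and lip: "\<And>x t. 0 < t \<Longrightarrow> t \<le> 1 \<Longrightarrow> norm (f (x + t *\<^sub>R axis i 1) - f x) \<le> t * w x"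
    and der: "AE x in lborel. ((\<lambda>t. f (x + t *\<^sub>R axis i 1)) has_vector_derivative g x) (at 0)"
  shows "integrable lborel g" and "(LINT x|lborel. g x) = 0"
proof -
  have [measurable]: "f \<in> borel_measurable borel" using f by auto
  define s where "s n x = (1 / inverse (real (Suc n))) *\<^sub>R (f (x + inverse (real (Suc n)) *\<^sub>R axis i 1) - f x)" for n x
  have conv: "AE x in lborel. (\<lambda>n. s n x) \<longlonglongrightarrow> g x"
    using der
  proof eventually_elim
    case (elim x)
    have "((\<lambda>h. (1 / h) *\<^sub>R (f (x + h *\<^sub>R axis i 1) - f x)) \<longlongrightarrow> g x) (at 0)"
    proof (rule Lim_null[THEN iffD2], rule tendsto_norm_zero_cancel)
      have "((\<lambda>h. norm (f (x + h *\<^sub>R axis i 1) - f x - h *\<^sub>R g x) / norm h) \<longlongrightarrow> 0) (at 0)"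
        using elim unfolding has_vector_derivative_def has_derivative_at by simp
      then show "((\<lambda>h. norm ((1 / h) *\<^sub>R (f (x + h *\<^sub>R axis i 1) - f x) - g x)) \<longlongrightarrow> 0) (at 0)"
      proof (rule Lim_transform_eventually, intro eventually_at_filter[THEN iffD2] always_eventually allI impI)
        fix h :: real assume "h \<noteq> 0"
        then have "(1 / h) *\<^sub>R (f (x + h *\<^sub>R axis i 1) - f x) - g x
          = (1 / h) *\<^sub>R (f (x + h *\<^sub>R axis i 1) - f x - h *\<^sub>R g x)" by (simp add: scaleR_diff_right)
        then show "norm (f (x + h *\<^sub>R axis i 1) - f x - h *\<^sub>R g x) / norm h
          = norm ((1 / h) *\<^sub>R (f (x + h *\<^sub>R axis i 1) - f x) - g x)" by simp
      qed
    qed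
    moreover have "filterlim (\<lambda>n. inverse (real (Suc n))) (at 0) sequentially"
      using LIMSEQ_inverse_real_of_nat by (simp add: filterlim_at del: of_nat_Suc)
    ultimately show ?case unfolding s_def by (rule filterlim_compose)
  qed
  have bd: "AE x in lborel. norm (s n x) \<le> w x" for n
  proof (rule AE_I2)
    fix x show "norm (s n x) \<le> w x"
    proof -
      define r where "r = inverse (real (Suc n))"
      have r: "0 < r" "r \<le> 1" unfolding r_def by (auto simp: field_simps)
      have "norm ((1 / r) *\<^sub>R (f (x + r *\<^sub>R axis i 1) - f x)) \<le> (1 / r) * (r * w x)"
        unfolding norm_scaleR using r lip[OF r, of x] by (intro mult_mono) auto
      then show ?thesis using r unfolding s_def r_def[symmetric] by simp
    qed
  qed
  have [measurable]: "s n \<in> borel_measurable lborel" for n unfolding s_def by measurable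
  have z: "(LINT x|lborel. s n x) = 0" for n
    unfolding s_def using f integral_translate[of f] by (simp add: Bochner_Integration.integral_diff)
  show "integrable lborel g"
    by (rule integrable_dominated_convergence[OF _ _ w conv bd]) auto
  have "(\<lambda>n. LINT x|lborel. s n x) \<longlonglongrightarrow> (LINT x|lborel. g x)"
    by (rule integral_dominated_convergence[OF _ _ w conv bd]) auto
  then show "(LINT x|lborel. g x) = 0" unfolding z by (simp add: LIMSEQ_const_iff)
qed

text \<open>The product of f with a test function has an almost everywhere line derivative given by
  the product rule, and the integral of a line derivative vanishes. Asking for differentiability
  only almost everywhere admits profiles with kinks.\<close>

lemma weak_partialI:
  fixes f g :: "real^'n \<Rightarrow> 'b::euclidean_space"
  assumes f [measurable]: "f \<in> borel_measurable borel" and g: "locally_integrable g"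
    and b: "\<And>x. norm (f x) \<le> M"
    and lip: "\<And>x t. norm (f (x + t *\<^sub>R axis i 1) - f x) \<le> L * \<bar>t\<bar>"
    and der: "AE x in lborel. ((\<lambda>t. f (x + t *\<^sub>R axis i 1)) has_vector_derivative g x) (at 0)"
  shows "has_weak_partial i f g"
  unfolding has_weak_partial_def
proof (intro conjI allI impI)
  show lf: "locally_integrable f" by (rule locally_integrable_bounded[OF f b])
  show "locally_integrable g" by fact
  note [measurable] = locally_integrable_measurable[OF g]
  fix \<phi> :: "real^'n \<Rightarrow> real" assume t: "test_function \<phi>"
  obtain R where R: "R > 0" "\<And>x. norm x \<ge> R \<Longrightarrow> \<phi> x = 0" using test_function_support[OF t] by blast
  obtain C where C: "C \<ge> 0" "\<And>x. \<bar>\<phi> x\<bar> \<le> C" using test_function_bounded[OF t] by blast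
  obtain K where K: "K \<ge> 0" "\<And>x t. \<bar>\<phi> (x + t *\<^sub>R axis i 1) - \<phi> x\<bar> \<le> K * \<bar>t\<bar>"
    using test_function_lipschitz[OF t] by blast
  note [measurable] = test_function_measurable[OF t] test_function_measurable[OF test_function_partial[OF t]]
  have M: "M \<ge> 0" using b[of 0] norm_ge_zero[of "f 0"] by linarith
  have L: "L \<ge> 0" using order_trans[OF norm_ge_zero lip[of 0 1]] by simp
  \<comment> \<open>The product rule bounds increments by K M + C L times the step. Steps of length
    at most 1 move the support by at most 1, whence the radius R + 1.\<close>
  define w :: "real^'n \<Rightarrow> real" where "w x = (K * M + C * L) * indicator (cball 0 (R + 1)) x" for x
  have w: "integrable lborel w" unfolding w_def
    using emeasure_compact_finite[OF compact_cball, of 0 "R + 1"]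
    by (intro integrable_mult_right integrable_real_indicator) auto
  have i1: "integrable lborel (\<lambda>x. \<phi> x *\<^sub>R f x)" "integrable lborel (\<lambda>x. \<phi> x *\<^sub>R g x)"
    "integrable lborel (\<lambda>x. partial_deriv i \<phi> x *\<^sub>R f x)"
    using integrable_test_function t test_function_partial lf g by blast+
  have "(LINT x|lborel. partial_deriv i \<phi> x *\<^sub>R f x + \<phi> x *\<^sub>R g x) = 0"
  proof (rule integral_line_derivative_eq_0(2)[OF i1(1) _ w])
    show "(\<lambda>x. partial_deriv i \<phi> x *\<^sub>R f x + \<phi> x *\<^sub>R g x) \<in> borel_measurable borel" by measurable
    show "AE x in lborel. ((\<lambda>t. \<phi> (x + t *\<^sub>R axis i 1) *\<^sub>R f (x + t *\<^sub>R axis i 1)) has_vector_derivative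
            partial_deriv i \<phi> x *\<^sub>R f x + \<phi> x *\<^sub>R g x) (at 0)"
      using der
    proof eventually_elim
      case (elim x)
      show ?case
        using has_vector_derivative_scaleR[OF test_function_has_derivative_line[OF t, of x i 0] elim] by (simp add: add.commute)
    qed
    fix x t :: "real^'n" and s :: real
    assume s: "0 < s" "s \<le> 1"
    let ?y = "x + s *\<^sub>R axis i 1"
    show "norm (\<phi> ?y *\<^sub>R f ?y - \<phi> x *\<^sub>R f x) \<le> s * w x"
    proof (cases "norm x \<le> R + 1")
      case True
      have "\<phi> ?y *\<^sub>R f ?y - \<phi> x *\<^sub>R f x = (\<phi> ?y - \<phi> x) *\<^sub>R f ?y + \<phi> x *\<^sub>R (f ?y - f x)"
        by (simp add: algebra_simps)
      also have "norm \<dots> \<le> (K * s) * M + C * (L * s)"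
      proof (rule norm_triangle_le, rule add_mono)
        have "\<bar>\<phi> ?y - \<phi> x\<bar> \<le> K * s" using K(2)[of x s] s by simp
        then show "norm ((\<phi> ?y - \<phi> x) *\<^sub>R f ?y) \<le> (K * s) * M"
          unfolding norm_scaleR using b[of ?y] s K(1) by (intro mult_mono) auto
        have "norm (f ?y - f x) \<le> L * s" using lip[of x s] s by simp
        then show "norm (\<phi> x *\<^sub>R (f ?y - f x)) \<le> C * (L * s)"
          unfolding norm_scaleR using C by (intro mult_mono) auto
      qed
      finally show ?thesis using True by (simp add: w_def algebra_simps)
    next
      case False
      have "norm x - norm (s *\<^sub>R axis i 1 :: real^'n) \<le> norm ?y" by (rule norm_diff_ineq)
      then have "norm ?y \<ge> R" using False s by (simp add: norm_axis_1)
      then show ?thesis using R(2)[of x] R(2)[of ?y] False by (simp add: w_def)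
    qed
  qed
  then show "(LINT x|lborel. partial_deriv i \<phi> x *\<^sub>R f x) = - (LINT x|lborel. \<phi> x *\<^sub>R g x)"
    using i1 by (simp add: eq_neg_iff_add_eq_0)
qed

text \<open>This takes the place of mollification: f is divided by a bump function bounded below on
  the support, the quotient is approximated by continuous functions and these by polynomials on a
  ball, and the bump function is multiplied back. The products are smooth, uniformly bounded and
  have a common support.\<close>

lemma bounded_limit_of_test_functions:
  fixes f :: "real^'n \<Rightarrow> real"
  assumes f: "f \<in> borel_measurable borel" and b: "\<And>x. \<bar>f x\<bar> \<le> M"
    and s: "\<And>x. norm x > r \<Longrightarrow> f x = 0" and r: "r \<ge> 0"
  obtains \<phi> :: "nat \<Rightarrow> real^'n \<Rightarrow> real" and C R where "\<And>n. test_function (\<phi> n)" "\<And>n x. \<bar>\<phi> n x\<bar> \<le> C"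
    "\<And>n x. norm x \<ge> R \<Longrightarrow> \<phi> n x = 0" "AE x in lborel. (\<lambda>n. \<phi> n x) \<longlonglongrightarrow> f x" "R > r"
proof -
  obtain \<beta> :: "real^'n \<Rightarrow> real" where \<beta>: "test_function \<beta>"
    "\<And>x. norm x < r + 1 \<Longrightarrow> \<beta> x > 0" "\<And>x. norm x \<ge> r + 1 \<Longrightarrow> \<beta> x = 0"
    using bump_exists[of "r + 1"] r by auto
  note [measurable] = test_function_measurable[OF \<beta>(1)] f
  obtain x0 where x0: "x0 \<in> cball 0 r" "\<And>x. x \<in> cball 0 r \<Longrightarrow> \<beta> x0 \<le> \<beta> x"
    using continuous_attains_inf[of "cball 0 r" \<beta>] r test_function_continuous[OF \<beta>(1)]
    by (metis compact_cball cball_eq_empty continuous_on_subset not_less top_greatest)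
  define c where "c = \<beta> x0"
  have c: "c > 0" "\<And>x. norm x \<le> r \<Longrightarrow> \<beta> x \<ge> c" unfolding c_def using x0 \<beta>(2)[of x0] by auto
  define F where "F x = f x / \<beta> x" for x
  have M: "M \<ge> 0" using b[of 0] by linarith
  define K where "K = M / c"
  have K: "K \<ge> 0" unfolding K_def using M c by simp
  have F: "\<bar>F x\<bar> \<le> K" for x
  proof (cases "norm x \<le> r")
    case True
    then show ?thesis unfolding F_def K_def abs_divide using b[of x] c(1) c(2)[of x] M by (intro frac_le) auto
  qed (use s K in \<open>auto simp: F_def\<close>)
  have "F \<in> borel_measurable borel" unfolding F_def by measurable
  then have "F \<in> borel_measurable lebesgue" by (intro measurable_completion) simp
  then have "F measurable_on UNIV" by (intro lebesgue_measurable_imp_measurable_on) auto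
  then obtain N g where N: "negligible N" and g: "\<And>n. continuous_on UNIV (g n)"
    "\<And>x. x \<notin> N \<Longrightarrow> (\<lambda>n. g n x) \<longlonglongrightarrow> F x" unfolding measurable_on_def by auto
  \<comment> \<open>Truncation at the bound K of F keeps the almost everywhere limit and makes the
    sequence uniformly bounded, as dominated convergence will require.\<close>
  define h where "h n x = max (- K) (min K (g n x))" for n :: nat and x
  have h: "continuous_on UNIV (h n)" for n unfolding h_def by (intro continuous_intros g)
  have hb: "\<bar>h n x\<bar> \<le> K" for n x unfolding h_def using K by auto
  have hl: "(\<lambda>n. h n x) \<longlonglongrightarrow> F x" if "x \<notin> N" for x
  proof -
    have "(\<lambda>n. h n x) \<longlonglongrightarrow> max (- K) (min K (F x))"
      unfolding h_def by (intro tendsto_intros g(2) that)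
    then show ?thesis using F[of x] by (simp add: abs_le_iff)
  qed
  have "\<exists>p. real_polynomial_function p \<and> (\<forall>x\<in>cball 0 (r + 1). \<bar>h n x - p x\<bar> < inverse (real (Suc n)))" for n
    using Stone_Weierstrass_real_polynomial_function[OF compact_cball, of 0 "r + 1" "h n" "inverse (real (Suc n))"]
      continuous_on_subset[OF h] by (metis inverse_positive_iff_positive of_nat_0_less_iff subset_UNIV zero_less_Suc)
  then obtain p where p: "\<And>n. real_polynomial_function (p n)"
    "\<And>n x. norm x \<le> r + 1 \<Longrightarrow> \<bar>h n x - p n x\<bar> < inverse (real (Suc n))" by (metis mem_cball_0)
  obtain B where B: "B \<ge> 0" "\<And>x. \<bar>\<beta> x\<bar> \<le> B" using test_function_bounded[OF \<beta>(1)] by blast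
  show ?thesis
  proof (rule that[of "\<lambda>n x. \<beta> x * p n x" "B * (K + 1)" "r + 1"])
    fix n x
    show "test_function (\<lambda>x. \<beta> x * p n x)"
    proof (rule test_functionI[of _ "r + 1"])
      show "C_k k (\<lambda>x. \<beta> x * p n x)" for k
        using \<beta>(1) C_k_polynomial[OF p(1)] unfolding test_function_def by (auto intro: C_k_mult)
    qed (use \<beta> in auto)
    show z: "\<beta> x * p n x = 0" if "norm x \<ge> r + 1" for x using \<beta>(3)[OF that] by simp
    show "\<bar>\<beta> x * p n x\<bar> \<le> B * (K + 1)"
    proof (cases "norm x \<le> r + 1")
      case True
      have "inverse (real (Suc n)) \<le> 1" by (simp add: field_simps)
      then have "\<bar>p n x\<bar> \<le> K + 1" using p(2)[OF True, of n] hb[of n x] by linarith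
      then show ?thesis unfolding abs_mult using B by (intro mult_mono) auto
    next
      case False
      then have "\<beta> x * p n x = 0" using z[of x] by linarith
      then show ?thesis using mult_nonneg_nonneg[OF B(1), of "K + 1"] K by linarith
    qed
  next
    have "AE x in lborel. x \<notin> N"
      using AE_not_in[of N lebesgue] N by (simp add: negligible_iff_null_sets AE_completion_iff)
    then show "AE x in lborel. (\<lambda>n. \<beta> x * p n x) \<longlonglongrightarrow> f x"
    proof eventually_elim
      case (elim x)
      show ?case
      proof (cases "norm x < r + 1")
        case True
        have "(\<lambda>n. h n x - p n x) \<longlonglongrightarrow> 0"
          by (rule Lim_null_comparison[OF _ LIMSEQ_inverse_real_of_nat])
            (use p(2) True in \<open>auto intro!: always_eventually less_imp_le simp del: of_nat_Suc\<close>)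
        then have "(\<lambda>n. h n x - (h n x - p n x)) \<longlonglongrightarrow> F x - 0" by (intro tendsto_diff hl elim)
        then have "(\<lambda>n. \<beta> x * p n x) \<longlonglongrightarrow> \<beta> x * F x" by (intro tendsto_mult_left) simp
        then show ?thesis using \<beta>(2)[OF True] by (simp add: F_def)
      next
        case False
        then have "\<beta> x = 0" "f x = 0" using \<beta>(3) s by auto
        then show ?thesis by simp
      qed
    qed
  qed auto
qed

text \<open>Test with bounded approximations of sgn v on a ball; in the limit the integral of |v|
  over that ball is 0.\<close>

lemma AE_eq_0_of_test_functions:
  fixes v :: "real^'n \<Rightarrow> real"
  assumes v: "locally_integrable v" and z: "\<And>\<phi>. test_function \<phi> \<Longrightarrow> (LINT x|lborel. \<phi> x * v x) = 0"
  shows "AE x in lborel. v x = 0"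
proof -
  note [measurable] = locally_integrable_measurable[OF v]
  have "AE x in lborel. norm x \<le> real n \<longrightarrow> v x = 0" for n
  proof -
    define f where "f x = sgn (v x) * indicator (cball 0 (real n)) x" for x
    have [measurable]: "cball (0::real^'n) (real n) \<in> sets borel" by simp
    have fm [measurable]: "f \<in> borel_measurable borel" unfolding f_def by measurable
    have fb: "\<bar>f x\<bar> \<le> 1" for x unfolding f_def by (auto simp: indicator_def sgn_if)
    have fs: "f x = 0" if "norm x > real n" for x unfolding f_def using that by simp
    obtain \<phi> C R where \<phi>: "\<And>k. test_function (\<phi> k)" "\<And>k x. \<bar>\<phi> k x\<bar> \<le> C"
      "\<And>k x. norm x \<ge> R \<Longrightarrow> \<phi> k x = (0::real)" "AE x in lborel. (\<lambda>k. \<phi> k x) \<longlonglongrightarrow> f x" "R > real n"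
      
      using bounded_limit_of_test_functions[of f 1 "real n", OF fm fb fs of_nat_0_le_iff] by blast
    note [measurable] = test_function_measurable[OF \<phi>(1)]
    have C: "C \<ge> 0" using \<phi>(2)[of 0 0] by linarith
    have w: "integrable lborel (\<lambda>x. C * \<bar>indicator (cball 0 R) x *\<^sub>R v x\<bar>)"
      using v unfolding locally_integrable_def set_integrable_def
      by (intro integrable_mult_right integrable_abs) auto
    have c: "AE x in lborel. (\<lambda>k. \<phi> k x * v x) \<longlonglongrightarrow> f x * v x"
      using \<phi>(4) by eventually_elim (intro tendsto_intros)
    have d: "AE x in lborel. norm (\<phi> k x * v x) \<le> C * \<bar>indicator (cball 0 R) x *\<^sub>R v x\<bar>" for k
    proof (rule AE_I2)
      fix x show "norm (\<phi> k x * v x) \<le> C * \<bar>indicator (cball 0 R) x *\<^sub>R v x\<bar>"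
        using \<phi>(2)[of k x] \<phi>(3)[of x k] C by (cases "norm x \<le> R") (auto simp: abs_mult mult_right_mono)
    qed
    have "(\<lambda>k. LINT x|lborel. \<phi> k x * v x) \<longlonglongrightarrow> (LINT x|lborel. f x * v x)"
      by (rule integral_dominated_convergence[OF _ _ w c d]) auto
    then have "(LINT x|lborel. f x * v x) = 0" using z[OF \<phi>(1)] by (simp add: LIMSEQ_const_iff)
    moreover have "integrable lborel (\<lambda>x. f x * v x)"
      by (rule integrable_dominated_convergence[OF _ _ w c d]) auto
    moreover have fv: "f x * v x = indicator (cball 0 (real n)) x * \<bar>v x\<bar>" for x
      unfolding f_def by (auto simp: indicator_def sgn_if)
    ultimately have "AE x in lborel. f x * v x = 0"
      by (subst (asm) integral_nonneg_eq_0_iff_AE) auto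
    then show ?thesis by eventually_elim (auto simp: fv)
  qed
  then have "AE x in lborel. \<forall>n. norm x \<le> real n \<longrightarrow> v x = 0" by (subst AE_all_countable) simp
  then show ?thesis by eventually_elim (use real_arch_simple in blast)
qed

lemma has_weak_partial_inner:
  fixes u v :: "real^'n \<Rightarrow> 'b::euclidean_space"
  assumes w: "has_weak_partial i u v"
  shows "has_weak_partial i (\<lambda>x. u x \<bullet> b) (\<lambda>x. v x \<bullet> b)"
proof -
  have l: "locally_integrable (\<lambda>x. f x \<bullet> b)" if "locally_integrable f" for f :: "real^'n \<Rightarrow> 'b"
    using that unfolding locally_integrable_def set_integrable_def
    by (auto dest!: spec intro: integrable_inner_left simp flip: inner_scaleR_left)
  have *: "(LINT x|lborel. \<phi> x *\<^sub>R (f x \<bullet> b)) = (LINT x|lborel. \<phi> x *\<^sub>R f x) \<bullet> b"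
    if "test_function \<phi>" "locally_integrable f" for \<phi> and f :: "real^'n \<Rightarrow> 'b"
    using integral_inner_left[OF integrable_test_function[OF that], of b] by simp
  show ?thesis
    unfolding has_weak_partial_def
  proof (intro conjI allI impI)
    have lu: "locally_integrable u" and lv: "locally_integrable v" using w unfolding has_weak_partial_def by auto
    then show "locally_integrable (\<lambda>x. u x \<bullet> b)" "locally_integrable (\<lambda>x. v x \<bullet> b)" using l by auto
    fix \<phi> :: "real^'n \<Rightarrow> real" assume t: "test_function \<phi>"
    have "(LINT x|lborel. partial_deriv i \<phi> x *\<^sub>R u x) = - (LINT x|lborel. \<phi> x *\<^sub>R v x)"
      using w t unfolding has_weak_partial_def by blast
    then show "(LINT x|lborel. partial_deriv i \<phi> x *\<^sub>R (u x \<bullet> b)) = - (LINT x|lborel. \<phi> x *\<^sub>R (v x \<bullet> b))"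
      using *[OF test_function_partial[OF t] lu] *[OF t lv] by simp
  qed
qed

lemma has_weak_partial_unique:
  fixes u v w :: "real^'n \<Rightarrow> 'b::euclidean_space"
  assumes "has_weak_partial i u v" "has_weak_partial i u w"
  shows "AE x in lborel. v x = w x"
proof -
  have "AE x in lborel. v x \<bullet> b - w x \<bullet> b = 0" for b
  proof (rule AE_eq_0_of_test_functions)
    have h: "has_weak_partial i (\<lambda>x. u x \<bullet> b) (\<lambda>x. v x \<bullet> b)" "has_weak_partial i (\<lambda>x. u x \<bullet> b) (\<lambda>x. w x \<bullet> b)"
      using assms has_weak_partial_inner by blast+
    then have l: "locally_integrable (\<lambda>x. v x \<bullet> b)" "locally_integrable (\<lambda>x. w x \<bullet> b)"
      unfolding has_weak_partial_def by blast+
    then show "locally_integrable (\<lambda>x. v x \<bullet> b - w x \<bullet> b)"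
      unfolding locally_integrable_def set_integrable_def by (auto simp: right_diff_distrib)
    fix \<phi> :: "real^'n \<Rightarrow> real" assume t: "test_function \<phi>"
    have "(LINT x|lborel. partial_deriv i \<phi> x *\<^sub>R (u x \<bullet> b)) = - (LINT x|lborel. \<phi> x *\<^sub>R (v x \<bullet> b))"
      "(LINT x|lborel. partial_deriv i \<phi> x *\<^sub>R (u x \<bullet> b)) = - (LINT x|lborel. \<phi> x *\<^sub>R (w x \<bullet> b))"
      using h t unfolding has_weak_partial_def by blast+
    then have "(LINT x|lborel. \<phi> x *\<^sub>R (v x \<bullet> b)) = (LINT x|lborel. \<phi> x *\<^sub>R (w x \<bullet> b))" by simp
    then show "(LINT x|lborel. \<phi> x * (v x \<bullet> b - w x \<bullet> b)) = 0"
      using integrable_test_function[OF t l(1)] integrable_test_function[OF t l(2)]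
      by (simp add: right_diff_distrib)
  qed
  then have "AE x in lborel. \<forall>b\<in>Basis. v x \<bullet> b - w x \<bullet> b = 0" by (subst AE_ball_countable) (auto intro: countable_finite)
  then show ?thesis by eventually_elim (auto intro: euclidean_eqI)
qed

lemma has_weak_partial_cong_AE:
  fixes u v :: "real^'n \<Rightarrow> 'b::euclidean_space"
  assumes w: "has_weak_partial i u v" and m: "u' \<in> borel_measurable borel" "v' \<in> borel_measurable borel"
    and e: "AE x in lborel. u x = u' x" "AE x in lborel. v x = v' x"
  shows "has_weak_partial i u' v'"
proof -
  have l: "locally_integrable f'" if f: "locally_integrable f" and m: "f' \<in> borel_measurable borel"
    and e: "AE x in lborel. f x = f' x" for f f' :: "real^'n \<Rightarrow> 'b"
    unfolding locally_integrable_def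
  proof (intro allI impI)
    fix K :: "(real^'n) set" assume K: "compact K"
    have [measurable]: "f \<in> borel_measurable borel" "f' \<in> borel_measurable borel" "K \<in> sets borel"
      using locally_integrable_measurable[OF f] m borel_compact[OF K] by auto
    have "integrable lborel (\<lambda>x. indicator K x *\<^sub>R f x) \<longleftrightarrow> integrable lborel (\<lambda>x. indicator K x *\<^sub>R f' x)"
      by (rule integrable_cong_AE) (use e in auto)
    then show "set_integrable lborel K f'" using f K unfolding locally_integrable_def set_integrable_def by blast
  qed
  have i: "(LINT x|lborel. \<phi> x *\<^sub>R f x) = (LINT x|lborel. \<phi> x *\<^sub>R f' x)"
    if "test_function \<phi>" and f: "f \<in> borel_measurable borel" and m: "f' \<in> borel_measurable borel"
    and e: "AE x in lborel. f x = f' x" for \<phi> and f f' :: "real^'n \<Rightarrow> 'b"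
  proof -
    note [measurable] = test_function_measurable[OF that(1)] f m
    show ?thesis by (rule integral_cong_AE) (use e in auto)
  qed
  have l': "locally_integrable u" "locally_integrable v" using w unfolding has_weak_partial_def by auto
  note um = locally_integrable_measurable[OF l'(1)] and vm = locally_integrable_measurable[OF l'(2)]
  show ?thesis
    unfolding has_weak_partial_def
  proof (intro conjI allI impI)
    show "locally_integrable u'" "locally_integrable v'" by (fact l[OF l'(1) m(1) e(1)] l[OF l'(2) m(2) e(2)])+
    fix \<phi> :: "real^'n \<Rightarrow> real" assume t: "test_function \<phi>"
    then have "(LINT x|lborel. partial_deriv i \<phi> x *\<^sub>R u x) = - (LINT x|lborel. \<phi> x *\<^sub>R v x)"
      using w unfolding has_weak_partial_def by blast
    then show "(LINT x|lborel. partial_deriv i \<phi> x *\<^sub>R u' x) = - (LINT x|lborel. \<phi> x *\<^sub>R v' x)"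
      using i[OF test_function_partial[OF t] um m(1) e(1)] i[OF t vm m(2) e(2)] by simp
  qed
qed

section \<open>Difference quotients in \<open>L\<^sup>2\<close>\<close>

definition L2norm :: "(real^'n \<Rightarrow> real) \<Rightarrow> real" where
  "L2norm f = sqrt (LINT x|lborel. (f x)\<^sup>2)"

lemma L2norm_nonneg [simp]: "L2norm f \<ge> 0"
  unfolding L2norm_def by simp

lemma L2norm_power2: "(L2norm f)\<^sup>2 = (LINT x|lborel. (f x)\<^sup>2)"
  unfolding L2norm_def by simp

lemma in_L2_real_iff:
  fixes f :: "real^'n \<Rightarrow> real"
  shows "in_L2 f \<longleftrightarrow> f \<in> borel_measurable borel \<and> integrable lborel (\<lambda>x. (f x)\<^sup>2)"
  unfolding in_L2_def by simp

lemma in_L2_integrable_square: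
  fixes f :: "real^'n \<Rightarrow> real"
  shows "in_L2 f \<Longrightarrow> integrable lborel (\<lambda>x. (f x)\<^sup>2)"
  by (simp add: in_L2_real_iff)

lemma in_L2_cmult: "in_L2 f \<Longrightarrow> in_L2 (\<lambda>x. c * f x)" for f :: "real^'n \<Rightarrow> real"
  by (auto simp: in_L2_real_iff power_mult_distrib)

lemma in_L2_add:
  fixes f g :: "real^'n \<Rightarrow> real"
  assumes "in_L2 f" "in_L2 g" shows "in_L2 (\<lambda>x. f x + g x)"
  using assms in_L2_integrable_mult[OF assms]
  by (auto simp: in_L2_real_iff power2_sum mult.assoc intro!: Bochner_Integration.integrable_add integrable_mult_right)

lemma in_L2_diff:
  fixes f g :: "real^'n \<Rightarrow> real"
  assumes "in_L2 f" "in_L2 g" shows "in_L2 (\<lambda>x. f x - g x)"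
  using in_L2_add[OF assms(1) in_L2_cmult[OF assms(2), of "-1"]] by simp

lemma in_L2_minus: "in_L2 f \<Longrightarrow> in_L2 (\<lambda>x. - f x)" for f :: "real^'n \<Rightarrow> real"
  using in_L2_cmult[of f "-1"] by simp

lemma in_L2_sum:
  fixes f :: "'i \<Rightarrow> real^'n \<Rightarrow> real"
  assumes "\<And>i. i \<in> I \<Longrightarrow> in_L2 (f i)" shows "in_L2 (\<lambda>x. \<Sum>i\<in>I. f i x)"
  using assms
proof (induction I rule: infinite_finite_induct)
  case (insert i I)
  then show ?case by (simp add: in_L2_add)
qed (auto simp: in_L2_real_iff)

lemma in_L2_dominated:
  fixes f g :: "real^'n \<Rightarrow> real"
  assumes g: "in_L2 g" and f [measurable]: "f \<in> borel_measurable borel" and b: "\<And>x. \<bar>f x\<bar> \<le> \<bar>g x\<bar>"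
  shows "in_L2 f"
proof -
  have "integrable lborel (\<lambda>x. (f x)\<^sup>2)"
    by (rule Bochner_Integration.integrable_bound[OF in_L2_integrable_square[OF g]])
      (use b in \<open>auto simp: abs_le_square_iff\<close>)
  then show ?thesis using f by (simp add: in_L2_real_iff)
qed

lemma in_L2_bounded_mult:
  fixes f g :: "real^'n \<Rightarrow> real"
  assumes g: "in_L2 g" and f: "f \<in> borel_measurable borel" and b: "\<And>x. \<bar>f x\<bar> \<le> B"
  shows "in_L2 (\<lambda>x. f x * g x)"
proof (rule in_L2_dominated[OF in_L2_cmult[OF g, of B]])
  show "(\<lambda>x. f x * g x) \<in> borel_measurable borel" using f in_L2_measurable[OF g] by measurable
  have "B \<ge> 0" using b[of 0] by linarith
  then show "\<bar>f x * g x\<bar> \<le> \<bar>B * g x\<bar>" for x using b[of x] by (simp add: abs_mult mult_right_mono)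
qed

lemma in_L2_bounded_support:
  fixes f :: "real^'n \<Rightarrow> real"
  assumes f: "f \<in> borel_measurable borel" and b: "\<And>x. \<bar>f x\<bar> \<le> B" and s: "\<And>x. norm x > R \<Longrightarrow> f x = 0"
  shows "in_L2 f"
proof (rule in_L2_dominated)
  have "integrable lborel (\<lambda>x. B\<^sup>2 * indicator (cball (0::real^'n) R) x)"
    using emeasure_compact_finite[OF compact_cball, of 0 R]
    by (intro integrable_mult_right integrable_real_indicator) auto
  moreover have [measurable]: "cball (0::real^'n) R \<in> sets borel" by simp
  moreover have "(B * indicator (cball 0 R) x)\<^sup>2 = B\<^sup>2 * indicator (cball 0 R) x" for x :: "real^'n"
    by (simp add: indicator_def)
  ultimately show "in_L2 (\<lambda>x::real^'n. B * indicator (cball 0 R) x)"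
    by (simp add: in_L2_real_iff)
  show "\<bar>f x\<bar> \<le> \<bar>B * indicator (cball 0 R) x\<bar>" for x
    using b[of x] s[of x] by (cases "norm x > R") (auto simp: indicator_def)
qed (fact f)

lemma in_L2_test_function: "test_function \<phi> \<Longrightarrow> in_L2 \<phi>"
  using in_L2_bounded_support test_function_bounded test_function_support test_function_measurable
  by (metis order_less_imp_le)

lemma in_L2_translate: "in_L2 f \<Longrightarrow> in_L2 (\<lambda>x. f (x + a))" for f :: "real^'n \<Rightarrow> real"
  using integral_translate(2)[OF borel_measurable_power[of f borel 2], of a] by (auto simp: in_L2_real_iff)

lemma L2norm_translate: "in_L2 f \<Longrightarrow> L2norm (\<lambda>x. f (x + a)) = L2norm f"
  using integral_translate(1)[OF borel_measurable_power[of f borel 2], of a] by (simp add: in_L2_real_iff L2norm_def)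

lemma L2_Cauchy_Schwarz:
  fixes f g :: "real^'n \<Rightarrow> real"
  assumes f: "in_L2 f" and g: "in_L2 g"
  shows "\<bar>LINT x|lborel. f x * g x\<bar> \<le> L2norm f * L2norm g"
proof -
  define A B C where "A = (LINT x|lborel. (f x)\<^sup>2)" and "B = (LINT x|lborel. f x * g x)"
    and "C = (LINT x|lborel. (g x)\<^sup>2)"
  have q: "0 \<le> A - 2 * t * B + t\<^sup>2 * C" for t
  proof -
    have "0 \<le> (LINT x|lborel. (f x - t * g x)\<^sup>2)" by simp
    also have "\<dots> = (LINT x|lborel. (f x)\<^sup>2 - 2 * t * (f x * g x) + t\<^sup>2 * (g x)\<^sup>2)"
      by (rule Bochner_Integration.integral_cong) (auto simp: power2_eq_square algebra_simps)
    also have "\<dots> = A - 2 * t * B + t\<^sup>2 * C"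
      unfolding A_def B_def C_def
      using in_L2_integrable_square[OF f] in_L2_integrable_square[OF g] in_L2_integrable_mult[OF f g] by simp
    finally show ?thesis .
  qed
  have C: "C \<ge> 0" "A \<ge> 0" unfolding C_def A_def by auto
  have "B\<^sup>2 \<le> A * C"
  proof (cases "C = 0")
    case True
    have "B = 0"
    proof (rule ccontr)
      assume "B \<noteq> 0"
      \<comment> \<open>For C = 0 the quadratic in t is affine, and at this t it equals -1.\<close>
      then show False using q[of "(A + 1) / (2 * B)"] True by (simp add: field_simps)
    qed
    then show ?thesis using True by simp
  next
    case False
    then have "0 \<le> C * (A - 2 * (B / C) * B + (B / C)\<^sup>2 * C)" using q[of "B / C"] C by simp
    also have "\<dots> = A * C - B\<^sup>2" using False by (simp add: field_simps power2_eq_square)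
    finally show ?thesis by simp
  qed
  then have "\<bar>B\<bar> \<le> sqrt (A * C)" by (intro real_le_rsqrt) simp
  then show ?thesis unfolding L2norm_def A_def B_def C_def by (simp add: real_sqrt_mult)
qed

lemma square_diff_le: "(a - c)\<^sup>2 \<le> 2 * (a - b)\<^sup>2 + 2 * (b - c)\<^sup>2" for a b c :: real
  using zero_le_power2[of "(a - b) - (b - c)"] by (simp add: power2_eq_square algebra_simps)

text \<open>Truncate g in value and in space, then approximate the truncation; both steps converge
  by dominated convergence. The two errors e / 4 are doubled by \<open>square_diff_le\<close> and
  add up to e.\<close>

lemma test_functions_dense_L2:
  fixes g :: "real^'n \<Rightarrow> real"
  assumes g: "in_L2 g" and e: "e > 0"
  obtains \<phi> where "test_function \<phi>" "(LINT x|lborel. (g x - \<phi> x)\<^sup>2) < e"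
proof -
  note [measurable] = in_L2_measurable[OF g]
  define f where "f k x = max (- real k) (min (real k) (g x)) * indicator (cball 0 (real k)) x" for k and x :: "real^'n"
  have [measurable]: "cball (0::real^'n) (real k) \<in> sets borel" for k by simp
  have [measurable]: "f k \<in> borel_measurable borel" for k unfolding f_def by measurable
  have "(\<lambda>k. LINT x|lborel. (g x - f k x)\<^sup>2) \<longlonglongrightarrow> (LINT x|(lborel :: (real^'n) measure). 0)"
  proof (rule integral_dominated_convergence[OF _ _ in_L2_integrable_square[OF g]])
    show "AE x in lborel. (\<lambda>k. (g x - f k x)\<^sup>2) \<longlonglongrightarrow> 0"
    proof (intro AE_I2 tendsto_eventually)
      fix x :: "real^'n"
      have "\<forall>\<^sub>F k in sequentially. real k \<ge> max (norm x) \<bar>g x\<bar>"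
        using eventually_ge_at_top[of "nat \<lceil>max (norm x) \<bar>g x\<bar>\<rceil>"] by eventually_elim linarith
      then show "\<forall>\<^sub>F k in sequentially. (g x - f k x)\<^sup>2 = 0"
        by eventually_elim (auto simp: f_def)
    qed
    show "AE x in lborel. norm ((g x - f k x)\<^sup>2) \<le> (g x)\<^sup>2" for k
      by (intro AE_I2) (auto simp: f_def indicator_def abs_le_square_iff[symmetric])
  qed auto
  then have "\<forall>\<^sub>F k in sequentially. (LINT x|lborel. (g x - f k x)\<^sup>2) < e / 4"
    using e by (intro order_tendstoD(2)) auto
  then obtain k where k: "(LINT x|lborel. (g x - f k x)\<^sup>2) < e / 4"
    by (auto simp: eventually_sequentially)
  have fb: "\<bar>f k x\<bar> \<le> real k" for x unfolding f_def by (auto simp: indicator_def)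
  have fs: "f k x = 0" if "norm x > real k" for x unfolding f_def using that by simp
  obtain \<phi> C R where \<phi>: "\<And>n. test_function (\<phi> n)" "\<And>n x. \<bar>\<phi> n x\<bar> \<le> C"
    "\<And>n x. norm x \<ge> R \<Longrightarrow> \<phi> n x = (0::real)" "AE x in lborel. (\<lambda>n. \<phi> n x) \<longlonglongrightarrow> f k x" "R > real k"
    
    using bounded_limit_of_test_functions[of "f k" "real k" "real k", OF _ fb fs of_nat_0_le_iff] by auto
  note [measurable] = test_function_measurable[OF \<phi>(1)]
  have "(\<lambda>n. LINT x|lborel. (f k x - \<phi> n x)\<^sup>2) \<longlonglongrightarrow> (LINT x|(lborel :: (real^'n) measure). 0)"
  proof (rule integral_dominated_convergence)
    show "AE x in lborel. (\<lambda>n. (f k x - \<phi> n x)\<^sup>2) \<longlonglongrightarrow> 0"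
      using \<phi>(4)
    proof eventually_elim
      case (elim x)
      have "(\<lambda>n. (f k x - \<phi> n x)\<^sup>2) \<longlonglongrightarrow> (f k x - f k x)\<^sup>2" by (intro tendsto_intros elim)
      then show ?case by simp
    qed
    show "integrable lborel (\<lambda>x. (real k + C)\<^sup>2 * indicator (cball (0::real^'n) R) x)"
      using emeasure_compact_finite[OF compact_cball, of 0 R]
      by (intro integrable_mult_right integrable_real_indicator) auto
    show "AE x in lborel. norm ((f k x - \<phi> n x)\<^sup>2) \<le> (real k + C)\<^sup>2 * indicator (cball 0 R) x" for n
    proof (rule AE_I2)
      fix x :: "real^'n"
      show "norm ((f k x - \<phi> n x)\<^sup>2) \<le> (real k + C)\<^sup>2 * indicator (cball 0 R) x"
      proof (cases "norm x \<le> R")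
        case True
        have "\<bar>f k x - \<phi> n x\<bar> \<le> \<bar>real k + C\<bar>" using fb[of x] \<phi>(2)[of n x] by linarith
        then show ?thesis using True by (simp add: abs_le_square_iff)
      next
        case False
        then show ?thesis using fs[of x] \<phi>(3)[of x n] \<phi>(5) by simp
      qed
    qed
  qed auto
  then have "\<forall>\<^sub>F n in sequentially. (LINT x|lborel. (f k x - \<phi> n x)\<^sup>2) < e / 4"
    using e by (intro order_tendstoD(2)) auto
  then obtain n where n: "(LINT x|lborel. (f k x - \<phi> n x)\<^sup>2) < e / 4"
    by (auto simp: eventually_sequentially)
  have fL: "in_L2 (f k)" by (rule in_L2_bounded_support[OF _ fb fs]) auto
  have i: "integrable lborel (\<lambda>x. (g x - f k x)\<^sup>2)" "integrable lborel (\<lambda>x. (f k x - \<phi> n x)\<^sup>2)"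
      "integrable lborel (\<lambda>x. (g x - \<phi> n x)\<^sup>2)"
    using g fL in_L2_test_function[OF \<phi>(1)[of n]] by (auto intro: in_L2_integrable_square in_L2_diff)
  have "(LINT x|lborel. (g x - \<phi> n x)\<^sup>2) \<le> (LINT x|lborel. 2 * (g x - f k x)\<^sup>2 + 2 * (f k x - \<phi> n x)\<^sup>2)"
    by (rule integral_mono) (use i square_diff_le in auto)
  also have "\<dots> < e" using i n k by simp
  finally show ?thesis using that \<phi>(1) by blast
qed

text \<open>For h = 0 the quotient is 0, because division by 0 gives 0; the algebraic identities
  below therefore hold for every h.\<close>

definition diffq :: "'n \<Rightarrow> real \<Rightarrow> (real^'n \<Rightarrow> real) \<Rightarrow> real^'n \<Rightarrow> real" where
  "diffq i h f x = (f (x + h *\<^sub>R axis i 1) - f x) / h"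

lemma in_L2_diffq: "in_L2 f \<Longrightarrow> in_L2 (diffq i h f)"
  using in_L2_cmult[OF in_L2_diff[OF in_L2_translate], of f f "1/h"] by (simp add: diffq_def[abs_def])

text \<open>Translation invariance moves the shift from f to g, which reverses its direction; hence
  the step - h on the right.\<close>

lemma diffq_by_parts:
  fixes f g :: "real^'n \<Rightarrow> real"
  assumes f: "in_L2 f" and g: "in_L2 g"
  shows "(LINT x|lborel. diffq i h f x * g x) = - (LINT x|lborel. f x * diffq i (- h) g x)"
proof -
  let ?a = "h *\<^sub>R axis i 1 :: real^'n"
  note [measurable] = in_L2_measurable[OF f] in_L2_measurable[OF g]
  have i: "integrable lborel (\<lambda>x. f (x + ?a) * g x)" "integrable lborel (\<lambda>x. f x * g x)"
     "integrable lborel (\<lambda>x. f x * g (x + - ?a))"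
    using in_L2_integrable_mult in_L2_translate f g by blast+
  have t: "(LINT x|lborel. f x * g (x + - ?a)) = (LINT x|lborel. f (x + ?a) * g x)"
    using integral_translate(1)[of "\<lambda>x. f x * g (x + - ?a)" ?a] by simp
  have "(LINT x|lborel. diffq i h f x * g x) = (LINT x|lborel. (f (x + ?a) * g x - f x * g x) / h)"
    by (simp add: diffq_def left_diff_distrib)
  also have "\<dots> = ((LINT x|lborel. f x * g (x + - ?a)) - (LINT x|lborel. f x * g x)) / h"
    using i t by simp
  also have "\<dots> = (LINT x|lborel. (f x * g (x + - ?a) - f x * g x) / h)"
    using i by simp
  also have "\<dots> = (LINT x|lborel. - (f x * diffq i (- h) g x))"
    by (rule Bochner_Integration.integral_cong) (auto simp: diffq_def right_diff_distrib)
  finally show ?thesis by simp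
qed

lemma diffq_commute: "diffq i h (diffq j k f) x = diffq j k (diffq i h f) x"
  by (simp add: diffq_def diff_divide_distrib add_divide_distrib algebra_simps)

lemma filterlim_uminus_at_0: "filterlim (\<lambda>h::real. - h) (at 0) (at 0)"
  by (auto simp: filterlim_at eventually_at_filter intro!: tendsto_eq_intros)

lemma diffq_test_function_tendsto:
  fixes u :: "real^'n \<Rightarrow> real"
  assumes u: "locally_integrable u" and t: "test_function \<phi>"
  shows "((\<lambda>h. LINT x|lborel. diffq i h \<phi> x * u x) \<longlongrightarrow> (LINT x|lborel. partial_deriv i \<phi> x * u x)) (at 0)"
  unfolding tendsto_at_iff_sequentially comp_def
proof (intro allI impI)
  fix X :: "nat \<Rightarrow> real" assume X: "\<forall>n. X n \<in> UNIV - {0}" "X \<longlonglongrightarrow> 0"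
  obtain R where R: "R > 0" "\<And>x. norm x \<ge> R \<Longrightarrow> \<phi> x = 0" using test_function_support[OF t] by blast
  obtain L where L: "L \<ge> 0" "\<And>x t. \<bar>\<phi> (x + t *\<^sub>R axis i 1) - \<phi> x\<bar> \<le> L * \<bar>t\<bar>"
    using test_function_lipschitz[OF t] by blast
  note [measurable] = locally_integrable_measurable[OF u] test_function_measurable[OF t]
    test_function_measurable[OF test_function_partial[OF t]]
  have "\<forall>\<^sub>F n in sequentially. \<bar>X n\<bar> < 1"
    using order_tendstoD(2)[OF tendsto_rabs_zero[OF X(2)], of 1] by simp
  \<comment> \<open>Dropping the first N terms keeps the shifts shorter than 1, so all quotients
    vanish outside the ball of radius R + 1.\<close>
  then obtain N where N: "\<And>n. n \<ge> N \<Longrightarrow> \<bar>X n\<bar> < 1" by (auto simp: eventually_sequentially)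
  have w: "integrable lborel (\<lambda>x. L * \<bar>indicator (cball 0 (R + 1)) x *\<^sub>R u x\<bar>)"
    using u unfolding locally_integrable_def set_integrable_def
    by (intro integrable_mult_right integrable_abs) auto
  have "(\<lambda>n. LINT x|lborel. diffq i (X (n + N)) \<phi> x * u x) \<longlonglongrightarrow> (LINT x|lborel. partial_deriv i \<phi> x * u x)"
  proof (rule integral_dominated_convergence[OF _ _ w])
    show "(\<lambda>x. diffq i (X (n + N)) \<phi> x * u x) \<in> borel_measurable lborel" for n
      unfolding diffq_def by measurable
    show "AE x in lborel. (\<lambda>n. diffq i (X (n + N)) \<phi> x * u x) \<longlonglongrightarrow> partial_deriv i \<phi> x * u x"
    proof (intro AE_I2 tendsto_mult_right)
      fix x
      have "((\<lambda>h. diffq i h \<phi> x) \<longlongrightarrow> partial_deriv i \<phi> x) (at 0)"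
        using test_function_has_derivative_line[OF t, of x i 0] by (simp add: DERIV_def diffq_def)
      moreover have "filterlim (\<lambda>n. X (n + N)) (at 0) sequentially"
        using X LIMSEQ_ignore_initial_segment[OF X(2), of N] by (auto simp: filterlim_at)
      ultimately show "(\<lambda>n. diffq i (X (n + N)) \<phi> x) \<longlonglongrightarrow> partial_deriv i \<phi> x"
        by (rule filterlim_compose)
    qed
    show "AE x in lborel. norm (diffq i (X (n + N)) \<phi> x * u x) \<le> L * \<bar>indicator (cball 0 (R + 1)) x *\<^sub>R u x\<bar>" for n
    proof (rule AE_I2)
      fix x
      let ?h = "X (n + N)"
      show "norm (diffq i ?h \<phi> x * u x) \<le> L * \<bar>indicator (cball 0 (R + 1)) x *\<^sub>R u x\<bar>"
      proof (cases "norm x \<le> R + 1")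
        case True
        have "\<bar>diffq i ?h \<phi> x\<bar> \<le> L"
          using L(2)[of x ?h] X(1) by (simp add: diffq_def field_simps)
        then show ?thesis using True by (simp add: abs_mult mult_right_mono)
      next
        case False
        have "norm x - norm (?h *\<^sub>R axis i 1 :: real^'n) \<le> norm (x + ?h *\<^sub>R axis i 1)" by (rule norm_diff_ineq)
        then have "norm (x + ?h *\<^sub>R axis i 1) \<ge> R" using False N[of "n + N"] by (simp add: norm_axis_1)
        then show ?thesis using R(2)[of x] R(2)[of "x + ?h *\<^sub>R axis i 1"] False by (simp add: diffq_def)
      qed
    qed
  qed auto
  then show "(\<lambda>n. LINT x|lborel. diffq i (X n) \<phi> x * u x) \<longlonglongrightarrow> (LINT x|lborel. partial_deriv i \<phi> x * u x)"
    by (rule LIMSEQ_offset)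
qed

lemma has_weak_partial_realD:
  fixes u v :: "real^'n \<Rightarrow> real"
  assumes "has_weak_partial i u v" "test_function \<phi>"
  shows "(LINT x|lborel. partial_deriv i \<phi> x * u x) = - (LINT x|lborel. \<phi> x * v x)"
  using assms unfolding has_weak_partial_def by simp

text \<open>The function \<open>\<theta> t = \<integral> u(x) \<phi>(x - t e\<^sub>i) dx\<close> is differentiable with derivative
  \<open>\<integral> v(x) \<phi>(x - t e\<^sub>i) dx\<close>; the mean value theorem for \<open>\<theta>\<close> bounds the difference
  quotients of \<open>u\<close>.\<close>

lemma L2_weak_partial_line_derivative:
  fixes u v :: "real^'n \<Rightarrow> real"
  assumes u: "in_L2 u" and w: "has_weak_partial i u v" and t: "test_function \<phi>"
  shows "((\<lambda>t. LINT x|lborel. \<phi> (x - t *\<^sub>R axis i 1) * u x) has_real_derivative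
    (LINT x|lborel. \<phi> (x - t *\<^sub>R axis i 1) * v x)) (at t)"
proof -
  let ?\<psi> = "\<lambda>x. \<phi> (x + (- t) *\<^sub>R axis i 1)"
  have \<psi>: "test_function ?\<psi>" by (rule test_function_translate[OF t])
  have "((\<lambda>h. LINT x|lborel. diffq i (- h) ?\<psi> x * u x) \<longlongrightarrow> (LINT x|lborel. partial_deriv i ?\<psi> x * u x)) (at 0)"
    by (rule filterlim_compose[OF diffq_test_function_tendsto[OF in_L2_locally_integrable[OF u] \<psi>] filterlim_uminus_at_0])
  then have l: "((\<lambda>h. - (LINT x|lborel. diffq i (- h) ?\<psi> x * u x)) \<longlongrightarrow> (LINT x|lborel. ?\<psi> x * v x)) (at 0)"
    using has_weak_partial_realD[OF w \<psi>] by (intro tendsto_eq_intros) auto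
  have "- (LINT x|lborel. diffq i (- h) ?\<psi> x * u x) =
     ((LINT x|lborel. \<phi> (x - (t + h) *\<^sub>R axis i 1) * u x) - (LINT x|lborel. \<phi> (x - t *\<^sub>R axis i 1) * u x)) / h" for h
  proof -
    have m: "in_L2 (\<lambda>x. \<phi> (x + a))" for a by (rule in_L2_translate[OF in_L2_test_function[OF t]])
    have i: "integrable lborel (\<lambda>x. \<phi> (x - a) * u x)" for a
      using in_L2_integrable_mult[OF m[of "- a"] u] by simp
    have "- (LINT x|lborel. diffq i (- h) ?\<psi> x * u x)
      = (LINT x|lborel. (\<phi> (x - (t + h) *\<^sub>R axis i 1) * u x - \<phi> (x - t *\<^sub>R axis i 1) * u x) / h)"
      unfolding Bochner_Integration.integral_minus[symmetric]
      by (rule Bochner_Integration.integral_cong) (auto simp: diffq_def algebra_simps diff_divide_distrib)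
    also have "\<dots> = ((LINT x|lborel. \<phi> (x - (t + h) *\<^sub>R axis i 1) * u x) - (LINT x|lborel. \<phi> (x - t *\<^sub>R axis i 1) * u x)) / h"
      using i by simp
    finally show ?thesis .
  qed
  with l show ?thesis by (simp add: DERIV_def)
qed

lemma diffq_weak_bound:
  fixes u v :: "real^'n \<Rightarrow> real"
  assumes u: "in_L2 u" and v: "in_L2 v" and w: "has_weak_partial i u v" and t: "test_function \<phi>"
  shows "\<bar>LINT x|lborel. diffq i h u x * \<phi> x\<bar> \<le> L2norm v * L2norm \<phi>"
proof -
  define \<theta> where "\<theta> t = (LINT x|lborel. \<phi> (x - t *\<^sub>R axis i 1) * u x)" for t
  have tL: "in_L2 \<phi>" by (rule in_L2_test_function[OF t])
  have "norm (\<theta> h - \<theta> 0) \<le> (L2norm v * L2norm \<phi>) * \<bar>h - 0\<bar>"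
  proof (rule lipschitz_of_line_derivative)
    show "(\<theta> has_vector_derivative (LINT x|lborel. \<phi> (x - t *\<^sub>R axis i 1) * v x)) (at t)" for t
      using L2_weak_partial_line_derivative[OF u w t] unfolding \<theta>_def
      by (simp add: has_real_derivative_iff_has_vector_derivative)
    show "norm (LINT x|lborel. \<phi> (x - t *\<^sub>R axis i 1) * v x) \<le> L2norm v * L2norm \<phi>" for t
      using L2_Cauchy_Schwarz[OF in_L2_translate[OF tL] v, of "- (t *\<^sub>R axis i 1)"]
        L2norm_translate[OF tL, of "- (t *\<^sub>R axis i 1)"] by (simp add: mult.commute)
  qed
  moreover have "(LINT x|lborel. diffq i h u x * \<phi> x) = (\<theta> h - \<theta> 0) / h"
  proof -
    have m: "in_L2 (\<lambda>x. \<phi> (x + a))" for a by (rule in_L2_translate[OF tL])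
    have i: "integrable lborel (\<lambda>x. \<phi> (x - a) * u x)" for a
      using in_L2_integrable_mult[OF m[of "- a"] u] by simp
    have "(LINT x|lborel. diffq i h u x * \<phi> x) = - (LINT x|lborel. u x * diffq i (- h) \<phi> x)"
      by (rule diffq_by_parts[OF u tL])
    also have "\<dots> = (LINT x|lborel. (\<phi> (x - h *\<^sub>R axis i 1) * u x - \<phi> (x - 0) * u x) / h)"
      unfolding Bochner_Integration.integral_minus[symmetric]
      by (rule Bochner_Integration.integral_cong) (auto simp: diffq_def algebra_simps diff_divide_distrib)
    also have "\<dots> = (\<theta> h - \<theta> 0) / h" unfolding \<theta>_def using i[of "h *\<^sub>R axis i 1"] i[of 0] by simp
    finally show ?thesis .
  qed
  ultimately show ?thesis by (cases "h = 0") (auto simp: abs_divide divide_le_eq)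
qed

text \<open>Take phi close to f. Testing with phi bounds the norm of phi by K plus the distance, and
  pairing f with f = phi + (f - phi) bounds the norm of f by that of phi plus the distance.\<close>

lemma L2norm_le_of_test_functions:
  fixes f :: "real^'n \<Rightarrow> real"
  assumes f: "in_L2 f" and b: "\<And>\<phi>. test_function \<phi> \<Longrightarrow> \<bar>LINT x|lborel. f x * \<phi> x\<bar> \<le> K * L2norm \<phi>"
    and K: "K \<ge> 0"
  shows "L2norm f \<le> K"
proof (rule field_le_epsilon)
  fix e :: real assume e: "e > 0"
  obtain \<phi> where t: "test_function \<phi>" and d: "(LINT x|lborel. (f x - \<phi> x)\<^sup>2) < (e / 2)\<^sup>2"
    using test_functions_dense_L2[OF f, of "(e / 2)\<^sup>2"] e by auto
  have pL: "in_L2 \<phi>" by (rule in_L2_test_function[OF t])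
  have dL: "in_L2 (\<lambda>x. f x - \<phi> x)" by (rule in_L2_diff[OF f pL])
  define \<delta> where "\<delta> = L2norm (\<lambda>x. f x - \<phi> x)"
  have \<delta>: "\<delta> \<le> e / 2" "\<delta> \<ge> 0"
    using d e real_sqrt_le_mono[OF less_imp_le[OF d]] unfolding \<delta>_def L2norm_def by auto
  have s1: "(LINT x|lborel. f x * \<phi> x) = (L2norm \<phi>)\<^sup>2 + (LINT x|lborel. (f x - \<phi> x) * \<phi> x)"
    unfolding L2norm_power2
    using in_L2_integrable_square[OF pL] in_L2_integrable_mult[OF dL pL]
    by (subst Bochner_Integration.integral_add[symmetric]) (auto simp: algebra_simps power2_eq_square)
  then have "(L2norm \<phi>)\<^sup>2 \<le> K * L2norm \<phi> + \<delta> * L2norm \<phi>"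
    using b[OF t] L2_Cauchy_Schwarz[OF dL pL] unfolding \<delta>_def by linarith
  then have "L2norm \<phi> * L2norm \<phi> \<le> (K + \<delta>) * L2norm \<phi>" by (simp add: power2_eq_square distrib_right)
  then have p: "L2norm \<phi> \<le> K + \<delta>"
    using K \<delta> L2norm_nonneg[of \<phi>] by (cases "L2norm \<phi> = 0") (auto simp: mult_le_cancel_right)
  have "(L2norm f)\<^sup>2 = (LINT x|lborel. f x * \<phi> x) + (LINT x|lborel. f x * (f x - \<phi> x))"
    unfolding L2norm_power2
    using in_L2_integrable_mult[OF f pL] in_L2_integrable_mult[OF f dL]
    by (subst Bochner_Integration.integral_add[symmetric]) (auto simp: algebra_simps power2_eq_square)
  also have "\<dots> \<le> L2norm f * L2norm \<phi> + L2norm f * \<delta>"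
    using L2_Cauchy_Schwarz[OF f pL] L2_Cauchy_Schwarz[OF f dL] unfolding \<delta>_def by linarith
  finally have "L2norm f * L2norm f \<le> (L2norm \<phi> + \<delta>) * L2norm f"
    by (simp add: power2_eq_square algebra_simps)
  then have "L2norm f \<le> L2norm \<phi> + \<delta>"
    using \<delta> L2norm_nonneg[of \<phi>] L2norm_nonneg[of f] by (cases "L2norm f = 0") (auto simp: mult_le_cancel_right)
  then show "L2norm f \<le> K + e" using p \<delta> by linarith
qed

lemma L2norm_diffq_le:
  fixes u v :: "real^'n \<Rightarrow> real"
  assumes "in_L2 u" "in_L2 v" "has_weak_partial i u v"
  shows "L2norm (diffq i h u) \<le> L2norm v"
  by (rule L2norm_le_of_test_functions) (use assms diffq_weak_bound in_L2_diffq in auto)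

text \<open>For test functions this is the definition of the weak derivative; the bound
  \<open>L2norm_diffq_le\<close>, uniform in h, extends it to all square integrable g by
  density.\<close>

lemma diffq_weak_tendsto:
  fixes u v g :: "real^'n \<Rightarrow> real"
  assumes u: "in_L2 u" and v: "in_L2 v" and w: "has_weak_partial i u v" and g: "in_L2 g"
  shows "((\<lambda>h. LINT x|lborel. diffq i h u x * g x) \<longlongrightarrow> (LINT x|lborel. v x * g x)) (at 0)"
proof (rule tendstoI)
  fix e :: real assume e: "e > 0"
  \<comment> \<open>Makes each of the two errors caused by replacing g with phi at most e / 3; the
    added 1 keeps the denominator positive.\<close>
  define c where "c = e / (3 * (L2norm v + 1))"
  have c: "c > 0" unfolding c_def using e L2norm_nonneg[of v] by (intro divide_pos_pos mult_pos_pos) linarith+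
  obtain \<phi> where t: "test_function \<phi>" and d: "(LINT x|lborel. (g x - \<phi> x)\<^sup>2) < c\<^sup>2"
    using test_functions_dense_L2[OF g, of "c\<^sup>2"] c by auto
  have pL: "in_L2 \<phi>" by (rule in_L2_test_function[OF t])
  have dL: "in_L2 (\<lambda>x. g x - \<phi> x)" by (rule in_L2_diff[OF g pL])
  have dn: "L2norm (\<lambda>x. g x - \<phi> x) \<le> c"
    using real_sqrt_le_mono[OF less_imp_le[OF d]] c unfolding L2norm_def by simp
  have cv: "L2norm v * c \<le> e / 3" 
  proof -
    have n: "L2norm v + 1 > 0" using L2norm_nonneg[of v] by linarith
    have "L2norm v * c \<le> (L2norm v + 1) * c" using c by (intro mult_right_mono) auto
    also have "\<dots> = e / 3" unfolding c_def using n by (metis less_irrefl nonzero_mult_divide_mult_cancel_left mult.commute times_divide_eq_right)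
    finally show ?thesis .
  qed
  have "((\<lambda>h. LINT x|lborel. u x * diffq i (- h) \<phi> x) \<longlongrightarrow> (LINT x|lborel. u x * partial_deriv i \<phi> x)) (at 0)"
    unfolding mult.commute[of "u _"]
    by (rule filterlim_compose[OF diffq_test_function_tendsto[OF in_L2_locally_integrable[OF u] t] filterlim_uminus_at_0])
  from tendsto_minus[OF this]
  have "((\<lambda>h. LINT x|lborel. diffq i h u x * \<phi> x) \<longlongrightarrow> (LINT x|lborel. v x * \<phi> x)) (at 0)"
    using has_weak_partial_realD[OF w t] unfolding diffq_by_parts[OF u pL] by (simp add: mult.commute)
  then have "\<forall>\<^sub>F h in at 0. dist (LINT x|lborel. diffq i h u x * \<phi> x) (LINT x|lborel. v x * \<phi> x) < e / 3"
    using e by (intro tendstoD) auto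
  then show "\<forall>\<^sub>F h in at 0. dist (LINT x|lborel. diffq i h u x * g x) (LINT x|lborel. v x * g x) < e"
  proof eventually_elim
    case (elim h)
    have s: "(LINT x|lborel. f x * g x) = (LINT x|lborel. f x * \<phi> x) + (LINT x|lborel. f x * (g x - \<phi> x))" 
      if "in_L2 f" for f :: "real^'n \<Rightarrow> real"
      using in_L2_integrable_mult[OF that pL] in_L2_integrable_mult[OF that dL]
      by (subst Bochner_Integration.integral_add[symmetric]) (auto simp: algebra_simps)
    have r: "\<bar>LINT x|lborel. f x * (g x - \<phi> x)\<bar> \<le> e / 3" if "in_L2 f" "L2norm f \<le> L2norm v" for f :: "real^'n \<Rightarrow> real"
    proof -
      have "\<bar>LINT x|lborel. f x * (g x - \<phi> x)\<bar> \<le> L2norm f * L2norm (\<lambda>x. g x - \<phi> x)"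
        by (rule L2_Cauchy_Schwarz[OF that(1) dL])
      also have "\<dots> \<le> L2norm v * c" using that dn by (intro mult_mono) auto
      finally show ?thesis using cv by linarith
    qed
    have tri: "\<bar>(a + a') - (b + b')\<bar> < e" if "\<bar>a - b\<bar> < e / 3" "\<bar>a'\<bar> \<le> e / 3" "\<bar>b'\<bar> \<le> e / 3" for a b a' b'
      using that by linarith
    show ?case
      unfolding s[OF v] s[OF in_L2_diffq[OF u]] dist_real_def
      by (rule tri[OF elim[unfolded dist_real_def] r[OF in_L2_diffq[OF u] L2norm_diffq_le[OF u v w]] r[OF v order_refl]])
  qed
qed

text \<open>Product and chain rules for difference quotients have coefficients evaluated at the
  shifted point. Their uniform convergence leaves an error that pairs a function small in L2 with
  quotients bounded in L2.\<close>

lemma diffq_weak_tendsto_coeff: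
  fixes u v g c :: "real^'n \<Rightarrow> real"
  assumes u: "in_L2 u" and v: "in_L2 v" and w: "has_weak_partial i u v" and g: "in_L2 g"
    and c: "c \<in> borel_measurable borel" "\<And>x. \<bar>c x\<bar> \<le> B"
    and ch: "\<And>h. ch h \<in> borel_measurable borel"
    and u': "uniform_limit UNIV ch c (at 0)"
  shows "((\<lambda>h. LINT x|lborel. ch h x * diffq i h u x * g x) \<longlongrightarrow> (LINT x|lborel. c x * v x * g x)) (at 0)"
proof -
  have cg: "in_L2 (\<lambda>x. c x * g x)" by (rule in_L2_bounded_mult[OF g c])
  have lim: "((\<lambda>h. (LINT x|lborel. diffq i h u x * (c x * g x)) + (LINT x|lborel. (ch h x - c x) * g x * diffq i h u x))
     \<longlongrightarrow> (LINT x|lborel. v x * (c x * g x)) + 0) (at 0)"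
  proof (intro tendsto_add diffq_weak_tendsto[OF u v w cg] tendstoI)
    fix e :: real assume e: "e > 0"
    define b where "b = e / (2 * (L2norm g * L2norm v + 1))"
    have p: "L2norm g * L2norm v \<ge> 0" by simp
    have b: "b > 0" unfolding b_def using e p by (intro divide_pos_pos mult_pos_pos) linarith+
    have be: "b * L2norm g * L2norm v < e"
    proof -
      have "b * (L2norm g * L2norm v) \<le> b * (L2norm g * L2norm v + 1)" using b by (intro mult_left_mono) auto
      also have "\<dots> = e / 2" unfolding b_def using p
        by (metis add_nonneg_pos less_irrefl nonzero_mult_divide_mult_cancel_left mult.commute times_divide_eq_right zero_less_one)
      finally show ?thesis using e by (simp add: mult.assoc)
    qed
    have "\<forall>\<^sub>F h in at 0. \<forall>x\<in>UNIV. dist (ch h x) (c x) < b" using u' b by (rule uniform_limitD)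
    then show "\<forall>\<^sub>F h in at 0. dist (LINT x|lborel. (ch h x - c x) * g x * diffq i h u x) 0 < e"
    proof eventually_elim
      case (elim h)
      then have el: "\<And>x. \<bar>ch h x - c x\<bar> \<le> b" by (auto simp: dist_real_def intro: less_imp_le)
      have m: "(\<lambda>x. ch h x - c x) \<in> borel_measurable borel" using c ch by measurable
      have L: "in_L2 (\<lambda>x. (ch h x - c x) * g x)" by (rule in_L2_bounded_mult[OF g m el])
      have "L2norm (\<lambda>x. (ch h x - c x) * g x) \<le> b * L2norm g"
      proof -
        have "(LINT x|lborel. ((ch h x - c x) * g x)\<^sup>2) \<le> (LINT x|lborel. b\<^sup>2 * (g x)\<^sup>2)"
        proof (rule integral_mono)
          show "((ch h x - c x) * g x)\<^sup>2 \<le> b\<^sup>2 * (g x)\<^sup>2" for x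
            using el[of x] b by (auto simp: power_mult_distrib abs_le_square_iff[symmetric] intro!: mult_right_mono)
        qed (use in_L2_integrable_square[OF L] in_L2_integrable_square[OF g] in auto)
        then have "sqrt (LINT x|lborel. ((ch h x - c x) * g x)\<^sup>2) \<le> sqrt (b\<^sup>2 * (LINT x|lborel. (g x)\<^sup>2))" by simp
        then show ?thesis unfolding L2norm_def using b by (simp add: real_sqrt_mult)
      qed
      then have "\<bar>LINT x|lborel. (ch h x - c x) * g x * diffq i h u x\<bar> \<le> b * L2norm g * L2norm v"
        using L2_Cauchy_Schwarz[OF L in_L2_diffq[OF u, of i h]] L2norm_diffq_le[OF u v w, of h]
        by (meson L2norm_nonneg b less_imp_le mult_mono mult_nonneg_nonneg order_trans)
      then show ?case using be by simp
    qed
  qed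
  have eq: "(LINT x|lborel. diffq i h u x * (c x * g x)) + (LINT x|lborel. (ch h x - c x) * g x * diffq i h u x)
    = (LINT x|lborel. ch h x * diffq i h u x * g x)" if "\<And>x. \<bar>ch h x - c x\<bar> \<le> 1" for h
  proof (subst Bochner_Integration.integral_add[symmetric])
    have m: "(\<lambda>x. ch h x - c x) \<in> borel_measurable borel" using c ch by measurable
    show "integrable lborel (\<lambda>x. (ch h x - c x) * g x * diffq i h u x)"
      by (rule in_L2_integrable_mult[OF in_L2_bounded_mult[OF g m that] in_L2_diffq[OF u]])
    show "integrable lborel (\<lambda>x. diffq i h u x * (c x * g x))"
      by (rule in_L2_integrable_mult[OF in_L2_diffq[OF u] cg])
  qed (simp add: algebra_simps)
  \<comment> \<open>Splitting the integral needs integrability of both parts, which is at hand once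
    the coefficients are within 1 of their limit.\<close>
  have ev: "\<forall>\<^sub>F h in at 0. \<forall>x. \<bar>ch h x - c x\<bar> \<le> 1"
    using uniform_limitD[OF u' zero_less_one] by eventually_elim (auto simp: dist_real_def intro: less_imp_le)
  have "((\<lambda>h. LINT x|lborel. ch h x * diffq i h u x * g x) \<longlongrightarrow> (LINT x|lborel. v x * (c x * g x)) + 0) (at 0)"
    by (rule Lim_transform_eventually[OF lim eventually_mono[OF ev]]) (use eq in blast)
  then show ?thesis by (simp add: mult_ac)
qed

lemma L2_integration_by_parts:
  fixes f f' g g' :: "real^'n \<Rightarrow> real"
  assumes "in_L2 f" "in_L2 f'" "has_weak_partial i f f'" "in_L2 g" "in_L2 g'" "has_weak_partial i g g'"
  shows "(LINT x|lborel. f' x * g x) = - (LINT x|lborel. f x * g' x)"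
proof -
  have "((\<lambda>h. LINT x|lborel. diffq i (- h) g x * f x) \<longlongrightarrow> (LINT x|lborel. g' x * f x)) (at 0)"
    by (rule filterlim_compose[OF diffq_weak_tendsto[OF assms(4-6,1)] filterlim_uminus_at_0])
  then have "((\<lambda>h. - (LINT x|lborel. diffq i (- h) g x * f x)) \<longlongrightarrow> - (LINT x|lborel. g' x * f x)) (at 0)"
    by (intro tendsto_intros)
  moreover have "(LINT x|lborel. diffq i h f x * g x) = - (LINT x|lborel. diffq i (- h) g x * f x)" for h
    by (subst diffq_by_parts[OF assms(1,4)]) (simp add: mult.commute)
  ultimately have "((\<lambda>h. LINT x|lborel. diffq i h f x * g x) \<longlongrightarrow> - (LINT x|lborel. g' x * f x)) (at 0)"
    by simp
  from tendsto_unique[OF _ this diffq_weak_tendsto[OF assms(1-4)]] show ?thesis by (simp add: mult.commute)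
qed

text \<open>The mixed second derivatives that cancel in the smooth case are replaced by commuting
  difference quotients, since f and g have only one weak derivative. The limits in h and k are taken
  one after the other, because a product of two weakly convergent families need not converge to the
  product of the limits.\<close>

lemma L2_jacobian_integral_eq_0:
  fixes f g :: "real^'n \<Rightarrow> real"
  assumes f: "in_L2 f" "in_L2 fi" "in_L2 fj" "has_weak_partial i f fi" "has_weak_partial j f fj"
    and g: "in_L2 g" "in_L2 gi" "in_L2 gj" "has_weak_partial i g gi" "has_weak_partial j g gj"
  shows "(LINT x|lborel. fi x * gj x - fj x * gi x) = 0"
proof -
  have e: "(LINT x|lborel. diffq i h f x * diffq j k g x) = (LINT x|lborel. diffq j (- k) f x * diffq i (- h) g x)" for h k
    unfolding diffq_by_parts[OF f(1) in_L2_diffq[OF g(1)]]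
    by (simp add: diffq_commute[of i _ j])
  have k: "(LINT x|lborel. fi x * diffq j k g x) = (LINT x|lborel. diffq j (- k) f x * gi x)" for k
  proof (rule tendsto_unique[OF _ diffq_weak_tendsto[OF f(1,2,4) in_L2_diffq[OF g(1)]]])
    show "((\<lambda>h. LINT x|lborel. diffq i h f x * diffq j k g x) \<longlongrightarrow> (LINT x|lborel. diffq j (- k) f x * gi x)) (at 0)"
      unfolding e mult.commute[of "diffq j _ _ _"]
      by (rule filterlim_compose[OF diffq_weak_tendsto[OF g(1,2,4) in_L2_diffq[OF f(1)]] filterlim_uminus_at_0])
  qed simp
  have "(LINT x|lborel. gj x * fi x) = (LINT x|lborel. fj x * gi x)"
  proof (rule tendsto_unique[OF _ diffq_weak_tendsto[OF g(1,3,5) f(2)]])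
    show "((\<lambda>k. LINT x|lborel. diffq j k g x * fi x) \<longlongrightarrow> (LINT x|lborel. fj x * gi x)) (at 0)"
      unfolding mult.commute[of _ "fi _"] k
      by (rule filterlim_compose[OF diffq_weak_tendsto[OF f(1,3,5) g(2)] filterlim_uminus_at_0])
  qed simp
  then show ?thesis
    using in_L2_integrable_mult[OF f(2) g(3)] in_L2_integrable_mult[OF f(3) g(2)] by (simp add: mult.commute)
qed

section \<open>Admissible maps\<close>

lemma has_weak_partial_add:
  fixes u v u' v' :: "real^'n \<Rightarrow> 'b::euclidean_space"
  assumes u: "has_weak_partial i u u'" and v: "has_weak_partial i v v'"
  shows "has_weak_partial i (\<lambda>x. u x + v x) (\<lambda>x. u' x + v' x)"
proof -
  have l: "locally_integrable u" "locally_integrable u'" "locally_integrable v" "locally_integrable v'"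
    using u v unfolding has_weak_partial_def by auto
  show ?thesis
    unfolding has_weak_partial_def
  proof (intro conjI allI impI)
    show "locally_integrable (\<lambda>x. u x + v x)" "locally_integrable (\<lambda>x. u' x + v' x)"
      using l unfolding locally_integrable_def set_integrable_def by (auto simp: scaleR_add_right)
    fix \<phi> :: "real^'n \<Rightarrow> real" assume t: "test_function \<phi>"
    have "(LINT x|lborel. partial_deriv i \<phi> x *\<^sub>R u x) = - (LINT x|lborel. \<phi> x *\<^sub>R u' x)"
      "(LINT x|lborel. partial_deriv i \<phi> x *\<^sub>R v x) = - (LINT x|lborel. \<phi> x *\<^sub>R v' x)"
      using u v t unfolding has_weak_partial_def by blast+
    then show "(LINT x|lborel. partial_deriv i \<phi> x *\<^sub>R (u x + v x)) = - (LINT x|lborel. \<phi> x *\<^sub>R (u' x + v' x))"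
      using integrable_test_function[OF test_function_partial[OF t, of i] l(1)] integrable_test_function[OF t l(2)]
        integrable_test_function[OF test_function_partial[OF t, of i] l(3)] integrable_test_function[OF t l(4)]
      by (simp add: scaleR_add_right)
  qed
qed

lemma has_weak_partial_const: "has_weak_partial i (\<lambda>x. c) (\<lambda>x. 0 :: 'b::euclidean_space)"
  by (rule weak_partialI[where M = "norm c" and L = 0]) (auto intro: locally_integrable_bounded[where B = 0])

lemma has_weak_partial_add_const:
  fixes u v :: "real^'n \<Rightarrow> 'b::euclidean_space"
  shows "has_weak_partial i u v \<Longrightarrow> has_weak_partial i (\<lambda>x. u x + c) v"
  using has_weak_partial_add[OF _ has_weak_partial_const, of i u v c] by simp

lemma has_weak_partial_weak_partial:
  "has_weak_partial i u v \<Longrightarrow> has_weak_partial i u (weak_partial i u)"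
  unfolding weak_partial_def by (rule someI[where P = "has_weak_partial i u"])

lemma weak_partial_AE_eq:
  fixes u v :: "real^'n \<Rightarrow> 'b::euclidean_space"
  shows "has_weak_partial i u v \<Longrightarrow> AE x in lborel. weak_partial i u x = v x"
  using has_weak_partial_unique has_weak_partial_weak_partial by blast

lemma has_weak_partial_measurable:
  fixes u v :: "real^'n \<Rightarrow> 'b::euclidean_space"
  assumes "has_weak_partial i u v"
  shows "u \<in> borel_measurable borel" "v \<in> borel_measurable borel"
  using assms locally_integrable_measurable unfolding has_weak_partial_def by auto

lemma in_L2_cong_AE:
  fixes u v :: "real^'n \<Rightarrow> 'b::euclidean_space"
  assumes "in_L2 u" "v \<in> borel_measurable borel" "AE x in lborel. u x = v x"
  shows "in_L2 v"
proof -
  note [measurable] = in_L2_measurable[OF assms(1)] assms(2)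
  have "integrable lborel (\<lambda>x. (norm (u x))\<^sup>2) \<longleftrightarrow> integrable lborel (\<lambda>x. (norm (v x))\<^sup>2)"
    by (rule integrable_cong_AE) (use assms(3) in auto)
  then show ?thesis using assms unfolding in_L2_def by auto
qed

lemma has_weak_partial_nth:
  fixes u v :: "real^'n \<Rightarrow> real^'m"
  shows "has_weak_partial i u v \<Longrightarrow> has_weak_partial i (\<lambda>x. u x $ k) (\<lambda>x. v x $ k)"
  using has_weak_partial_inner[of i u v "axis k 1"] by (simp add: inner_axis)

lemma in_L2_nth:
  fixes u :: "real^'n \<Rightarrow> real^'m"
  assumes "in_L2 u" shows "in_L2 (\<lambda>x. u x $ k)"
proof -
  note [measurable] = in_L2_measurable[OF assms]
  have "(\<lambda>x. u x \<bullet> axis k 1) \<in> borel_measurable borel" by measurable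
  then have m: "(\<lambda>x. u x $ k) \<in> borel_measurable borel" by (simp add: inner_axis)
  have "integrable lborel (\<lambda>x. (u x $ k)\<^sup>2)"
  proof (rule Bochner_Integration.integrable_bound)
    show "integrable lborel (\<lambda>x. (norm (u x))\<^sup>2)" using assms unfolding in_L2_def by auto
    show "AE x in lborel. norm ((u x $ k)\<^sup>2) \<le> norm ((norm (u x))\<^sup>2)"
      using component_le_norm_cart by (intro AE_I2) (auto simp: abs_le_square_iff[symmetric])
  qed (use m in measurable)
  then show ?thesis using m by (simp add: in_L2_real_iff)
qed

lemma in_H2D:
  fixes u :: "real^'n \<Rightarrow> 'b::euclidean_space"
  assumes "in_H2 u"
  shows "in_L2 u" "has_weak_partial i u (weak_partial i u)" "in_L2 (weak_partial i u)"
    "has_weak_partial j (weak_partial i u) (weak_partial j (weak_partial i u))"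
    "in_L2 (weak_partial j (weak_partial i u))"
  using assms has_weak_partial_weak_partial unfolding in_H2_def weakly_differentiable_def by blast+

lemma weak_partial_cong_AE:
  fixes u u' v :: "real^'n \<Rightarrow> 'b::euclidean_space"
  assumes "has_weak_partial j u v" "u' \<in> borel_measurable borel" "AE x in lborel. u x = u' x"
  shows "has_weak_partial j u' (weak_partial j u')" "AE x in lborel. weak_partial j u' x = v x"
proof -
  have "has_weak_partial j u' v"
    by (rule has_weak_partial_cong_AE[OF assms(1,2) has_weak_partial_measurable(2)[OF assms(1)] assms(3)]) auto
  then show "has_weak_partial j u' (weak_partial j u')" "AE x in lborel. weak_partial j u' x = v x"
    using has_weak_partial_weak_partial weak_partial_AE_eq by blast+
qed

text \<open>The representatives of the weak derivatives of \<open>u\<close> and \<open>u + c\<close> chosen by \<open>weak_partial\<close>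
  agree only almost everywhere.\<close>

lemma shifted_weak_partials:
  fixes u v w :: "real^'n \<Rightarrow> 'b::euclidean_space"
  assumes v: "has_weak_partial i u v" and w: "has_weak_partial j v w"
  shows "has_weak_partial i (\<lambda>x. u x + c) (weak_partial i (\<lambda>x. u x + c))"
    "AE x in lborel. weak_partial i (\<lambda>x. u x + c) x = v x"
    "has_weak_partial j (weak_partial i (\<lambda>x. u x + c)) (weak_partial j (weak_partial i (\<lambda>x. u x + c)))"
    "AE x in lborel. weak_partial j (weak_partial i (\<lambda>x. u x + c)) x = w x"
proof -
  have h: "has_weak_partial i (\<lambda>x. u x + c) v" by (rule has_weak_partial_add_const[OF v])
  show 1: "has_weak_partial i (\<lambda>x. u x + c) (weak_partial i (\<lambda>x. u x + c))"
    by (rule has_weak_partial_weak_partial[OF h])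
  show 2: "AE x in lborel. weak_partial i (\<lambda>x. u x + c) x = v x" by (rule weak_partial_AE_eq[OF h])
  then have e: "AE x in lborel. v x = weak_partial i (\<lambda>x. u x + c) x" by eventually_elim simp
  show "has_weak_partial j (weak_partial i (\<lambda>x. u x + c)) (weak_partial j (weak_partial i (\<lambda>x. u x + c)))"
    "AE x in lborel. weak_partial j (weak_partial i (\<lambda>x. u x + c)) x = w x"
    using weak_partial_cong_AE[OF w has_weak_partial_measurable(2)[OF 1] e] by auto
qed

text \<open>\<open>admissible\<close> imposes the Sobolev condition on m - e3, while energy and
  degree use the representatives \<open>weak_partial i m\<close>; the two families agree almost
  everywhere.\<close>

lemma admissible_weak_partials:
  assumes m: "m \<in> admissible"
  shows "in_L2 (\<lambda>x. m x - e3)"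
    "has_weak_partial i (\<lambda>x. m x - e3) (weak_partial i m)" "in_L2 (weak_partial i m)"
    "has_weak_partial j (weak_partial i m) (weak_partial j (weak_partial i m))"
    "in_L2 (weak_partial j (weak_partial i m))"
proof -
  let ?u = "\<lambda>x. m x - e3"
  have h: "in_H2 ?u" using m unfolding admissible_def by auto
  have eq: "(\<lambda>x. ?u x + e3) = m" by auto
  note s = shifted_weak_partials[OF in_H2D(2)[OF h, of i] in_H2D(4)[OF h, of j i], of e3, unfolded eq]
  show "in_L2 ?u" by (rule in_H2D(1)[OF h])
  show "has_weak_partial i ?u (weak_partial i m)"
    using has_weak_partial_add_const[OF s(1), of "- e3"] by simp
  show "has_weak_partial j (weak_partial i m) (weak_partial j (weak_partial i m))" by (rule s(3))
  have f: "AE x in lborel. P x = (Q x :: real^3)" if "AE x in lborel. Q x = P x" for P Q :: "real^2 \<Rightarrow> real^3"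
    using that by eventually_elim simp
  show "in_L2 (weak_partial i m)"
    by (rule in_L2_cong_AE[OF in_H2D(3)[OF h] has_weak_partial_measurable(2)[OF s(1)] f[OF s(2)]])
  show "in_L2 (weak_partial j (weak_partial i m))"
    by (rule in_L2_cong_AE[OF in_H2D(5)[OF h] has_weak_partial_measurable(2)[OF s(3)] f[OF s(4)]])
qed

lemma admissible_components:
  assumes m: "m \<in> admissible"
  shows "in_L2 (\<lambda>x. m x $ k - e3 $ k)"
    "has_weak_partial i (\<lambda>x. m x $ k - e3 $ k) (\<lambda>x. weak_partial i m x $ k)" "in_L2 (\<lambda>x. weak_partial i m x $ k)"
    "has_weak_partial j (\<lambda>x. weak_partial i m x $ k) (\<lambda>x. weak_partial j (weak_partial i m) x $ k)"
    "in_L2 (\<lambda>x. weak_partial j (weak_partial i m) x $ k)"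
  using in_L2_nth[OF admissible_weak_partials(1)[OF m], of k]
    has_weak_partial_nth[OF admissible_weak_partials(2)[OF m], of i k]
    in_L2_nth[OF admissible_weak_partials(3)[OF m]] in_L2_nth[OF admissible_weak_partials(5)[OF m]]
    has_weak_partial_nth[OF admissible_weak_partials(4)[OF m]]
  by simp_all

lemma e3_nth [simp]: "e3 $ 1 = 0" "e3 $ 2 = 0" "e3 $ 3 = 1"
  by (simp_all add: e3_def)

lemma norm_power2_cart: "(norm (x :: real^'n))\<^sup>2 = (\<Sum>k\<in>UNIV. (x $ k)\<^sup>2)"
  by (simp add: norm_vec_def L2_set_def sum_nonneg)

lemma sphere_components:
  fixes y :: "real^3"
  shows "y \<in> sphere 0 1 \<longleftrightarrow> (y $ 1)\<^sup>2 + (y $ 2)\<^sup>2 + (y $ 3)\<^sup>2 = 1"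
proof -
  have "y \<in> sphere 0 1 \<longleftrightarrow> (norm y)\<^sup>2 = 1\<^sup>2" 
    using norm_ge_zero[of y] power2_eq_1_iff[of "norm y"] by (simp, linarith)
  then show ?thesis by (simp add: norm_power2_cart sum_3)
qed

lemma sphere_abs_le: "y \<in> sphere 0 1 \<Longrightarrow> \<bar>y $ k\<bar> \<le> 1" for y :: "real^3"
  using component_le_norm_cart[of y k] by simp

lemma one_minus_third:
  fixes y :: "real^3"
  assumes "y \<in> sphere 0 1"
  shows "1 - y $ 3 = 1/2 * (\<Sum>k\<in>UNIV. (y $ k - e3 $ k)\<^sup>2)"
  using assms unfolding sphere_components by (simp add: sum_3 power2_eq_square algebra_simps)

definition helmholtz :: "(real^2 \<Rightarrow> real^3) \<Rightarrow> 3 \<Rightarrow> real^2 \<Rightarrow> real" where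
  "helmholtz m k x = weak_laplacian m x $ k + 1/2 * (m x $ k - e3 $ k)"

lemma admissible_laplacian:
  assumes m: "m \<in> admissible"
  shows "in_L2 (\<lambda>x. weak_laplacian m x $ k)"
  unfolding weak_laplacian_def by (auto simp: intro!: in_L2_sum admissible_components[OF m])

lemma integrable_one_minus_third: "m \<in> admissible \<Longrightarrow> integrable lborel (\<lambda>x. 1 - m x $ 3)"
  using one_minus_third in_L2_integrable_square[OF admissible_components(1)]
  by (subst Bochner_Integration.integrable_cong[OF refl one_minus_third]) (auto simp: admissible_def)

lemma integrable_energy_terms:
  assumes m: "m \<in> admissible"
  shows "integrable lborel (grad_sq m)" "integrable lborel (\<lambda>x. (norm (weak_laplacian m x))\<^sup>2)"
proof -
  show "integrable lborel (grad_sq m)"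
    unfolding grad_sq_def[abs_def] norm_power2_cart
    by (intro Bochner_Integration.integrable_sum in_L2_integrable_square admissible_components m)
  show "integrable lborel (\<lambda>x. (norm (weak_laplacian m x))\<^sup>2)"
    unfolding norm_power2_cart
    by (intro Bochner_Integration.integrable_sum in_L2_integrable_square admissible_laplacian m)
qed

lemma energy_eq_quarter:
  assumes m: "m \<in> admissible"
  shows "energy H m = energy (1/4) m + (H - 1/4) * (LINT x|lborel. 1 - m x $ 3)"
proof -
  define A where "A x = - (1/2) * grad_sq m x + 1/2 * (norm (weak_laplacian m x))\<^sup>2" for x
  have "integrable lborel A"
    unfolding A_def using integrable_energy_terms[OF m] by auto
  then have "energy H m = (LINT x|lborel. A x) + H * (LINT x|lborel. 1 - m x $ 3)" for H
    unfolding energy_def A_def[symmetric] using integrable_one_minus_third[OF m] by simp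
  then show ?thesis by (simp add: algebra_simps)
qed

lemma energy_quarter_eq:
  assumes m: "m \<in> admissible"
  shows "energy (1/4) m = 1/2 * (\<Sum>k\<in>UNIV. LINT x|lborel. (helmholtz m k x)\<^sup>2)"
proof -
  define U where "U k x = m x $ k - e3 $ k" for k x
  define a where "a i k x = weak_partial i m x $ k" for i :: 2 and k x
  define b where "b i k x = weak_partial i (weak_partial i m) x $ k" for i :: 2 and k x
  define l where "l k x = weak_laplacian m x $ k" for k x
  have l_eq: "l k x = (\<Sum>i\<in>UNIV. b i k x)" for k x unfolding l_def b_def weak_laplacian_def by simp
  have L2: "in_L2 (U k)" "in_L2 (a i k)" "in_L2 (b i k)" "in_L2 (l k)"
    and w: "has_weak_partial i (U k) (a i k)" "has_weak_partial i (a i k) (b i k)" for i k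
    unfolding U_def[abs_def] a_def[abs_def] b_def[abs_def] l_def[abs_def]
    using admissible_components[OF m] admissible_laplacian[OF m] by auto
  note i2 = in_L2_integrable_square[OF L2(1)] in_L2_integrable_square[OF L2(2)] in_L2_integrable_square[OF L2(4)]
    in_L2_integrable_mult[OF L2(1) L2(4)] in_L2_integrable_mult[OF L2(1) L2(3)]
  \<comment> \<open>Trades the gradient term for the cross term in the square of Delta U + U /
    2.\<close>
  have ibp: "(\<Sum>i\<in>UNIV. LINT x|lborel. (a i k x)\<^sup>2) = - (LINT x|lborel. U k x * l k x)" for k
  proof -
    have "(LINT x|lborel. (a i k x)\<^sup>2) = - (LINT x|lborel. U k x * b i k x)" for i
      unfolding power2_eq_square by (rule L2_integration_by_parts[OF L2(1,2) w(1) L2(2,3) w(2)])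
    then show ?thesis
      unfolding l_eq using i2 by (simp add: sum_distrib_left sum_negf)
  qed
  have "energy (1/4) m = (LINT x|lborel. 1/2 * (\<Sum>k\<in>UNIV. (l k x)\<^sup>2 - (\<Sum>i\<in>UNIV. (a i k x)\<^sup>2) + 1/4 * (U k x)\<^sup>2))"
    unfolding energy_def
  proof (rule Bochner_Integration.integral_cong[OF refl])
    fix x
    have "m x \<in> sphere 0 1" using m unfolding admissible_def by auto
    have g: "grad_sq m x = (\<Sum>k\<in>UNIV. \<Sum>i\<in>UNIV. (a i k x)\<^sup>2)"
      unfolding grad_sq_def norm_power2_cart a_def by (rule sum.swap)
    show "- (1 / 2) * grad_sq m x + 1 / 2 * (norm (weak_laplacian m x))\<^sup>2 + 1 / 4 * (1 - m x $ 3) =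
      1/2 * (\<Sum>k\<in>UNIV. (l k x)\<^sup>2 - (\<Sum>i\<in>UNIV. (a i k x)\<^sup>2) + 1/4 * (U k x)\<^sup>2)"
      unfolding g one_minus_third[OF \<open>m x \<in> sphere 0 1\<close>] norm_power2_cart l_def U_def
      by (simp add: sum.distrib sum_subtractf sum_distrib_left sum_negf algebra_simps)
  qed
  also have "\<dots> = 1/2 * (\<Sum>k\<in>UNIV. (LINT x|lborel. (l k x)\<^sup>2) - (\<Sum>i\<in>UNIV. LINT x|lborel. (a i k x)\<^sup>2)
      + 1/4 * (LINT x|lborel. (U k x)\<^sup>2))"
    using i2 by simp
  also have "\<dots> = 1/2 * (\<Sum>k\<in>UNIV. LINT x|lborel. (helmholtz m k x)\<^sup>2)"
  proof -
    have "(LINT x|lborel. (helmholtz m k x)\<^sup>2)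
       = (LINT x|lborel. (l k x)\<^sup>2 + U k x * l k x + 1/4 * (U k x)\<^sup>2)" for k
      by (rule Bochner_Integration.integral_cong)
        (auto simp: helmholtz_def l_def U_def power2_eq_square algebra_simps)
    then show ?thesis unfolding ibp using i2 by simp
  qed
  finally show ?thesis .
qed

section \<open>Nonlinear rules for weak derivatives of sphere-valued maps\<close>

lemma uniformly_continuous_shift:
  fixes f :: "real^'n \<Rightarrow> real"
  assumes "uniformly_continuous_on UNIV f"
  shows "uniform_limit UNIV (\<lambda>h x. f (x + h *\<^sub>R axis i 1)) f (at 0)"
proof (rule uniform_limitI)
  fix e :: real assume "e > 0"
  then obtain d where d: "d > 0" "\<And>x y. dist y x < d \<Longrightarrow> dist (f y) (f x) < e"
    using assms unfolding uniformly_continuous_on_def by (metis UNIV_I)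
  have "\<forall>\<^sub>F h in at (0::real). \<bar>h\<bar> < d"
    using d(1) by (auto simp: eventually_at dist_real_def)
  then show "\<forall>\<^sub>F h in at 0. \<forall>x\<in>UNIV. dist (f (x + h *\<^sub>R axis i 1)) (f x) < e"
  proof (eventually_elim, intro ballI)
    fix h :: real and x :: "real^'n" assume "\<bar>h\<bar> < d"
    then show "dist (f (x + h *\<^sub>R axis i 1)) (f x) < e"
      by (intro d(2)) (simp add: dist_norm norm_axis_1)
  qed
qed

text \<open>Converse of \<open>diffq_weak_tendsto\<close>: a weak limit of difference quotients is a
  weak derivative. It yields the weak quotient rule needed for m1 / (1 + m3) and m2 / (1 +
  m3).\<close>

lemma has_weak_partialI_diffq:
  fixes f F :: "real^'n \<Rightarrow> real"
  assumes f: "in_L2 f" and F: "in_L2 F"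
    and l: "\<And>\<phi>. test_function \<phi> \<Longrightarrow> ((\<lambda>h. LINT x|lborel. diffq i h f x * \<phi> x) \<longlongrightarrow> (LINT x|lborel. F x * \<phi> x)) (at 0)"
  shows "has_weak_partial i f F"
  unfolding has_weak_partial_def
proof (intro conjI allI impI)
  show "locally_integrable f" "locally_integrable F" using f F in_L2_locally_integrable by auto
  fix \<phi> :: "real^'n \<Rightarrow> real" assume t: "test_function \<phi>"
  have pL: "in_L2 \<phi>" by (rule in_L2_test_function[OF t])
  have "((\<lambda>h. LINT x|lborel. diffq i (- h) \<phi> x * f x) \<longlongrightarrow> (LINT x|lborel. partial_deriv i \<phi> x * f x)) (at 0)"
    by (rule filterlim_compose[OF diffq_test_function_tendsto[OF in_L2_locally_integrable[OF f] t] filterlim_uminus_at_0])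
  from tendsto_minus[OF this]
  have "((\<lambda>h. LINT x|lborel. diffq i h f x * \<phi> x) \<longlongrightarrow> - (LINT x|lborel. partial_deriv i \<phi> x * f x)) (at 0)"
    unfolding diffq_by_parts[OF f pL] by (simp add: mult.commute)
  from tendsto_unique[OF _ this l[OF t]]
  show "(LINT x|lborel. partial_deriv i \<phi> x *\<^sub>R f x) = - (LINT x|lborel. \<phi> x *\<^sub>R F x)"
    by (simp add: mult.commute)
qed

lemma admissible_component_uniformly_continuous:
  assumes "m \<in> admissible" shows "uniformly_continuous_on UNIV (\<lambda>x. m x $ k)"
  using assms unfolding admissible_def uniformly_continuous_on_def
  by (auto, meson dist_vec_nth_le le_less_trans)

lemma admissible_component_measurable:
  assumes "m \<in> admissible" shows "(\<lambda>x. m x $ k) \<in> borel_measurable borel"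
  using admissible_component_uniformly_continuous[OF assms]
  by (intro borel_measurable_continuous_onI uniformly_continuous_imp_continuous)

lemma diffq_const: "diffq i h (\<lambda>x. f x - c) = diffq i h f"
  by (auto simp: diffq_def)

text \<open>The difference of |m|^2 at two points of a line is the inner product of m(x + h) + m(x)
  with m(x + h) - m(x), and it is 0 on the sphere. After division by h the first factor converges
  uniformly and the second weakly.\<close>

lemma orthogonal_weak_partial:
  assumes m: "m \<in> admissible"
  shows "AE x in lborel. (\<Sum>k\<in>UNIV. m x $ k * weak_partial i m x $ k) = 0"
proof (rule AE_eq_0_of_test_functions)
  have sph: "m x \<in> sphere 0 1" for x using m unfolding admissible_def by auto
  note comp = admissible_components[OF m] and meas = admissible_component_measurable[OF m]
  have L: "in_L2 (\<lambda>x. m x $ k * weak_partial i m x $ k)" for k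
    by (rule in_L2_bounded_mult[OF comp(3) meas sphere_abs_le[OF sph]])
  show "locally_integrable (\<lambda>x. \<Sum>k\<in>UNIV. m x $ k * weak_partial i m x $ k)"
    by (intro in_L2_locally_integrable in_L2_sum L)
  fix \<phi> :: "real^2 \<Rightarrow> real" assume t: "test_function \<phi>"
  have pL: "in_L2 \<phi>" by (rule in_L2_test_function[OF t])
  let ?c = "\<lambda>h k x. m (x + h *\<^sub>R axis i 1) $ k + m x $ k"
  have cm: "(\<lambda>x. ?c h k x) \<in> borel_measurable borel" for h k
    using meas[of k] by measurable
  have u: "uniform_limit UNIV (\<lambda>h x. ?c h k x) (\<lambda>x. m x $ k + m x $ k) (at 0)" for k
    by (intro uniform_limit_intros uniformly_continuous_shift admissible_component_uniformly_continuous m)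
  have b: "\<bar>m x $ k + m x $ k\<bar> \<le> 2" for x k using sphere_abs_le[OF sph, of x k] by linarith
  have b': "\<bar>?c h k x\<bar> \<le> 2" for h x k
    using sphere_abs_le[OF sph, of x k] sphere_abs_le[OF sph, of "x + h *\<^sub>R axis i 1" k] by linarith
  have "((\<lambda>h. \<Sum>k\<in>UNIV. LINT x|lborel. ?c h k x * diffq i h (\<lambda>x. m x $ k - e3 $ k) x * \<phi> x)
     \<longlongrightarrow> (\<Sum>k\<in>UNIV. LINT x|lborel. (m x $ k + m x $ k) * weak_partial i m x $ k * \<phi> x)) (at 0)"
  proof (rule tendsto_sum)
    show "((\<lambda>h. LINT x|lborel. ?c h k x * diffq i h (\<lambda>x. m x $ k - e3 $ k) x * \<phi> x)
     \<longlongrightarrow> (LINT x|lborel. (m x $ k + m x $ k) * weak_partial i m x $ k * \<phi> x)) (at 0)" for k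
      by (rule diffq_weak_tendsto_coeff[OF comp(1,3,2) pL _ b cm u]) (use meas[of k] in measurable)
  qed
  moreover have "(\<Sum>k\<in>UNIV. LINT x|lborel. ?c h k x * diffq i h (\<lambda>x. m x $ k - e3 $ k) x * \<phi> x) = 0" for h
  proof -
    have "integrable lborel (\<lambda>x. ?c h k x * diffq i h (\<lambda>x. m x $ k - e3 $ k) x * \<phi> x)" for k
      by (rule in_L2_integrable_mult[OF in_L2_bounded_mult[OF in_L2_diffq[OF comp(1)] cm b'] pL])
    then have "(\<Sum>k\<in>UNIV. LINT x|lborel. ?c h k x * diffq i h (\<lambda>x. m x $ k - e3 $ k) x * \<phi> x)
      = (LINT x|lborel. (\<Sum>k\<in>UNIV. ?c h k x * diffq i h (\<lambda>x. m x $ k - e3 $ k) x * \<phi> x))"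
      by (subst Bochner_Integration.integral_sum) auto
    moreover have "(\<Sum>k\<in>UNIV. ?c h k x * diffq i h (\<lambda>x. m x $ k - e3 $ k) x * \<phi> x) = 0" for x
    proof -
      let ?y = "x + h *\<^sub>R axis i 1"
      have "(\<Sum>k\<in>UNIV. ?c h k x * diffq i h (\<lambda>x. m x $ k - e3 $ k) x * \<phi> x)
         = ((\<Sum>k\<in>UNIV. (m ?y $ k)\<^sup>2) - (\<Sum>k\<in>UNIV. (m x $ k)\<^sup>2)) / h * \<phi> x"
        unfolding diffq_const by (simp add: diffq_def sum_3 power2_eq_square algebra_simps add_divide_distrib diff_divide_distrib)
      then show ?thesis using sph[of x, unfolded sphere_components] sph[of ?y, unfolded sphere_components]
        by (simp add: sum_3)
    qed
    ultimately show ?thesis by simp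
  qed
  ultimately have "0 = (\<Sum>k\<in>UNIV. LINT x|lborel. (m x $ k + m x $ k) * weak_partial i m x $ k * \<phi> x)"
    by (simp add: tendsto_const_iff)
  moreover have "(LINT x|lborel. (m x $ k + m x $ k) * weak_partial i m x $ k * \<phi> x)
    = 2 * (LINT x|lborel. \<phi> x * (m x $ k * weak_partial i m x $ k))" for k
    by (subst Bochner_Integration.integral_mult_right_zero[symmetric])
      (auto intro!: Bochner_Integration.integral_cong simp: algebra_simps)
  moreover have "(LINT x|lborel. \<phi> x * (\<Sum>k\<in>UNIV. m x $ k * weak_partial i m x $ k))
    = (\<Sum>k\<in>UNIV. LINT x|lborel. \<phi> x * (m x $ k * weak_partial i m x $ k))"
    unfolding sum_distrib_left using in_L2_integrable_mult[OF pL L] by simp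
  ultimately show "(LINT x|lborel. \<phi> x * (\<Sum>k\<in>UNIV. m x $ k * weak_partial i m x $ k)) = 0"
    by (simp add: sum_distrib_left[symmetric])
qed

section \<open>Maps avoiding the south pole\<close>

text \<open>Off the south pole the area form of the sphere is the exterior derivative of g (m1 dm2 -
  m2 dm1). The right-hand side is the form d(m1 g) dm2 - d(m2 g) dm1 evaluated on tangent vectors a
  and b, which stand for the two partial derivatives of m.\<close>

lemma pullback_area_form:
  fixes m a b :: "real^3"
  assumes s: "(m $ 1)\<^sup>2 + (m $ 2)\<^sup>2 + (m $ 3)\<^sup>2 = 1"
    and a: "m $ 1 * a $ 1 + m $ 2 * a $ 2 + m $ 3 * a $ 3 = 0"
    and b: "m $ 1 * b $ 1 + m $ 2 * b $ 2 + m $ 3 * b $ 3 = 0"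
    and g: "g * (1 + m $ 3) = 1"
  shows "m \<bullet> cross3 a b =
    ((g * a $ 1 - m $ 1 * g\<^sup>2 * a $ 3) * b $ 2 - (g * b $ 1 - m $ 1 * g\<^sup>2 * b $ 3) * a $ 2)
    - ((g * a $ 2 - m $ 2 * g\<^sup>2 * a $ 3) * b $ 1 - (g * b $ 2 - m $ 2 * g\<^sup>2 * b $ 3) * a $ 1)"
proof -
  define c1 c2 c3 where "c1 = a $ 2 * b $ 3 - a $ 3 * b $ 2" and "c2 = a $ 3 * b $ 1 - a $ 1 * b $ 3"
    and "c3 = a $ 1 * b $ 2 - a $ 2 * b $ 1"
  define D where "D = m $ 1 * c1 + m $ 2 * c2 + m $ 3 * c3"
  have D: "m \<bullet> cross3 a b = D"
    by (simp add: D_def c1_def c2_def c3_def cross3_def inner_vec_def sum_3 algebra_simps)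
  \<comment> \<open>Both a and b are orthogonal to the unit vector m, so their cross product is
    parallel to m.\<close>
  have p: "c1 = D * m $ 1" "c2 = D * m $ 2" "c3 = D * m $ 3"
    using s a b unfolding D_def c1_def c2_def c3_def by algebra+
  have "((g * a $ 1 - m $ 1 * g\<^sup>2 * a $ 3) * b $ 2 - (g * b $ 1 - m $ 1 * g\<^sup>2 * b $ 3) * a $ 2)
    - ((g * a $ 2 - m $ 2 * g\<^sup>2 * a $ 3) * b $ 1 - (g * b $ 2 - m $ 2 * g\<^sup>2 * b $ 3) * a $ 1)
    = 2 * g * c3 + g\<^sup>2 * (m $ 1 * c1 + m $ 2 * c2)"
    unfolding c1_def c2_def c3_def by (simp add: algebra_simps)
  \<comment> \<open>What remains is 2 g m3 + g^2 (1 - m3^2) = g (1 + m3) = 1.\<close>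
  also have "\<dots> = D" using s g unfolding p by algebra
  finally show ?thesis using D by simp
qed

lemma degree_eq_0_if_avoids_south_pole:
  assumes m: "m \<in> admissible" and av: "\<And>x. m x \<noteq> - e3"
  shows "degree_Q m = 0"
proof -
  have sph: "m x \<in> sphere 0 1" for x using m unfolding admissible_def by auto
  note comp = admissible_components[OF m] and meas = admissible_component_measurable[OF m]
    and uc = admissible_component_uniformly_continuous[OF m]
  have cont: "continuous_on S (\<lambda>x. m x $ k)" for S k
    using uniformly_continuous_imp_continuous[OF uc] continuous_on_subset by blast
  \<comment> \<open>Near infinity m3 is positive, and on the remaining ball 1 + m3 attains a
    positive minimum; so g is bounded and uniformly continuous.\<close>
  obtain \<delta> where \<delta>: "\<delta> > 0" "\<And>x. 1 + m x $ 3 \<ge> \<delta>"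
  proof -
    have "((\<lambda>x. m x $ 3) \<longlongrightarrow> e3 $ 3) at_infinity"
      using m unfolding admissible_def by (intro tendsto_vec_nth) auto
    then have "\<forall>\<^sub>F x in at_infinity. m x $ 3 > 0" by (intro order_tendstoD(1)) auto
    then obtain B where B: "\<And>x. norm x \<ge> B \<Longrightarrow> m x $ 3 > 0" unfolding eventually_at_infinity by blast
    have "continuous_on (cball 0 \<bar>B\<bar>) (\<lambda>x. 1 + m x $ 3)" by (intro continuous_intros cont)
    then obtain x0 where "\<forall>x\<in>cball 0 \<bar>B\<bar>. 1 + m x0 $ 3 \<le> 1 + m x $ 3"
      using continuous_attains_inf[OF compact_cball, of 0 "\<bar>B\<bar>" "\<lambda>x. 1 + m x $ 3"] by fastforce
    then have x0: "1 + m x0 $ 3 \<le> 1 + m x $ 3" if "x \<in> cball 0 \<bar>B\<bar>" for x using that by blast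
    have p: "1 + m x0 $ 3 > 0"
    proof (rule ccontr)
      assume "\<not> 1 + m x0 $ 3 > 0"
      then have 3: "m x0 $ 3 = - 1" using sphere_abs_le[OF sph, of x0 3] by linarith
      then have "(m x0 $ 1)\<^sup>2 + (m x0 $ 2)\<^sup>2 = 0" using sph[of x0, unfolded sphere_components] by simp
      then have "m x0 $ 1 = 0" "m x0 $ 2 = 0" by (auto simp: sum_power2_eq_zero_iff)
      then have "m x0 = - e3" using 3 by (simp add: vec_eq_iff forall_3)
      then show False using av by blast
    qed
    show ?thesis
    proof (rule that[of "min 1 (1 + m x0 $ 3)"])
      show "min 1 (1 + m x0 $ 3) \<le> 1 + m x $ 3" for x
      proof (cases "norm x \<ge> B")
        case False
        then have "norm x \<le> \<bar>B\<bar>" by linarith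
        then show ?thesis using x0[of x] by simp
      qed (use B[of x] in simp)
    qed (use p in auto)
  qed
  define g where "g x = 1 / (1 + m x $ 3)" for x
  have g1: "g x * (1 + m x $ 3) = 1" for x unfolding g_def using \<delta>(1) \<delta>(2)[of x] by simp
  have gb: "\<bar>g x\<bar> \<le> 1 / \<delta>" for x unfolding g_def using \<delta>(1) \<delta>(2)[of x] by (simp add: frac_le)
  have gm [measurable]: "g \<in> borel_measurable borel" unfolding g_def using meas[of 3] by measurable
  have mm [measurable]: "(\<lambda>x. m x $ k) \<in> borel_measurable borel" for k by (rule meas)
  have gdiff: "g y - g x = - (g x * g y * (m y $ 3 - m x $ 3))" for x y
    using g1[of x] g1[of y] by algebra
  have guc: "uniformly_continuous_on UNIV g"
    unfolding uniformly_continuous_on_def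
  proof (intro allI impI)
    fix e :: real assume e: "e > 0"
    then have "e * \<delta>\<^sup>2 > 0" using \<delta> by simp
    then obtain d where d: "d > 0" "\<And>x y. dist y x < d \<Longrightarrow> dist (m y $ 3) (m x $ 3) < e * \<delta>\<^sup>2"
      using uc[of 3] unfolding uniformly_continuous_on_def by (metis UNIV_I)
    have "dist (g y) (g x) < e" if "dist y x < d" for x y
    proof -
      have "\<bar>g x * g y * (m y $ 3 - m x $ 3)\<bar> \<le> (1 / \<delta> * (1 / \<delta>)) * \<bar>m y $ 3 - m x $ 3\<bar>"
        unfolding abs_mult using gb \<delta> by (intro mult_mono) auto
      also have "\<dots> < (1 / \<delta> * (1 / \<delta>)) * (e * \<delta>\<^sup>2)"
        using d(2)[OF that] \<delta> by (intro mult_strict_left_mono) (auto simp: dist_real_def)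
      also have "\<dots> = e" using \<delta> by (simp add: power2_eq_square)
      finally show ?thesis unfolding dist_real_def gdiff[of y x] by simp
    qed
    then show "\<exists>d>0. \<forall>x\<in>UNIV. \<forall>y\<in>UNIV. dist y x < d \<longrightarrow> dist (g y) (g x) < e" using d(1) by blast
  qed
  \<comment> \<open>F is what the quotient rule predicts for the derivative of m_k g. The condition
    \<open>e3 $ k = 0\<close> below selects the components that vanish at infinity, which makes f
    square integrable.\<close>
  define f where "f k x = m x $ k * g x" for k x
  define F where "F k i x = g x * weak_partial i m x $ k - m x $ k * (g x)\<^sup>2 * weak_partial i m x $ 3" for k i x
  have cb: "\<bar>m x $ k * g x * g y\<bar> \<le> 1 / \<delta> * (1 / \<delta>)" for k x y
  proof -
    have "\<bar>m x $ k * g x * g y\<bar> \<le> (1 * (1 / \<delta>)) * (1 / \<delta>)"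
      unfolding abs_mult using gb sphere_abs_le[OF sph] \<delta> by (intro mult_mono) auto
    then show ?thesis by simp
  qed
  have FL: "in_L2 (F k i)" for k i
  proof -
    have "in_L2 (\<lambda>x. g x * weak_partial i m x $ k)" by (rule in_L2_bounded_mult[OF comp(3) gm gb])
    moreover have "in_L2 (\<lambda>x. (m x $ k * g x * g x) * weak_partial i m x $ 3)"
      by (rule in_L2_bounded_mult[OF comp(3) _ cb]) measurable
    ultimately show ?thesis unfolding F_def[abs_def]
      using in_L2_diff by (fastforce simp: power2_eq_square mult.assoc)
  qed
  have fL: "in_L2 (f k)" if "e3 $ k = 0" for k
    using in_L2_bounded_mult[OF comp(1)[of k] gm gb] that by (simp add: f_def[abs_def] mult.commute)
  have w: "has_weak_partial i (f k) (F k i)" if k: "e3 $ k = 0" for k i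
  proof (rule has_weak_partialI_diffq[OF fL[OF k] FL])
    fix \<phi> :: "real^2 \<Rightarrow> real" assume t: "test_function \<phi>"
    have pL: "in_L2 \<phi>" by (rule in_L2_test_function[OF t])
    let ?U = "\<lambda>k x. m x $ k - e3 $ k" and ?s = "\<lambda>h x. x + h *\<^sub>R axis i 1"
    have l1: "((\<lambda>h. LINT x|lborel. g (?s h x) * diffq i h (?U k) x * \<phi> x) \<longlongrightarrow>
        (LINT x|lborel. g x * weak_partial i m x $ k * \<phi> x)) (at 0)"
      by (rule diffq_weak_tendsto_coeff[OF comp(1,3,2) pL gm gb _ uniformly_continuous_shift[OF guc]]) measurable
    have u2: "uniform_limit UNIV (\<lambda>h x. m x $ k * g x * g (?s h x)) (\<lambda>x. m x $ k * g x * g x) (at 0)"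
    proof (rule uniform_limit_intros)
      show "uniform_limit UNIV (\<lambda>h x. m x $ k * g x) (\<lambda>x. m x $ k * g x) (at 0)"
        by (rule uniform_limit_const)
      show "bounded ((\<lambda>x. m x $ k * g x) ` UNIV)"
      proof (intro boundedI[of _ "1 * (1 / \<delta>)"])
        fix y assume "y \<in> range (\<lambda>x. m x $ k * g x)"
        then obtain x where y: "y = m x $ k * g x" by auto
        show "norm y \<le> 1 * (1 / \<delta>)"
          unfolding y real_norm_def abs_mult using gb sphere_abs_le[OF sph] by (intro mult_mono) auto
      qed
      show "bounded (g ` UNIV)" using gb by (intro boundedI[of _ "1 / \<delta>"]) auto
    qed (rule uniformly_continuous_shift[OF guc])
    have l2: "((\<lambda>h. LINT x|lborel. (m x $ k * g x * g (?s h x)) * diffq i h (?U 3) x * \<phi> x) \<longlongrightarrow>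
        (LINT x|lborel. (m x $ k * g x * g x) * weak_partial i m x $ 3 * \<phi> x)) (at 0)"
      by (rule diffq_weak_tendsto_coeff[OF comp(1,3,2) pL _ cb _ u2]) measurable
    have i1: "integrable lborel (\<lambda>x. g (x + a) * v x * \<phi> x)" if "in_L2 v" for v a
      by (rule in_L2_integrable_mult[OF in_L2_bounded_mult[OF that _ gb] pL]) measurable
    have i2: "integrable lborel (\<lambda>x. (m x $ k * g x * g (x + a)) * v x * \<phi> x)" if "in_L2 v" for v a
      by (rule in_L2_integrable_mult[OF in_L2_bounded_mult[OF that _ cb] pL]) measurable
    \<comment> \<open>The exact product rule for difference quotients; by \<open>gdiff\<close> the
      increment of g is an increment of m3 with the coefficient - g(x) g(x + h).\<close>
    have e1: "(LINT x|lborel. g (?s h x) * diffq i h (?U k) x * \<phi> x)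
      - (LINT x|lborel. (m x $ k * g x * g (?s h x)) * diffq i h (?U 3) x * \<phi> x)
      = (LINT x|lborel. diffq i h (f k) x * \<phi> x)" for h
    proof -
      have "g (?s h x) * diffq i h (?U k) x * \<phi> x - (m x $ k * g x * g (?s h x)) * diffq i h (?U 3) x * \<phi> x
        = diffq i h (f k) x * \<phi> x" for x
      proof -
        have "diffq i h (f k) x = (g (?s h x) * (m (?s h x) $ k - m x $ k) + m x $ k * (g (?s h x) - g x)) / h"
          by (simp add: diffq_def f_def algebra_simps)
        also have "\<dots> = g (?s h x) * diffq i h (?U k) x - (m x $ k * g x * g (?s h x)) * diffq i h (?U 3) x"
          unfolding gdiff by (simp add: diffq_def diff_divide_distrib add_divide_distrib algebra_simps)
        finally show ?thesis by (simp only: left_diff_distrib)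
      qed
      then show ?thesis
        by (subst Bochner_Integration.integral_diff[symmetric]) (auto intro: i1 i2 in_L2_diffq comp simp del: e3_nth)
    qed
    have e2: "(LINT x|lborel. g x * weak_partial i m x $ k * \<phi> x)
       - (LINT x|lborel. (m x $ k * g x * g x) * weak_partial i m x $ 3 * \<phi> x) = (LINT x|lborel. F k i x * \<phi> x)"
      using i1[OF comp(3), of 0] i2[OF comp(3), of 0]
      by (subst Bochner_Integration.integral_diff[symmetric]) (auto simp: F_def power2_eq_square algebra_simps)
    show "((\<lambda>h. LINT x|lborel. diffq i h (f k) x * \<phi> x) \<longlongrightarrow> (LINT x|lborel. F k i x * \<phi> x)) (at 0)"
      using tendsto_diff[OF l1 l2] unfolding e1 e2 .
  qed
  let ?d = "\<lambda>i x. weak_partial i m x"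
  have J: "(LINT x|lborel. F j 1 x * ?d 2 x $ l - F j 2 x * ?d 1 x $ l) = 0" if "e3 $ j = 0" for j l
    by (rule L2_jacobian_integral_eq_0[OF fL[OF that] FL FL w[OF that] w[OF that] comp(1,3,3,2,2)])
  have Ji: "integrable lborel (\<lambda>x. F j 1 x * ?d 2 x $ l - F j 2 x * ?d 1 x $ l)" for j l
    by (intro Bochner_Integration.integrable_diff in_L2_integrable_mult FL comp)
  have "AE x in lborel. m x \<bullet> cross3 (?d 1 x) (?d 2 x)
    = (F 1 1 x * ?d 2 x $ 2 - F 1 2 x * ?d 1 x $ 2) - (F 2 1 x * ?d 2 x $ 1 - F 2 2 x * ?d 1 x $ 1)"
    using orthogonal_weak_partial[OF m, of 1] orthogonal_weak_partial[OF m, of 2]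
  proof eventually_elim
    case (elim x)
    show ?case
      unfolding F_def by (rule pullback_area_form)
        (use elim sph[of x, unfolded sphere_components] g1 in \<open>auto simp: sum_3\<close>)
  qed
  moreover have "(\<lambda>x. m x \<bullet> cross3 (?d 1 x) (?d 2 x)) \<in> borel_measurable lborel"
    using mm in_L2_measurable[OF comp(3)] unfolding cross3_def inner_vec_def by (simp add: sum_3)
  moreover have "(\<lambda>x. (F 1 1 x * ?d 2 x $ 2 - F 1 2 x * ?d 1 x $ 2) - (F 2 1 x * ?d 2 x $ 1 - F 2 2 x * ?d 1 x $ 1))
    \<in> borel_measurable lborel"
    by (intro borel_measurable_integrable Bochner_Integration.integrable_diff[OF Ji Ji])
  ultimately have "(LINT x|lborel. m x \<bullet> cross3 (?d 1 x) (?d 2 x)) = (LINT x|lborel.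
     (F 1 1 x * ?d 2 x $ 2 - F 1 2 x * ?d 1 x $ 2) - (F 2 1 x * ?d 2 x $ 1 - F 2 2 x * ?d 1 x $ 1))"
    by (intro integral_cong_AE)
  also have "\<dots> = 0" using J[of 1 2] J[of 2 1] Ji by simp
  finally show ?thesis unfolding degree_Q_def by simp
qed

section \<open>The dual profile\<close>

definition bessel_coeff :: "nat \<Rightarrow> real" where
  "bessel_coeff k = (-1) ^ k / (fact k)\<^sup>2"

text \<open>Found by the method of Frobenius: the coefficients (-1)^k / ((s + 1) ... (s + k))^2 of
  the series with exponent s are differentiated in s at s = 0, which brings in the harmonic
  numbers.\<close>

definition bessel_log_coeff :: "nat \<Rightarrow> real" where
  "bessel_log_coeff k = - 2 * harm k * bessel_coeff k"

definition psum :: "(nat \<Rightarrow> real) \<Rightarrow> real \<Rightarrow> real" where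
  "psum c t = (\<Sum>n. c n * t ^ n)"

lemma summable_of_fact_bound:
  fixes c :: "nat \<Rightarrow> real"
  assumes "\<And>n. \<bar>c n\<bar> \<le> C / fact n"
  shows "summable (\<lambda>n. c n * t ^ n)"
proof (rule summable_comparison_test')
  show "summable (\<lambda>n. C * (inverse (fact n) * \<bar>t\<bar> ^ n))" by (intro summable_mult summable_exp)
  fix n :: nat
  have "\<bar>c n\<bar> * \<bar>t\<bar> ^ n \<le> C / fact n * \<bar>t\<bar> ^ n" using assms by (intro mult_right_mono) auto
  then show "norm (c n * t ^ n) \<le> C * (inverse (fact n) * \<bar>t\<bar> ^ n)"
    by (simp add: abs_mult power_abs field_simps)
qed

lemma summable_bessel_coeff: "summable (\<lambda>n. bessel_coeff n * t ^ n)"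
proof (rule summable_of_fact_bound[where C = 1])
  fix n
  have "(fact n :: real) \<le> (fact n)\<^sup>2" by (simp add: power2_eq_square fact_ge_1)
  then show "\<bar>bessel_coeff n\<bar> \<le> 1 / fact n"
    unfolding bessel_coeff_def by (simp add: power_abs frac_le)
qed

lemma summable_bessel_log_coeff: "summable (\<lambda>n. bessel_log_coeff n * t ^ n)"
proof (rule summable_of_fact_bound[where C = 2])
  fix n
  have h: "harm n \<le> real n" for n
  proof (induction n)
    case (Suc n)
    have "inverse (real (Suc n)) \<le> 1" by (simp add: field_simps)
    then show ?case using Suc by (simp add: harm_Suc)
  qed (simp add: harm_def)
  have "real n \<le> fact n" by (metis fact_ge_self of_nat_fact of_nat_le_iff)
  then have "harm n \<le> (fact n :: real)" using h[of n] by linarith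
  then have "harm n / (fact n)\<^sup>2 \<le> (fact n :: real) / (fact n)\<^sup>2" by (intro divide_right_mono) auto
  then show "\<bar>bessel_log_coeff n\<bar> \<le> 2 / fact n"
    unfolding bessel_log_coeff_def bessel_coeff_def
    by (simp add: abs_mult power_abs power2_eq_square harm_nonneg)
qed

lemma has_derivative_psum:
  assumes "\<And>t. summable (\<lambda>n. c n * t ^ n)"
  shows "(psum c has_real_derivative psum (diffs c) t) (at t)"
  unfolding psum_def[abs_def] by (rule termdiffs_strong_converges_everywhere[OF assms])

lemma psum_add:
  assumes "summable (\<lambda>n. c n * t ^ n)" "summable (\<lambda>n. d n * t ^ n)"
  shows "psum c t + psum d t = psum (\<lambda>n. c n + d n) t"
  unfolding psum_def using suminf_add[OF assms] by (simp add: distrib_right)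

text \<open>The operator t d^2/dt^2 + d/dt sends t^(n+1) to (n+1)^2 t^n.\<close>

lemma bessel_operator_psum:
  assumes c: "\<And>t. summable (\<lambda>n. c n * t ^ n)"
  shows "t * psum (diffs (diffs c)) t + psum (diffs c) t + psum c t
    = psum (\<lambda>n. (real (Suc n))\<^sup>2 * c (Suc n) + c n) t"
proof -
  have s1: "summable (\<lambda>n. diffs c n * t ^ n)" for t by (rule termdiff_converges_all[OF c])
  have s2: "summable (\<lambda>n. diffs (diffs c) n * t ^ n)" for t by (rule termdiff_converges_all[OF s1])
  have "(\<lambda>n. t * (real n * diffs c n * t ^ (n - Suc 0))) sums (t * psum (diffs (diffs c)) t)"
    unfolding psum_def by (intro sums_mult diffs_equiv s2)
  moreover have "t * (real n * diffs c n * t ^ (n - Suc 0)) = (real n * diffs c n) * t ^ n" for n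
    by (cases n) auto
  ultimately have t: "(\<lambda>n. (real n * diffs c n) * t ^ n) sums (t * psum (diffs (diffs c)) t)" by simp
  have "t * psum (diffs (diffs c)) t = psum (\<lambda>n. real n * diffs c n) t"
    using sums_unique[OF t] by (simp add: psum_def)
  then have "t * psum (diffs (diffs c)) t + psum (diffs c) t + psum c t
     = psum (\<lambda>n. real n * diffs c n + diffs c n + c n) t"
    using sums_summable[OF t] s1 c by (simp add: psum_add summable_add distrib_right)
  also have "(\<lambda>n. real n * diffs c n + diffs c n + c n) = (\<lambda>n. (real (Suc n))\<^sup>2 * c (Suc n) + c n)"
    by (simp add: diffs_def power2_eq_square algebra_simps fun_eq_iff)
  finally show ?thesis .
qed

lemma bessel_coeff_Suc: "(real (Suc n))\<^sup>2 * bessel_coeff (Suc n) = - bessel_coeff n"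
  by (simp add: bessel_coeff_def power_mult_distrib del: of_nat_Suc)

text \<open>In the variable \<open>t = r\<^sup>2 / 4\<close> the Bessel function is \<open>J\<^sub>0 r = bF t\<close>, and a second solution
  of the same equation is \<open>bF t * ln t + bP t\<close>.\<close>

abbreviation "bF \<equiv> psum bessel_coeff"
abbreviation "bF' \<equiv> psum (diffs bessel_coeff)"
abbreviation "bF'' \<equiv> psum (diffs (diffs bessel_coeff))"
abbreviation "bP \<equiv> psum bessel_log_coeff"
abbreviation "bP' \<equiv> psum (diffs bessel_log_coeff)"
abbreviation "bP'' \<equiv> psum (diffs (diffs bessel_log_coeff))"

lemma bessel_derivs:
  "(bF has_real_derivative bF' t) (at t)" "(bF' has_real_derivative bF'' t) (at t)"
  "(bP has_real_derivative bP' t) (at t)" "(bP' has_real_derivative bP'' t) (at t)"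
  by (intro has_derivative_psum termdiff_converges_all summable_bessel_coeff summable_bessel_log_coeff)+

lemma bessel_continuous: "continuous_on S bF" "continuous_on S bF'"
  by (rule DERIV_continuous_on, rule has_field_derivative_at_within, rule bessel_derivs)+

lemma bessel_ode: "t * bF'' t + bF' t + bF t = 0"
proof -
  have "t * bF'' t + bF' t + bF t = psum (\<lambda>n. 0) t"
    by (subst bessel_operator_psum[OF summable_bessel_coeff]) (simp add: bessel_coeff_Suc del: of_nat_Suc)
  then show ?thesis by (simp add: psum_def)
qed

text \<open>Since bF solves the homogeneous equation, the operator applied to
  \<open>bF t * ln t\<close> leaves 2 bF', which the regular part has to cancel.\<close>

lemma bessel_log_ode: "t * bP'' t + bP' t + bP t = - 2 * bF' t"
proof -
  have "(real (Suc n))\<^sup>2 * bessel_log_coeff (Suc n) + bessel_log_coeff n = - 2 * diffs bessel_coeff n" for n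
  proof -
    have "(real (Suc n))\<^sup>2 * bessel_log_coeff (Suc n) = - 2 * harm (Suc n) * ((real (Suc n))\<^sup>2 * bessel_coeff (Suc n))"
      by (simp add: bessel_log_coeff_def)
    also have "\<dots> = 2 * (harm n + inverse (real (Suc n))) * bessel_coeff n"
      unfolding bessel_coeff_Suc by (simp add: harm_Suc algebra_simps)
    finally have "(real (Suc n))\<^sup>2 * bessel_log_coeff (Suc n) + bessel_log_coeff n = 2 * inverse (real (Suc n)) * bessel_coeff n"
      by (simp add: bessel_log_coeff_def algebra_simps)
    also have "\<dots> = - 2 * inverse (real (Suc n)) * ((real (Suc n))\<^sup>2 * bessel_coeff (Suc n))"
      unfolding bessel_coeff_Suc by simp
    also have "\<dots> = - 2 * diffs bessel_coeff n" by (simp add: diffs_def power2_eq_square)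
    finally show ?thesis .
  qed
  then have "t * bP'' t + bP' t + bP t = psum (\<lambda>n. - 2 * diffs bessel_coeff n) t"
    by (subst bessel_operator_psum[OF summable_bessel_log_coeff]) simp
  also have "\<dots> = - 2 * bF' t"
    unfolding psum_def using termdiff_converges_all[OF summable_bessel_coeff]
    by (subst suminf_mult[symmetric]) (auto simp: mult.assoc)
  finally show ?thesis .
qed

lemma psum_0: "psum c 0 = c 0"
  unfolding psum_def by (simp add: powser_zero)

lemma bessel_at_0: "bF 0 = 1" "bF' 0 = - 1"
  by (simp_all add: psum_0 bessel_coeff_def diffs_def)

text \<open>This is t times the Wronskian of bF and bF ln t + bP, in which the logarithms cancel; it
  is constant and equals 1 at t = 0.\<close>

lemma bessel_wronskian: "(bF t)\<^sup>2 + t * (bF t * bP' t - bF' t * bP t) = 1"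
proof -
  have "((\<lambda>t. (bF t)\<^sup>2 + t * (bF t * bP' t - bF' t * bP t)) has_real_derivative 0) (at t)" for t
  proof -
    have "((\<lambda>t. (bF t)\<^sup>2 + t * (bF t * bP' t - bF' t * bP t)) has_real_derivative
      2 * bF t * bF' t + (bF t * bP' t - bF' t * bP t)
        + t * (bF' t * bP' t + bF t * bP'' t - (bF'' t * bP t + bF' t * bP' t))) (at t)"
      by (auto intro!: derivative_eq_intros bessel_derivs)
    moreover have "2 * bF t * bF' t + (bF t * bP' t - bF' t * bP t)
        + t * (bF' t * bP' t + bF t * bP'' t - (bF'' t * bP t + bF' t * bP' t)) = 0"
      using bessel_ode[of t] bessel_log_ode[of t] by algebra
    ultimately show ?thesis by simp
  qed
  then have "(\<lambda>t. (bF t)\<^sup>2 + t * (bF t * bP' t - bF' t * bP t)) t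
    = (\<lambda>t. (bF t)\<^sup>2 + t * (bF t * bP' t - bF' t * bP t)) 0"
    by (rule DERIV_isconst_all[rule_format])
  then show ?thesis by (simp add: bessel_at_0)
qed

section \<open>The first positive zero of J_1\<close>

lemma bessel_J_0_eq: "bessel_J 0 x = bF ((x / 2)\<^sup>2)"
  unfolding bessel_J_def psum_def bessel_coeff_def by (simp add: power_mult power2_eq_square)

text \<open>J_1 = - J_0', rewritten in t; positive zeros of J_1 thus correspond to positive zeros of
  bF'.\<close>

lemma bessel_J_1_eq: "bessel_J 1 x = - (x / 2) * bF' ((x / 2)\<^sup>2)"
proof -
  have "(- 1) ^ k / (fact k * fact (k + 1)) * (x / 2) ^ (2 * k + 1)
    = - (x / 2) * (diffs bessel_coeff k * ((x / 2)\<^sup>2) ^ k)" for k :: nat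
  proof -
    have "diffs bessel_coeff k = - ((- 1) ^ k / (fact k * fact (k + 1)))"
      by (simp add: diffs_def bessel_coeff_def power2_eq_square divide_simps del: of_nat_Suc)
    moreover have "(x / 2) ^ (2 * k + 1) = (x / 2) * ((x / 2)\<^sup>2) ^ k" by (simp add: power_mult)
    moreover have "c * ((x / 2) * Q) = - (x / 2) * (- c * Q)" for c Q :: real by simp
    ultimately show ?thesis by presburger
  qed
  then show ?thesis
    unfolding bessel_J_def psum_def
    using termdiff_converges_all[OF summable_bessel_coeff] by (simp only: suminf_mult)
qed

text \<open>Equivalent to J_1(4) < 0, which forces a zero of bF' in [0, 4]. The first five terms of
  the alternating series of the b k sum to -1/45, and the tail, which decreases in size and starts
  with a negative term, is at most 0.\<close>

lemma bF'_4_pos: "bF' 4 > 0"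
proof -
  define b where "b k = 4 ^ k / (fact k * fact (k + 1) :: real)" for k :: nat
  have b_Suc: "b (Suc k) = b k * (4 / (real (Suc k) * real (k + 2)))" for k
    by (simp add: b_def divide_simps algebra_simps)
  have bp: "b k > 0" for k unfolding b_def by simp
  have d: "diffs bessel_coeff k * 4 ^ k = - ((- 1) ^ k * b k)" for k
    by (simp add: diffs_def bessel_coeff_def power2_eq_square divide_simps b_def del: of_nat_Suc)
  have s: "summable (\<lambda>k. diffs bessel_coeff k * 4 ^ k)" by (rule termdiff_converges_all[OF summable_bessel_coeff])
  then have s': "summable (\<lambda>k. (- 1) ^ k * b k)" unfolding d by (simp only: summable_minus_iff)
  have dec: "b (Suc k) \<le> b k" if "k \<ge> 2" for k
  proof -
    have "3 * 4 \<le> real (Suc k) * real (k + 2)" using that by (intro mult_mono) auto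
    then have "4 / (real (Suc k) * real (k + 2)) \<le> 1" by (simp add: divide_le_eq del: of_nat_Suc of_nat_add)
    from mult_left_le[OF this less_imp_le[OF bp]] show ?thesis unfolding b_Suc .
  qed
  have "(\<lambda>k. \<bar>(- 1) ^ k * b k\<bar>) \<longlonglongrightarrow> 0" by (rule tendsto_rabs_zero[OF summable_LIMSEQ_zero[OF s']])
  then have lim: "(\<lambda>k. b k) \<longlonglongrightarrow> 0" using bp by (simp add: abs_mult power_abs less_imp_le)
  have "0 \<le> (\<Sum>i. (- 1) ^ i * b (i + 5))"
  proof -
    have "b (Suc n + 5) \<le> b (n + 5)" for n using dec[of "n + 5"] by simp
    from summable_Leibniz'(2)[of "\<lambda>i. b (i + 5)", OF LIMSEQ_ignore_initial_segment[OF lim] less_imp_le[OF bp] this, of 0]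
    show ?thesis by simp
  qed
  moreover have "(\<Sum>k. (- 1) ^ k * b k) = (\<Sum>i. (- 1) ^ (i + 5) * b (i + 5)) + (\<Sum>k<5. (- 1) ^ k * b k)"
    by (rule suminf_split_initial_segment[OF s'])
  moreover have "(\<Sum>i. (- 1) ^ (i + 5) * b (i + 5)) = - (\<Sum>i. (- 1) ^ i * b (i + 5))"
    using summable_ignore_initial_segment[OF s', of 5]
    by (subst suminf_minus[symmetric]) (auto simp: power_add summable_minus_iff)
  moreover have "(\<Sum>k<5. (- 1) ^ k * b k) < 0"
    by (simp add: b_def eval_nat_numeral lessThan_Suc fact_Suc)
  moreover have "bF' 4 = - (\<Sum>k. (- 1) ^ k * b k)"
    unfolding psum_def d using s' by (simp add: suminf_minus)
  ultimately show ?thesis by linarith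
qed

definition t_star :: real where
  "t_star = (r_star / 2)\<^sup>2"

text \<open>\<open>LEAST\<close> over the reals yields a zero only if a smallest one exists: the
  zeros of bF' in [0, 4] form a nonempty closed set, so their infimum is attained.\<close>

lemma t_star:
  "r_star > 0" "t_star > 0" "bF' t_star = 0" "\<And>t. 0 \<le> t \<Longrightarrow> t < t_star \<Longrightarrow> bF' t < 0"
proof -
  note cont = bessel_continuous(2)
  define Z where "Z = {t \<in> {0..4}. bF' t = 0}"
  have "\<exists>t\<ge>0. t \<le> 4 \<and> bF' t = 0"
    by (intro IVT') (use bessel_at_0 bF'_4_pos cont in auto)
  then have ne: "Z \<noteq> {}" unfolding Z_def by auto
  have "closed Z" unfolding Z_def by (rule continuous_closed_preimage_constant[OF cont]) auto
  moreover have "bdd_below Z" unfolding Z_def by (auto intro: bdd_belowI[of _ 0])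
  ultimately have "Inf Z \<in> Z" using ne closed_contains_Inf by blast
  define t0 where "t0 = Inf Z"
  have t0: "0 \<le> t0" "t0 \<le> 4" "bF' t0 = 0" using \<open>Inf Z \<in> Z\<close> unfolding t0_def Z_def by auto
  have nz: "bF' t \<noteq> 0" if "0 \<le> t" "t < t0" for t
  proof
    assume "bF' t = 0"
    then have "t \<in> Z" using that t0 unfolding Z_def by auto
    then show False using that \<open>bdd_below Z\<close> cInf_lower unfolding t0_def by force
  qed
  have t0p: "t0 > 0" using t0 bessel_at_0 by (cases "t0 = 0") auto
  have neg: "bF' t < 0" if "0 \<le> t" "t < t0" for t
  proof (rule ccontr)
    assume "\<not> bF' t < 0"
    then have "\<exists>s\<ge>0. s \<le> t \<and> bF' s = 0"
      by (intro IVT') (use bessel_at_0 cont that in auto)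
    then obtain s where "0 \<le> s" "s \<le> t" "bF' s = 0" by blast
    then show False using nz[of s] that by linarith
  qed
  have "r_star = 2 * sqrt t0"
    unfolding r_star_def
  proof (rule Least_equality)
    show "0 < 2 * sqrt t0 \<and> bessel_J 1 (2 * sqrt t0) = 0"
      unfolding bessel_J_1_eq using t0p t0 by simp
    fix y assume y: "0 < y \<and> bessel_J 1 y = 0"
    then have "bF' ((y / 2)\<^sup>2) = 0" unfolding bessel_J_1_eq by auto
    then have "(y / 2)\<^sup>2 \<ge> t0" using nz[of "(y / 2)\<^sup>2"] by force
    then show "2 * sqrt t0 \<le> y" using y real_sqrt_le_mono[of t0 "(y / 2)\<^sup>2"] by simp
  qed
  then have "t_star = (2 * sqrt t0 / 2)\<^sup>2" unfolding t_star_def by (rule arg_cong)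
  also have "\<dots> = t0" using t0(1) by simp
  finally have "t_star = t0" .
  then show "t_star > 0" "bF' t_star = 0" "\<And>t. 0 \<le> t \<Longrightarrow> t < t_star \<Longrightarrow> bF' t < 0"
    using t0 t0p neg by auto
  have "2 * sqrt t0 > 0" using t0p by simp
  then show "r_star > 0" using \<open>r_star = 2 * sqrt t0\<close> by (simp only:)
qed

text \<open>bF decreases up to t_star. If it were nonnegative there, t bF' would have the negative
  derivative - bF and could not return to 0 at t_star. The function bF^2 + t bF'^2 has the
  derivative - bF'^2, so it drops strictly below its initial value 1.\<close>

lemma bF_t_star: "bF t_star < 0" "(bF t_star)\<^sup>2 < 1"
proof -
  have "bF t_star < bF t" if "0 \<le> t" "t < t_star" for t
  proof (rule DERIV_neg_imp_decreasing_open[OF that(2)])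
    fix x assume "t < x" "x < t_star"
    then show "\<exists>y. (bF has_real_derivative y) (at x) \<and> y < 0"
      using bessel_derivs(1)[of x] t_star(4)[of x] that by (intro exI[of _ "bF' x"]) auto
  qed (rule bessel_continuous)
  note dec = this
  show "bF t_star < 0"
  proof (rule ccontr)
    assume n: "\<not> bF t_star < 0"
    have "t_star * bF' t_star < 0 * bF' 0"
    proof (rule DERIV_neg_imp_decreasing_open[where f = "\<lambda>t. t * bF' t"])
      fix t assume t: "0 < t" "t < t_star"
      have "((\<lambda>t. t * bF' t) has_real_derivative bF' t + t * bF'' t) (at t)"
        by (auto intro!: derivative_eq_intros bessel_derivs)
      moreover have "bF' t + t * bF'' t = - bF t" using bessel_ode[of t] by linarith
      ultimately have "((\<lambda>t. t * bF' t) has_real_derivative - bF t) (at t)" by simp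
      moreover have "- bF t < 0" using dec[of t] t n by linarith
      ultimately show "\<exists>y. ((\<lambda>t. t * bF' t) has_real_derivative y) (at t) \<and> y < 0" by blast
    qed (use t_star in \<open>auto intro!: continuous_intros bessel_continuous\<close>)
    then show False using t_star by simp
  qed
  have "(bF t_star)\<^sup>2 + t_star * (bF' t_star)\<^sup>2 < (bF 0)\<^sup>2 + 0 * (bF' 0)\<^sup>2"
  proof (rule DERIV_neg_imp_decreasing_open[where f = "\<lambda>t. (bF t)\<^sup>2 + t * (bF' t)\<^sup>2"])
    fix t assume t: "0 < t" "t < t_star"
    have "((\<lambda>t. (bF t)\<^sup>2 + t * (bF' t)\<^sup>2) has_real_derivative
       2 * bF t * bF' t + ((bF' t)\<^sup>2 + t * (2 * bF' t * bF'' t))) (at t)"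
      by (auto intro!: derivative_eq_intros bessel_derivs)
    moreover have "2 * bF t * bF' t + ((bF' t)\<^sup>2 + t * (2 * bF' t * bF'' t)) = - (bF' t)\<^sup>2"
      using bessel_ode[of t] by algebra
    moreover have "- (bF' t)\<^sup>2 < 0" using t_star(4)[of t] t by simp
    ultimately show "\<exists>y. ((\<lambda>t. (bF t)\<^sup>2 + t * (bF' t)\<^sup>2) has_real_derivative y) (at t) \<and> y < 0" by metis
  qed (use t_star in \<open>auto intro!: continuous_intros bessel_continuous\<close>)
  then show "(bF t_star)\<^sup>2 < 1" using t_star bessel_at_0 by simp
qed

section \<open>The logarithmic solution and its norm\<close>

lemma tendsto_sqrt_ln_at_0: "((\<lambda>t::real. sqrt t * ln t) \<longlongrightarrow> 0) (at_right 0)"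
proof -
  have l: "((\<lambda>s::real. s * ln s) \<longlongrightarrow> 0) (at_right 0)"
  proof -
    have a: "((\<lambda>s::real. - (ln (inverse s) / inverse s)) \<longlongrightarrow> 0) (at_right 0)"
      using tendsto_minus[OF filterlim_compose[OF ln_x_over_x_tendsto_0 filterlim_inverse_at_top_right]] by simp
    show ?thesis
      by (rule Lim_transform_eventually[OF a]) (auto simp: eventually_at_filter ln_inverse divide_inverse)
  qed
  have "filterlim sqrt (at_right 0) (at_right (0::real))"
    by (auto simp: filterlim_at eventually_at_filter intro!: tendsto_eq_intros)
  then have a: "((\<lambda>t. 2 * (sqrt t * ln (sqrt t))) \<longlongrightarrow> 0) (at_right 0)"
    using tendsto_mult_left[OF filterlim_compose[OF l], of sqrt _ 2] by simp
  show ?thesis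
    by (rule Lim_transform_eventually[OF a]) (auto simp: eventually_at_filter ln_sqrt)
qed

text \<open>The dual profile: the solution of \<open>t \<psi>'' + \<psi>' + \<psi> = 0\<close> with \<open>\<psi> ~ ln t\<close> at \<open>0\<close> that vanishes
  at \<open>t_star\<close>.\<close>

definition dual_const :: real where
  "dual_const = (bF t_star * ln t_star + bP t_star) / bF t_star"

definition dual :: "real \<Rightarrow> real" where
  "dual t = bF t * ln t + bP t - dual_const * bF t"

definition dual' :: "real \<Rightarrow> real" where
  "dual' t = bF' t * ln t + bF t / t + bP' t - dual_const * bF' t"

lemma dual_deriv: "t > 0 \<Longrightarrow> (dual has_real_derivative dual' t) (at t)"
  unfolding dual_def[abs_def] dual'_def by (auto intro!: derivative_eq_intros bessel_derivs)

lemma dual'_deriv: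
  assumes t: "t > 0" shows "(dual' has_real_derivative - (dual' t + dual t) / t) (at t)"
proof -
  have "(dual' has_real_derivative bF'' t * ln t + bF' t * (1 / t) + (bF' t * t - bF t) / (t * t) + bP'' t
      - dual_const * bF'' t) (at t)"
    unfolding dual'_def[abs_def] using t by (auto intro!: derivative_eq_intros bessel_derivs)
  moreover have "bF'' t * ln t + bF' t * (1 / t) + (bF' t * t - bF t) / (t * t) + bP'' t - dual_const * bF'' t
    = - (dual' t + dual t) / t"
  proof -
    have e: "bF'' t = - (bF' t + bF t) / t" "bP'' t = (- 2 * bF' t - bP' t - bP t) / t"
      using bessel_ode[of t] bessel_log_ode[of t] t by (auto simp: field_simps)
    show ?thesis unfolding e dual_def dual'_def using t by (simp add: field_simps)
  qed
  ultimately show ?thesis by simp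
qed

text \<open>As bF' vanishes at t_star, the Wronskian identity determines the slope there, and bF < 0
  makes it negative: this is the favourable sign of the kink.\<close>

lemma dual_t_star: "dual t_star = 0" "t_star * dual' t_star = 1 / bF t_star" "dual' t_star < 0"
proof -
  have n: "bF t_star \<noteq> 0" "t_star > 0" using bF_t_star t_star by auto
  show "dual t_star = 0" unfolding dual_def dual_const_def using n by simp
  have "t_star * dual' t_star = bF t_star + t_star * bP' t_star"
    unfolding dual'_def t_star(3) using n by (simp add: distrib_left)
  then have "t_star * dual' t_star * bF t_star = 1"
    using bessel_wronskian[of t_star] unfolding t_star(3) by algebra
  then show e: "t_star * dual' t_star = 1 / bF t_star" using n by (simp add: field_simps)
  have "t_star * dual' t_star < 0" unfolding e using bF_t_star by simp
  then show "dual' t_star < 0" using n by (simp add: mult_less_0_iff)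
qed

lemma bessel_tendsto_0:
  "(bF \<longlongrightarrow> 1) (at_right 0)" "(bF' \<longlongrightarrow> - 1) (at_right 0)" "(bP \<longlongrightarrow> bP 0) (at_right 0)" "(bP' \<longlongrightarrow> bP' 0) (at_right 0)"
  using bessel_derivs[of 0, THEN DERIV_isCont] bessel_at_0 by (auto simp: isCont_def filterlim_at_split)

text \<open>The first limit is the strength of the point source; the second says that the logarithm
  is weak enough for the disk t < d to drop out of the norm as d tends to 0.\<close>

lemma dual_limits:
  "((\<lambda>t. t * dual' t) \<longlongrightarrow> 1) (at_right 0)" "((\<lambda>t. sqrt t * dual t) \<longlongrightarrow> 0) (at_right 0)"
proof -
  have s: "((\<lambda>t. sqrt t) \<longlongrightarrow> 0) (at_right 0)" by (auto intro!: tendsto_eq_intros)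
  have "((\<lambda>t. sqrt t * ((sqrt t * ln t) * bF' t) + bF t + t * bP' t - t * dual_const * bF' t)
    \<longlongrightarrow> 0 * (0 * (- 1)) + 1 + 0 * bP' 0 - 0 * dual_const * (- 1)) (at_right 0)"
    by (intro tendsto_intros s bessel_tendsto_0 tendsto_sqrt_ln_at_0)
  then have a: "((\<lambda>t. sqrt t * ((sqrt t * ln t) * bF' t) + bF t + t * bP' t - t * dual_const * bF' t) \<longlongrightarrow> 1) (at_right 0)" by simp
  have "t * dual' t = sqrt t * ((sqrt t * ln t) * bF' t) + bF t + t * bP' t - t * dual_const * bF' t" if "t > 0" for t
  proof -
    have "sqrt t * ((sqrt t * ln t) * bF' t) = t * ln t * bF' t" using that by (simp flip: mult.assoc)
    then show ?thesis using that by (simp add: dual'_def field_simps)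
  qed
  then show "((\<lambda>t. t * dual' t) \<longlongrightarrow> 1) (at_right 0)"
    using Lim_transform_eventually[OF a, of "\<lambda>t. t * dual' t"] by (auto simp: eventually_at_filter)
  have "((\<lambda>t. bF t * (sqrt t * ln t) + sqrt t * bP t - sqrt t * dual_const * bF t)
    \<longlongrightarrow> 1 * 0 + 0 * bP 0 - 0 * dual_const * 1) (at_right 0)"
    by (intro tendsto_intros s bessel_tendsto_0 tendsto_sqrt_ln_at_0)
  then show "((\<lambda>t. sqrt t * dual t) \<longlongrightarrow> 0) (at_right 0)"
    by (simp add: dual_def[abs_def] algebra_simps)
qed

text \<open>The identity \<open>(t\<^sup>2 \<psi>'\<^sup>2 + t \<psi>\<^sup>2)' = \<psi>\<^sup>2\<close>.\<close>

lemma dual_square_integral: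
  assumes d: "0 < d" "d \<le> t_star"
  shows "has_bochner_integral lborel (\<lambda>t. (dual t)\<^sup>2 * indicator {d..t_star} t)
    (1 / (bF t_star)\<^sup>2 - ((d * dual' d)\<^sup>2 + d * (dual d)\<^sup>2))"
proof -
  have "has_bochner_integral lborel (\<lambda>t. (dual t)\<^sup>2 * indicator {d..t_star} t)
    (((t_star * dual' t_star)\<^sup>2 + t_star * (dual t_star)\<^sup>2) - ((d * dual' d)\<^sup>2 + d * (dual d)\<^sup>2))"
  proof (rule has_bochner_integral_FTC_Icc_real[OF d(2)])
    fix t assume "d \<le> t"
    then have t: "t > 0" using d by simp
    show "isCont (\<lambda>t. (dual t)\<^sup>2) t" using DERIV_isCont[OF dual_deriv[OF t]] by (intro continuous_intros)
    have "((\<lambda>t. (t * dual' t)\<^sup>2 + t * (dual t)\<^sup>2) has_real_derivative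
      2 * (t * dual' t) * (dual' t + t * (- (dual' t + dual t) / t)) + ((dual t)\<^sup>2 + t * (2 * dual t * dual' t))) (at t)"
      by (rule derivative_eq_intros refl dual_deriv[OF t] dual'_deriv[OF t])+ simp
    moreover have "2 * (t * dual' t) * (dual' t + t * (- (dual' t + dual t) / t)) + ((dual t)\<^sup>2 + t * (2 * dual t * dual' t)) = (dual t)\<^sup>2"
      using t by (simp add: field_simps)
    ultimately have "((\<lambda>t. (t * dual' t)\<^sup>2 + t * (dual t)\<^sup>2) has_real_derivative (dual t)\<^sup>2) (at t)"
      by (simp only:)
    then show "((\<lambda>t. (t * dual' t)\<^sup>2 + t * (dual t)\<^sup>2) has_real_derivative (dual t)\<^sup>2) (at t)" .
  qed
  then show ?thesis unfolding dual_t_star by (simp add: power_one_over)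
qed

section \<open>Radial test functions\<close>

text \<open>The variable \<open>t\<close> of the profiles: \<open>\<Delta> + 1/2\<close> acts on functions of \<open>radial x0 x\<close> as
  \<open>1/2 (t d\<^sup>2/dt\<^sup>2 + d/dt + 1)\<close>.\<close>

definition radial :: "real^2 \<Rightarrow> real^2 \<Rightarrow> real" where
  "radial x0 x = (norm (x - x0))\<^sup>2 / 8"

lemma radial_nonneg [simp]: "radial x0 x \<ge> 0"
  by (simp add: radial_def)

lemma radial_measurable [measurable]: "radial x0 \<in> borel_measurable borel"
  unfolding radial_def[abs_def] by measurable

text \<open>The set where \<open>radial x0 x\<close> is at most a is a disk of area 8 pi a, so t has
  the constant density 8 pi on the half-line. Integrals of radial functions become integrals in one
  variable.\<close>

lemma distr_radial:
  "distr lborel borel (radial x0) = density lborel (\<lambda>t::real. ennreal (8 * pi * indicator {0..} t))"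
proof (rule measure_eqI_generator_eq[where E = "range atMost" and \<Omega> = UNIV and A = "\<lambda>i. {..real i}"])
  have borel: "sets borel = sigma_sets UNIV (range (atMost :: real \<Rightarrow> _))"
    by (rule trans[OF arg_cong[where f = sets, OF borel_eq_atMost] sets_measure_of]) simp
  show "Int_stable (range (atMost :: real \<Rightarrow> _))" by (auto simp: Int_stable_def Int_atMost)
  show "sets (distr lborel borel (radial x0)) = sigma_sets UNIV (range atMost)"
    by (rule trans[OF _ borel]) simp
  show "sets (density lborel (\<lambda>t::real. ennreal (8 * pi * indicator {0..} t))) = sigma_sets UNIV (range atMost)"
    by (rule trans[OF _ borel]) simp
  have l: "emeasure (distr lborel borel (radial x0)) {..a} = ennreal (8 * pi * max 0 a)" for a
  proof (cases "a \<ge> 0")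
    case True
    have "radial x0 -` {..a} = cball x0 (sqrt (8 * a))"
    proof -
      have "radial x0 x \<le> a \<longleftrightarrow> norm (x - x0) \<le> sqrt (8 * a)" for x
        using real_le_rsqrt[of "norm (x - x0)" "8 * a"] power_mono[of "norm (x - x0)" "sqrt (8 * a)" 2] True
        by (auto simp: radial_def)
      then show ?thesis by (auto simp: dist_norm norm_minus_commute)
    qed
    then show ?thesis
      using True by (simp add: emeasure_distr emeasure_cball eval_unit_ball_vol)
  next
    case False
    have "\<not> radial x0 x \<le> a" for x using radial_nonneg[of x0 x] False by linarith
    then have "radial x0 -` {..a} = {}" by auto
    then show ?thesis using False by (simp add: emeasure_distr)
  qed
  have r: "emeasure (density lborel (\<lambda>t::real. ennreal (8 * pi * indicator {0..} t))) {..a} = ennreal (8 * pi * max 0 a)" for a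
  proof -
    have "emeasure (density lborel (\<lambda>t::real. ennreal (8 * pi * indicator {0..} t))) {..a}
      = (\<integral>\<^sup>+t. ennreal (8 * pi * indicator {0..} t) * indicator {..a} t \<partial>lborel)"
      by (rule emeasure_density) auto
    also have "\<dots> = (\<integral>\<^sup>+t. ennreal (8 * pi) * indicator {0..a} t \<partial>lborel)"
      by (rule nn_integral_cong) (auto simp: indicator_def)
    also have "\<dots> = ennreal (8 * pi) * emeasure lborel {0..a}" by (rule nn_integral_cmult_indicator) auto
    also have "\<dots> = ennreal (8 * pi * max 0 a)" by (cases "a \<ge> 0") (auto simp: ennreal_mult[symmetric])
    finally show ?thesis .
  qed
  show "emeasure (distr lborel borel (radial x0)) X = emeasure (density lborel (\<lambda>t::real. ennreal (8 * pi * indicator {0..} t))) X"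
    if "X \<in> range atMost" for X using that l r by auto
  show "emeasure (distr lborel borel (radial x0)) {..real i} \<noteq> \<infinity>" for i unfolding l by simp
qed (auto simp: real_arch_simple)

lemma has_bochner_integral_radial:
  assumes g: "has_bochner_integral lborel (\<lambda>t. g t * indicator {0..} t) I" and [measurable]: "g \<in> borel_measurable borel"
  shows "has_bochner_integral lborel (\<lambda>x. g (radial x0 x) :: real) (8 * pi * I)"
proof -
  have gi: "integrable lborel (\<lambda>t. 8 * pi * indicator {0..} t * g t)"
    "(LINT t|lborel. 8 * pi * indicator {0..} t * g t) = 8 * pi * I"
    using has_bochner_integral_mult_right[OF g, of "8 * pi"]
    by (auto simp: has_bochner_integral_iff mult_ac)
  have "integrable (distr lborel borel (radial x0)) g"
    unfolding distr_radial using gi(1) by (subst integrable_real_density) auto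
  moreover have "(LINT t|distr lborel borel (radial x0). g t) = 8 * pi * I"
    unfolding distr_radial using gi(2) by (subst integral_real_density) auto
  ultimately show ?thesis
    by (simp add: has_bochner_integral_iff integrable_distr_eq integral_distr)
qed

lemma AE_radial:
  assumes E: "finite E" shows "AE x in lborel. radial x0 x \<notin> E"
proof -
  have "AE t in lborel. t \<notin> E" using E by (intro AE_not_in finite_imp_null_set_lborel)
  then have "AE t in distr lborel borel (radial x0). t \<notin> E"
    unfolding distr_radial by (subst AE_density) auto
  moreover have "{t \<in> space borel. t \<notin> E} = - E" by auto
  then have "{t \<in> space borel. t \<notin> E} \<in> sets borel" using finite_imp_closed[OF E] by auto
  ultimately show ?thesis by (subst (asm) AE_distr_iff) auto
qed

lemma radial_line_derivative:
  "((\<lambda>h. radial x0 (x + h *\<^sub>R axis i 1)) has_real_derivative (x - x0) $ i / 4) (at 0)"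
proof -
  have eq: "radial x0 (x + h *\<^sub>R axis i 1) = (inner (x - x0) (x - x0) + 2 * h * (x - x0) $ i + h\<^sup>2) / 8" for h
  proof -
    define z where "z = x - x0"
    have z: "x + h *\<^sub>R axis i 1 - x0 = z + h *\<^sub>R axis i 1" by (simp add: z_def)
    show ?thesis unfolding z_def[symmetric] radial_def z power2_norm_eq_inner
      by (simp add: inner_add_left inner_add_right inner_axis inner_axis' inner_axis_axis power2_eq_square algebra_simps)
  qed
  have "((\<lambda>h. (inner (x - x0) (x - x0) + 2 * h * (x - x0) $ i + h\<^sup>2) / 8) has_real_derivative (x - x0) $ i / 4) (at 0)"
    by (auto intro!: derivative_eq_intros)
  then show ?thesis unfolding eq .
qed

lemma lipschitz_of_piecewise_C1:
  fixes p :: "real \<Rightarrow> real"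
  assumes c: "continuous_on {0..T} p" and E: "finite E"
    and d: "\<And>t. 0 \<le> t \<Longrightarrow> t < T \<Longrightarrow> t \<notin> E \<Longrightarrow> (p has_real_derivative p1 t) (at t)" and b: "\<And>t. \<bar>p1 t\<bar> \<le> K"
    and s: "s \<in> {0..T}" "t \<in> {0..T}"
  shows "\<bar>p s - p t\<bar> \<le> K * \<bar>s - t\<bar>"
proof -
  have K: "K \<ge> 0" using b[of 0] by linarith
  have *: "\<bar>p v - p u\<bar> \<le> K * \<bar>v - u\<bar>" if u: "0 \<le> u" "u \<le> v" "v \<le> T" for u v
  proof -
    have "(p1 has_integral (p v - p u)) {u..v}"
    proof (rule fundamental_theorem_of_calculus_interior_strong[OF E u(2)])
      show "continuous_on {u..v} p" by (rule continuous_on_subset[OF c]) (use u in auto)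
    qed (use u d in \<open>auto simp: has_real_derivative_iff_has_vector_derivative[symmetric]\<close>)
    from has_integral_bound_real[OF K finite.emptyI this] show ?thesis using b u by simp
  qed
  show ?thesis
  proof (cases "s \<le> t")
    case True
    then show ?thesis using *[of s t] s by (simp add: abs_minus_commute)
  qed (use *[of t s] s in auto)
qed

lemma min_sqrt_square:
  assumes "0 \<le> a" "0 \<le> T" shows "min (a\<^sup>2 / 8) T = (min a (sqrt (8 * T)))\<^sup>2 / 8"
proof (cases "a \<le> sqrt (8 * T)")
  case True
  then have "a\<^sup>2 \<le> (sqrt (8 * T))\<^sup>2" using assms by (intro power_mono) auto
  then show ?thesis using True assms by simp
next
  case False
  then have "(sqrt (8 * T))\<^sup>2 \<le> a\<^sup>2" using assms by (intro power_mono) auto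
  then show ?thesis using False assms by simp
qed

text \<open>\<open>radial\<close> is quadratic, hence not Lipschitz, but p vanishes beyond T, so
  distances from x0 may be capped at sqrt (8 T); a difference of capped squares is the difference
  times a bounded sum.\<close>

lemma radial_lipschitz:
  fixes p :: "real \<Rightarrow> real"
  assumes T: "T > 0" and K: "K \<ge> 0" and l: "\<And>s t. s \<in> {0..T} \<Longrightarrow> t \<in> {0..T} \<Longrightarrow> \<bar>p s - p t\<bar> \<le> K * \<bar>s - t\<bar>"
    and z: "\<And>t. t \<ge> T \<Longrightarrow> p t = 0"
  shows "\<bar>p (radial x0 x) - p (radial x0 y)\<bar> \<le> K * sqrt (8 * T) * norm (x - y)"
proof -
  let ?r = "sqrt (8 * T)"
  define a b where "a = min (norm (x - x0)) ?r" and "b = min (norm (y - x0)) ?r"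
  have ab: "0 \<le> a" "a \<le> ?r" "0 \<le> b" "b \<le> ?r" unfolding a_def b_def using T by auto
  have e: "p (radial x0 u) = p (min (radial x0 u) T)" for u
    using z[of "radial x0 u"] z[of T] by (cases "radial x0 u \<le> T") auto
  have m: "min (radial x0 x) T = a\<^sup>2 / 8" "min (radial x0 y) T = b\<^sup>2 / 8"
    unfolding radial_def a_def b_def using T by (intro min_sqrt_square; simp)+
  have "\<bar>a - b\<bar> \<le> \<bar>norm (x - x0) - norm (y - x0)\<bar>" unfolding a_def b_def by linarith
  also have "\<dots> \<le> norm (x - y)" using norm_triangle_ineq3[of "x - x0" "y - x0"] by simp
  finally have ab': "\<bar>a - b\<bar> \<le> norm (x - y)" .
  have "\<bar>a\<^sup>2 / 8 - b\<^sup>2 / 8\<bar> = \<bar>a - b\<bar> * (a + b) / 8"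
  proof -
    have "a\<^sup>2 / 8 - b\<^sup>2 / 8 = (a - b) * (a + b) / 8" by (simp add: power2_eq_square algebra_simps)
    then show ?thesis unfolding \<open>a\<^sup>2 / 8 - b\<^sup>2 / 8 = (a - b) * (a + b) / 8\<close> using ab by (simp add: abs_mult)
  qed
  also have "\<dots> \<le> norm (x - y) * (8 * ?r) / 8" using ab ab' by (intro divide_right_mono mult_mono) auto
  finally have d: "\<bar>a\<^sup>2 / 8 - b\<^sup>2 / 8\<bar> \<le> norm (x - y) * ?r" by simp
  have "\<bar>p (a\<^sup>2 / 8) - p (b\<^sup>2 / 8)\<bar> \<le> K * \<bar>a\<^sup>2 / 8 - b\<^sup>2 / 8\<bar>"
    by (rule l) (use m T radial_nonneg[of x0] in \<open>auto simp: min_def split: if_splits\<close>)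
  also have "\<dots> \<le> K * (norm (x - y) * ?r)" using d K by (intro mult_left_mono)
  finally show ?thesis unfolding e[of x] e[of y] m by (simp add: mult_ac)
qed

lemma radial_less_imp:
  assumes "radial x0 x < T" shows "norm (x - x0) \<le> sqrt (8 * T)" "\<bar>(x - x0) $ i\<bar> \<le> sqrt (8 * T)"
proof -
  have "(norm (x - x0))\<^sup>2 \<le> 8 * T" using assms unfolding radial_def by simp
  then show n: "norm (x - x0) \<le> sqrt (8 * T)" by (rule real_le_rsqrt)
  then show "\<bar>(x - x0) $ i\<bar> \<le> sqrt (8 * T)" using component_le_norm_cart[of "x - x0" i] by linarith
qed

lemma in_L2_radial_support:
  fixes f :: "real^2 \<Rightarrow> real"
  assumes "f \<in> borel_measurable borel" "\<And>x. \<bar>f x\<bar> \<le> B" "\<And>x. radial x0 x \<ge> T \<Longrightarrow> f x = 0"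
  shows "in_L2 f"
proof (rule in_L2_bounded_support[OF assms(1,2), of "norm x0 + sqrt (8 * T)"])
  fix x :: "real^2" assume "norm x > norm x0 + sqrt (8 * T)"
  then have "norm (x - x0) > sqrt (8 * T)" using norm_triangle_sub[of x x0] by linarith
  then show "f x = 0" using assms(3)[of x] radial_less_imp(1)[of x0 x T] by linarith
qed

text \<open>Profiles with finitely many kinks, at the points of E. They serve in two ways: as
  functions of \<open>radial x0 x\<close>, and multiplied by (x - x0) / 4, the gradient of
  \<open>radial\<close>, as vector fields.\<close>

locale radial_profile =
  fixes p p1 :: "real \<Rightarrow> real" and E :: "real set" and K T :: real
  assumes T: "T > 0" and cont: "continuous_on {0..T} p" and E: "finite E"
    and deriv: "\<And>t. 0 \<le> t \<Longrightarrow> t \<notin> E \<Longrightarrow> (p has_real_derivative p1 t) (at t)"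
    and bound: "\<And>t. \<bar>p t\<bar> \<le> K" "\<And>t. \<bar>p1 t\<bar> \<le> K"
    and zero: "\<And>t. t \<ge> T \<Longrightarrow> p t = 0" "\<And>t. t \<ge> T \<Longrightarrow> p1 t = 0"
    and meas [measurable]: "p \<in> borel_measurable borel" "p1 \<in> borel_measurable borel"
begin

lemma K_nonneg: "K \<ge> 0"
  using bound(1)[of 0] by linarith

lemma lip: "\<bar>p (radial x0 x) - p (radial x0 y)\<bar> \<le> K * sqrt (8 * T) * norm (x - y)"
  by (rule radial_lipschitz[OF T K_nonneg])
    (auto intro!: lipschitz_of_piecewise_C1[OF cont E deriv bound(2)] zero)

lemma component_measurable [measurable]: "(\<lambda>x :: real^2. (x - x0) $ i) \<in> borel_measurable borel"
  by (intro borel_measurable_continuous_onI continuous_intros)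

lemma bound_component:
  assumes "\<And>t. t \<ge> T \<Longrightarrow> q t = 0" "\<And>t. \<bar>q t\<bar> \<le> K"
  shows "\<bar>q (radial x0 x) * ((x - x0) $ i / 4)\<bar> \<le> K * (sqrt (8 * T) / 4)"
proof (cases "radial x0 x < T")
  case True
  then show ?thesis unfolding abs_mult using radial_less_imp(2)[OF True, of i] assms(2) K_nonneg
    by (intro mult_mono) auto
qed (use assms T K_nonneg in auto)

lemma in_L2_profile: "in_L2 (\<lambda>x. p (radial x0 x))" "in_L2 (\<lambda>x. p1 (radial x0 x) * ((x - x0) $ i / 4))"
  "in_L2 (\<lambda>x. p (radial x0 x) * ((x - x0) $ i / 4))"
  "in_L2 (\<lambda>x. p1 (radial x0 x) * ((x - x0) $ i / 4)\<^sup>2 + p (radial x0 x) / 4)"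
proof -
  show "in_L2 (\<lambda>x. p (radial x0 x))" by (rule in_L2_radial_support[where T = T and ?x0.0 = x0, OF _ bound(1)]) (auto simp: zero)
  then have a: "in_L2 (\<lambda>x. p (radial x0 x) / 4)" using in_L2_cmult[of _ "1/4"] by simp
  show 1: "in_L2 (\<lambda>x. p1 (radial x0 x) * ((x - x0) $ i / 4))"
    by (rule in_L2_radial_support[where T = T and ?x0.0 = x0, OF _ bound_component]) (auto simp: zero bound)
  show "in_L2 (\<lambda>x. p (radial x0 x) * ((x - x0) $ i / 4))"
    by (rule in_L2_radial_support[where T = T and ?x0.0 = x0, OF _ bound_component]) (auto simp: zero bound)
  have "in_L2 (\<lambda>x. p1 (radial x0 x) * ((x - x0) $ i / 4)\<^sup>2)"
  proof (rule in_L2_radial_support[where T = T and ?x0.0 = x0])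
    show "\<bar>p1 (radial x0 x) * ((x - x0) $ i / 4)\<^sup>2\<bar> \<le> K * (sqrt (8 * T) / 4) * (sqrt (8 * T) / 4)" for x
    proof (cases "radial x0 x < T")
      case True
      have "\<bar>p1 (radial x0 x) * ((x - x0) $ i / 4)\<bar> * \<bar>(x - x0) $ i / 4\<bar> \<le> K * (sqrt (8 * T) / 4) * (sqrt (8 * T) / 4)"
        using bound_component[OF zero(2) bound(2)] radial_less_imp(2)[OF True, of i] K_nonneg T
        by (intro mult_mono) auto
      then show ?thesis by (simp add: abs_mult power2_eq_square mult.assoc)
    qed (use zero T K_nonneg in auto)
  qed (auto simp: zero)
  from in_L2_add[OF this a] show "in_L2 (\<lambda>x. p1 (radial x0 x) * ((x - x0) $ i / 4)\<^sup>2 + p (radial x0 x) / 4)" .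
qed

lemma line_derivative:
  assumes "radial x0 x \<notin> E"
  shows "((\<lambda>h. p (radial x0 (x + h *\<^sub>R axis i 1))) has_real_derivative p1 (radial x0 x) * ((x - x0) $ i / 4)) (at 0)"
  by (rule DERIV_chain2[OF _ radial_line_derivative]) (simp add: deriv assms)

lemma weak_partial_profile:
  "has_weak_partial i (\<lambda>x. p (radial x0 x)) (\<lambda>x. p1 (radial x0 x) * ((x - x0) $ i / 4))"
proof (rule weak_partialI)
  show "locally_integrable (\<lambda>x. p1 (radial x0 x) * ((x - x0) $ i / 4))"
    by (rule in_L2_locally_integrable[OF in_L2_profile(2)])
  show "norm (p (radial x0 x)) \<le> K" for x using bound by simp
  show "norm (p (radial x0 (x + t *\<^sub>R axis i 1)) - p (radial x0 x)) \<le> K * sqrt (8 * T) * \<bar>t\<bar>" for x t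
    using lip[of x0 "x + t *\<^sub>R axis i 1" x] by (simp add: norm_axis_1)
  show "AE x in lborel. ((\<lambda>t. p (radial x0 (x + t *\<^sub>R axis i 1))) has_vector_derivative
      p1 (radial x0 x) * ((x - x0) $ i / 4)) (at 0)"
    using AE_radial[OF E, of x0]
  proof eventually_elim
    case (elim x)
    show ?case using line_derivative[OF elim] unfolding has_real_derivative_iff_has_vector_derivative .
  qed
qed measurable

lemma weak_partial_profile_component:
  "has_weak_partial i (\<lambda>x. p (radial x0 x) * ((x - x0) $ i / 4))
    (\<lambda>x. p1 (radial x0 x) * ((x - x0) $ i / 4)\<^sup>2 + p (radial x0 x) / 4)"
proof (rule weak_partialI)
  show "locally_integrable (\<lambda>x. p1 (radial x0 x) * ((x - x0) $ i / 4)\<^sup>2 + p (radial x0 x) / 4)"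
    by (rule in_L2_locally_integrable[OF in_L2_profile(4)])
  show "norm (p (radial x0 x) * ((x - x0) $ i / 4)) \<le> K * (sqrt (8 * T) / 4)" for x
    using bound_component[OF zero(1) bound(1)] by simp
  show "norm (p (radial x0 (x + t *\<^sub>R axis i 1)) * ((x + t *\<^sub>R axis i 1 - x0) $ i / 4) - p (radial x0 x) * ((x - x0) $ i / 4))
    \<le> (K * sqrt (8 * T) * (sqrt (8 * T) / 4) + K * (1 / 4)) * \<bar>t\<bar>" for x t
  proof -
    let ?y = "x + t *\<^sub>R axis i 1" and ?r = "sqrt (8 * T)"
    \<comment> \<open>The coordinate is clipped to its range on the support of p. This makes the
      second factor globally bounded and Lipschitz without changing the product.\<close>
    define c where "c u = max (- ?r) (min ?r ((u - x0) $ i)) / 4" for u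
    have c: "p (radial x0 u) * ((u - x0) $ i / 4) = p (radial x0 u) * c u" for u
    proof (cases "radial x0 u < T")
      case True
      have "max (- ?r) (min ?r z) = z" if "\<bar>z\<bar> \<le> ?r" for z :: real using that by linarith
      from this[OF radial_less_imp(2)[OF True, of i]] show ?thesis unfolding c_def by simp
    qed (simp add: zero(1))
    have "\<bar>max (- r) (min r z) / 4\<bar> \<le> r / 4" if "r \<ge> 0" for r z :: real using that by linarith
    then have cb: "\<bar>c u\<bar> \<le> ?r / 4" for u unfolding c_def using T by simp
    have "\<bar>(?y - x0) $ i - (x - x0) $ i\<bar> = \<bar>t\<bar>" by simp
    then have cl: "\<bar>c ?y - c x\<bar> \<le> 1 / 4 * \<bar>t\<bar>" unfolding c_def by linarith
    have "\<bar>p (radial x0 ?y) * c ?y - p (radial x0 x) * c x\<bar>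
      = \<bar>(p (radial x0 ?y) - p (radial x0 x)) * c ?y + p (radial x0 x) * (c ?y - c x)\<bar>"
      by (simp add: algebra_simps)
    also have "\<dots> \<le> \<bar>p (radial x0 ?y) - p (radial x0 x)\<bar> * \<bar>c ?y\<bar> + \<bar>p (radial x0 x)\<bar> * \<bar>c ?y - c x\<bar>"
      unfolding abs_mult[symmetric] by (rule abs_triangle_ineq)
    also have "\<dots> \<le> (K * ?r * \<bar>t\<bar>) * (?r / 4) + K * (1 / 4 * \<bar>t\<bar>)"
      using lip[of x0 ?y x] cb cl bound(1) K_nonneg T
      by (intro add_mono mult_mono) (auto simp: norm_axis_1)
    finally show ?thesis unfolding c by (simp add: algebra_simps)
  qed
  show "AE x in lborel. ((\<lambda>t. p (radial x0 (x + t *\<^sub>R axis i 1)) * ((x + t *\<^sub>R axis i 1 - x0) $ i / 4)) has_vector_derivative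
      p1 (radial x0 x) * ((x - x0) $ i / 4)\<^sup>2 + p (radial x0 x) / 4) (at 0)"
    using AE_radial[OF E, of x0]
  proof eventually_elim
    case (elim x)
    have "((\<lambda>t. (x + t *\<^sub>R axis i 1 - x0) $ i / 4) has_real_derivative 1 / 4) (at 0)"
      by (auto intro!: derivative_eq_intros)
    from DERIV_mult[OF line_derivative[OF elim, of i] this]
    have "((\<lambda>t. p (radial x0 (x + t *\<^sub>R axis i 1)) * ((x + t *\<^sub>R axis i 1 - x0) $ i / 4)) has_real_derivative
      p1 (radial x0 x) * ((x - x0) $ i / 4)\<^sup>2 + p (radial x0 x) / 4) (at 0)"
      by (rule DERIV_cong) (simp add: power2_eq_square)
    then show ?case unfolding has_real_derivative_iff_has_vector_derivative .
  qed
qed measurable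

end

section \<open>The lower bound\<close>

lemma psum_measurable [measurable]:
  "bF \<in> borel_measurable borel" "bF' \<in> borel_measurable borel"
  "bP \<in> borel_measurable borel" "bP' \<in> borel_measurable borel"
  by (rule borel_measurable_continuous_onI, rule DERIV_continuous_on, rule has_field_derivative_at_within, rule bessel_derivs)+

lemma dual_measurable [measurable]: "dual \<in> borel_measurable borel" "dual' \<in> borel_measurable borel"
  unfolding dual_def[abs_def] dual'_def[abs_def] by measurable

lemma dual_continuous: "d > 0 \<Longrightarrow> continuous_on {d..} dual" "d > 0 \<Longrightarrow> continuous_on {d..} dual'"
  by (rule DERIV_continuous_on, rule has_field_derivative_at_within, rule dual_deriv dual'_deriv, auto)+

lemma has_derivative_cong_open:
  fixes f g :: "real \<Rightarrow> real"
  assumes "(g has_real_derivative D) (at t)" "open S" "t \<in> S" "\<And>s. s \<in> S \<Longrightarrow> f s = g s"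
  shows "(f has_real_derivative D) (at t)"
  using has_field_derivative_transform_within_open[OF assms(1-3), of f] assms(4) by simp

text \<open>The test function \<open>f\<close> is the dual profile, continued linearly for \<open>t < d\<close>. Its gradient jumps
  at \<open>t_star\<close>; the cut-off \<open>p k\<close> of its derivative is Lipschitz, and the term of \<open>p1 k\<close> coming from the
  cut-off is nonnegative because \<open>dual'\<close> is negative near \<open>t_star\<close>. Dropping it leaves \<open>hk k\<close>.\<close>

locale dual_test =
  fixes d M :: real
  assumes d: "0 < d" "d < t_star"
    and M: "\<And>t. d \<le> t \<Longrightarrow> t \<le> t_star \<Longrightarrow> \<bar>dual t\<bar> \<le> M" "\<And>t. d \<le> t \<Longrightarrow> t \<le> t_star \<Longrightarrow> \<bar>dual' t\<bar> \<le> M"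
begin

lemma M_nonneg: "M \<ge> 0"
  using M(1)[of d] d by linarith

text \<open>\<open>max 0 t\<close> freezes the linear piece for t < 0, values that
  \<open>radial\<close> does not take, and so keeps f bounded on the whole line.\<close>

definition f where
  "f t = (if t \<ge> t_star then 0 else if t \<ge> d then dual t else dual d + dual' d * (max 0 t - d))"

definition f1 where
  "f1 t = (if t \<ge> t_star then 0 else if t \<ge> d then dual' t else if t \<ge> 0 then dual' d else 0)"

definition p where
  "p k t = (if t \<ge> t_star then 0 else if t > t_star - 1 / k then k * (t_star - t) * dual' t
    else if t \<ge> d then dual' t else dual' d)"

definition p1 where
  "p1 k t = (if t \<ge> t_star then 0
    else if t > t_star - 1 / k then - k * dual' t - k * (t_star - t) * ((dual' t + dual t) / t)
    else if t \<ge> d then - (dual' t + dual t) / t else 0)"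

text \<open>The Laplacian of f(radial) away from the kink. It is (t f'' + f') / 2, where the
  equation of the profile gives - dual / 2 and the linear piece gives dual' d / 2.\<close>

definition h where
  "h t = (if t \<ge> t_star then 0 else if t \<ge> d then - dual t / 2 else dual' d / 2)"

definition hk where
  "hk k t = (if t \<ge> t_star then 0 else if t > t_star - 1 / k then k * (t_star - t) * (- dual t / 2)
    else if t \<ge> d then - dual t / 2 else dual' d / 2)"

lemma measurable_profiles [measurable]:
  "f \<in> borel_measurable borel" "f1 \<in> borel_measurable borel" "p k \<in> borel_measurable borel"
  "p1 k \<in> borel_measurable borel" "h \<in> borel_measurable borel" "hk k \<in> borel_measurable borel"
  unfolding f_def[abs_def] f1_def[abs_def] p_def[abs_def] p1_def[abs_def] h_def[abs_def] hk_def[abs_def]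
  by measurable

lemma profile_f: "radial_profile f f1 {0, d, t_star} (M * (1 + d)) t_star"
proof
  have Md: "M \<le> M * (1 + d)" using M_nonneg d by (simp add: algebra_simps)
  show "continuous_on {0..t_star} f"
  proof -
    \<comment> \<open>One formula for both pieces: each summand is constant where the other
      varies.\<close>
    have "continuous_on {0..t_star} (\<lambda>t. dual (max d t) + dual' d * (min d (max 0 t) - d))"
      using d by (intro continuous_intros continuous_on_compose2[OF dual_continuous(1)[OF d(1)]]) auto
    then show ?thesis
      by (rule continuous_on_cong[THEN iffD1, rotated 2])
        (use d in \<open>auto simp: f_def dual_t_star max_def min_def\<close>)
  qed
  show "(f has_real_derivative f1 t) (at t)" if t: "0 \<le> t" "t \<notin> {0, d, t_star}" for t
  proof -
    consider "0 < t" "t < d" | "d < t" "t < t_star" | "t_star < t" using t by force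
    then show ?thesis
    proof cases
      case 1
      show ?thesis
        by (rule has_derivative_cong_open[of "\<lambda>t. dual d + dual' d * (t - d)" _ _ "{0<..<d}"])
          (use 1 d in \<open>auto intro!: derivative_eq_intros simp: f_def f1_def\<close>)
    next
      case 2
      have "(dual has_real_derivative f1 t) (at t)" using 2 d dual_deriv[of t] by (simp add: f1_def)
      then show ?thesis
        by (rule has_derivative_cong_open[of _ _ _ "{d<..<t_star}"]) (use 2 d in \<open>auto simp: f_def\<close>)
    next
      case 3
      show ?thesis
        by (rule has_derivative_cong_open[of "\<lambda>t. 0" _ _ "{t_star<..}"])
          (use 3 d in \<open>auto simp: f_def f1_def\<close>)
    qed
  qed
  show "\<bar>f t\<bar> \<le> M * (1 + d)" for t
  proof (cases "t < d")
    case True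
    have "\<bar>dual d + dual' d * (max 0 t - d)\<bar> \<le> \<bar>dual d\<bar> + \<bar>dual' d\<bar> * \<bar>max 0 t - d\<bar>"
      unfolding abs_mult[symmetric] by (rule abs_triangle_ineq)
    also have "\<dots> \<le> M + M * d" using True d M M_nonneg by (intro add_mono mult_mono) auto
    finally show ?thesis using True d by (simp add: f_def distrib_left)
  next
    case False
    then show ?thesis using M(1)[of t] Md M_nonneg d by (auto simp: f_def)
  qed
  show "\<bar>f1 t\<bar> \<le> M * (1 + d)" for t
    using M(2)[of t] M(2)[of d] Md M_nonneg d by (auto simp: f1_def)
qed (use t_star d in \<open>auto simp: f_def f1_def\<close>)

lemma dual''_bound: "d \<le> t \<Longrightarrow> t \<le> t_star \<Longrightarrow> \<bar>(dual' t + dual t) / t\<bar> \<le> 2 * M / d"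
  unfolding abs_divide using M[of t] M_nonneg d by (intro frac_le) auto

lemma cutoff_bound: "1 \<le> k * (t_star - d) \<Longrightarrow> t < t_star \<Longrightarrow> t > t_star - 1 / k \<Longrightarrow> k > 0 \<Longrightarrow> 0 \<le> k * (t_star - t) \<and> k * (t_star - t) \<le> 1 \<and> d < t"
proof -
  assume *: "1 \<le> k * (t_star - d)" "t < t_star" "t > t_star - 1 / k" "k > 0"
  then have "1 / k \<le> t_star - d" "k * (t_star - t) \<le> 1" by (auto simp: field_simps)
  then show ?thesis using * by auto
qed

lemma p_bound: "\<bar>p k t\<bar> \<le> M" if k: "k > 0" "1 \<le> k * (t_star - d)"
proof -
  consider "t \<ge> t_star" | "t < t_star" "t > t_star - 1 / k" | "t < t_star" "t \<le> t_star - 1 / k" by linarith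
  then show ?thesis
  proof cases
    case 2
    note c = cutoff_bound[OF k(2) 2 k(1)]
    have "\<bar>k * (t_star - t) * dual' t\<bar> \<le> 1 * M" unfolding abs_mult[of _ "dual' t"]
      using c M(2)[of t] 2 by (intro mult_mono) auto
    then show ?thesis using 2 by (simp add: p_def)
  qed (use M(2)[of t] M(2)[of d] M_nonneg d in \<open>auto simp: p_def\<close>)
qed

lemma profile_p:
  assumes k: "k > 0" "1 \<le> k * (t_star - d)"
  shows "radial_profile (p k) (p1 k) {0, d, t_star - 1 / k, t_star} (M + k * M + 2 * M / d) t_star"
proof
  let ?\<tau> = "t_star - 1 / k"
  have \<tau>: "d \<le> ?\<tau>" "?\<tau> < t_star" using k by (auto simp: field_simps)
  have nn: "k * M \<ge> 0" "2 * M / d \<ge> 0" "M \<ge> 0" using M_nonneg k d by auto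
  show "continuous_on {0..t_star} (p k)"
  proof -
    \<comment> \<open>Again one formula: \<open>min 1\<close> is the cut-off and
      \<open>max d\<close> the constant continuation below d.\<close>
    have "continuous_on {0..t_star} (\<lambda>t. min 1 (k * (t_star - t)) * dual' (max d t))"
      using d by (intro continuous_intros continuous_on_compose2[OF dual_continuous(2)[OF d(1)]]) auto
    moreover have "min 1 (k * (t_star - t)) * dual' (max d t) = p k t" if "t \<in> {0..t_star}" for t
    proof (cases "t > ?\<tau>")
      case True
      then have "t \<ge> d" using \<tau> by linarith
      moreover have "k * (t_star - t) \<le> 1" using True k by (simp add: field_simps)
      ultimately show ?thesis using True that by (auto simp: p_def min_def max_def)
    next
      case False
      then have "t < t_star" using \<tau> by linarith
      moreover have "k * (t_star - t) \<ge> 1" using False k by (simp add: field_simps)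
      moreover have "p k t = dual' (max d t)" using False \<open>t < t_star\<close> by (simp add: p_def max_def)
      ultimately show ?thesis by simp
    qed
    ultimately show ?thesis by (rule continuous_on_eq)
  qed
  show "(p k has_real_derivative p1 k t) (at t)" if t: "0 \<le> t" "t \<notin> {0, d, ?\<tau>, t_star}" for t
  proof -
    consider "0 < t" "t < d" | "d < t" "t < ?\<tau>" | "?\<tau> < t" "t < t_star" | "t_star < t" using t \<tau> by force
    then show ?thesis
    proof cases
      case 1
      show ?thesis
      proof (rule has_derivative_cong_open[of "\<lambda>t. dual' d" _ _ "{..<d}"])
        have e: "\<not> s \<ge> t_star" "\<not> s > ?\<tau>" "\<not> s \<ge> d" if "s < d" for s using that \<tau> d(2) by linarith+
        show "p k s = dual' d" if "s \<in> {..<d}" for s using e[of s] that by (simp add: p_def)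
        show "((\<lambda>t. dual' d) has_real_derivative p1 k t) (at t)" using e[OF 1(2)] by (simp add: p1_def)
      qed (use 1 in auto)
    next
      case 2
      have e: "\<not> s \<ge> t_star" "\<not> s > ?\<tau>" "s \<ge> d" if "d < s" "s < ?\<tau>" for s using that \<tau> by linarith+
      have "(dual' has_real_derivative p1 k t) (at t)" using e[OF 2] 2 d(1) dual'_deriv[of t] by (simp add: p1_def)
      then show ?thesis
      proof (rule has_derivative_cong_open[of _ _ _ "{d<..<?\<tau>}"])
        show "p k s = dual' s" if "s \<in> {d<..<?\<tau>}" for s using e[of s] that by (simp add: p_def)
      qed (use 2 in auto)
    next
      case 3
      have "((\<lambda>t. k * (t_star - t) * dual' t) has_real_derivative p1 k t) (at t)"
      proof -
        have "t > 0" using 3 d(1) \<tau>(1) by linarith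
        then have "((\<lambda>t. k * (t_star - t) * dual' t) has_real_derivative
            k * (0 - 1) * dual' t + - (dual' t + dual t) / t * (k * (t_star - t))) (at t)"
          by (auto intro!: derivative_eq_intros dual'_deriv)
        moreover have "k * (0 - 1) * dual' t + - (dual' t + dual t) / t * (k * (t_star - t)) = - k * dual' t - k * (t_star - t) * ((dual' t + dual t) / t)"
          using \<open>t > 0\<close> by (simp add: field_simps)
        moreover have "\<dots> = p1 k t" using 3 by (simp add: p1_def)
        ultimately show ?thesis by (simp only:)
      qed
      then show ?thesis
        by (rule has_derivative_cong_open[of _ _ _ "{?\<tau><..<t_star}"]) (use 3 d \<tau> in \<open>auto simp: p_def\<close>)
    next
      case 4
      show ?thesis
        by (rule has_derivative_cong_open[of "\<lambda>t. 0" _ _ "{t_star<..}"])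
          (use 4 d in \<open>auto simp: p_def p1_def\<close>)
    qed
  qed
  show "\<bar>p k t\<bar> \<le> M + k * M + 2 * M / d" for t using p_bound[OF k, of t] nn by linarith
  show "\<bar>p1 k t\<bar> \<le> M + k * M + 2 * M / d" for t
  proof -
    consider "t \<ge> t_star" | "t < t_star" "t > t_star - 1 / k" | "t < t_star" "t \<le> t_star - 1 / k" "d \<le> t"
      | "t < t_star" "t \<le> t_star - 1 / k" "t < d" by linarith
    then show ?thesis
    proof cases
      case 2
      note c = cutoff_bound[OF k(2) 2 k(1)]
      have a: "\<bar>k * (t_star - t) * ((dual' t + dual t) / t)\<bar> \<le> 1 * (2 * M / d)"
        unfolding abs_mult[of _ "(dual' t + dual t) / t"] using c dual''_bound[of t] 2 nn by (intro mult_mono) auto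
      have "\<bar>k * dual' t\<bar> \<le> k * M" unfolding abs_mult using k c M(2)[of t] 2 by (intro mult_mono) auto
      then show ?thesis using 2 a nn unfolding p1_def by (simp add: abs_if split: if_splits)
    next
      case 3
      then have "p1 k t = - (dual' t + dual t) / t" by (simp add: p1_def)
      then have "\<bar>p1 k t\<bar> = \<bar>(dual' t + dual t) / t\<bar>" by (simp only: minus_divide_left[symmetric] abs_minus_cancel)
      then show ?thesis using dual''_bound[of t] 3 nn by linarith
    qed (use nn in \<open>auto simp: p1_def\<close>)
  qed
qed (use t_star d k in \<open>auto simp: p_def p1_def intro!: finite.intros\<close>)

lemma hk_bound: "\<bar>hk k t\<bar> \<le> M" if k: "k > 0" "1 \<le> k * (t_star - d)"
proof -
  consider "t \<ge> t_star" | "t < t_star" "t > t_star - 1 / k" | "t < t_star" "t \<le> t_star - 1 / k" by linarith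
  then show ?thesis
  proof cases
    case 2
    note c = cutoff_bound[OF k(2) 2 k(1)]
    have "\<bar>k * (t_star - t) * (- dual t / 2)\<bar> \<le> 1 * M" unfolding abs_mult[of _ "- dual t / 2"]
      using c M(1)[of t] 2 M_nonneg by (intro mult_mono) auto
    then show ?thesis using 2 by (simp add: hk_def)
  next
    case 3
    then show ?thesis using M(1)[of t] M(2)[of d] M_nonneg d unfolding hk_def by (auto simp: abs_if split: if_splits)
  qed (use M_nonneg in \<open>auto simp: hk_def\<close>)
qed

lemma eventually_const:
  assumes k: "\<And>n. k n = k0 + real n" "k0 > 0" and t: "t < t_star"
  shows "\<forall>\<^sub>F n in sequentially. t \<le> t_star - 1 / k n"
proof -
  have "\<forall>\<^sub>F n in sequentially. real n \<ge> 1 / (t_star - t)"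
    using eventually_ge_at_top[of "nat \<lceil>1 / (t_star - t)\<rceil>"] by eventually_elim linarith
  then show ?thesis
  proof eventually_elim
    case (elim n)
    then have "k n \<ge> 1 / (t_star - t)" "k n > 0" using k by auto
    then show ?case using t by (simp add: field_simps)
  qed
qed

text \<open>Green's formula in two steps. The first integration by parts pairs f1 with the gradient
  of v; f1 jumps at t_star, so it is replaced by p k before the second one. For t >= 0, p k and hk k
  agree with f1 and h outside a layer that shrinks as k grows, and dominated convergence removes the
  replacement.\<close>

lemma test_inequality:
  fixes v :: "real^2 \<Rightarrow> real"
  assumes v: "in_L2 v" "\<And>i. in_L2 (v1 i)" "\<And>i. in_L2 (v2 i)"
    and w: "\<And>i. has_weak_partial i v (v1 i)" "\<And>i. has_weak_partial i (v1 i) (v2 i)"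
    and pos: "\<And>x. v x \<ge> 0"
  shows "(LINT x|lborel. f (radial x0 x) * (\<Sum>i\<in>UNIV. v2 i x)) \<ge> (LINT x|lborel. h (radial x0 x) * v x)"
proof -
  let ?c = "\<lambda>i (x :: real^2). (x - x0) $ i / 4"
  interpret F: radial_profile f f1 "{0, d, t_star}" "M * (1 + d)" t_star by (rule profile_f)
  have "(LINT x|lborel. f1 (radial x0 x) * ?c i x * v1 i x) = - (LINT x|lborel. f (radial x0 x) * v2 i x)" for i
    by (rule L2_integration_by_parts[OF F.in_L2_profile(1,2) F.weak_partial_profile v(2,3) w(2)])
  then have lhs: "(LINT x|lborel. f (radial x0 x) * (\<Sum>i\<in>UNIV. v2 i x))
     = (\<Sum>i\<in>UNIV. - (LINT x|lborel. f1 (radial x0 x) * ?c i x * v1 i x))"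
    using in_L2_integrable_mult[OF F.in_L2_profile(1) v(3)] by (simp add: sum_distrib_left)
  have "isCont dual' t_star" using dual'_deriv[OF t_star(2)] by (rule DERIV_isCont)
  then have "\<forall>\<^sub>F t in at t_star. dual' t < 0"
    unfolding isCont_def using dual_t_star(3) by (rule order_tendstoD(2))
  then obtain e where e: "e > 0" "\<And>t. t \<noteq> t_star \<Longrightarrow> \<bar>t - t_star\<bar> < e \<Longrightarrow> dual' t < 0"
    by (auto simp: eventually_at dist_real_def)
  \<comment> \<open>The layer of width 1 / k below t_star has to lie to the right of d and inside
    the neighbourhood on which dual' is negative.\<close>
  define k0 where "k0 = 1 / (t_star - d) + 1 / e"
  define k where "k n = k0 + real n" for n :: nat
  have k0: "k0 > 0" unfolding k0_def using d e by (intro add_pos_pos) auto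
  have kn: "k n > 0" "1 \<le> k n * (t_star - d)" "1 / k n \<le> e" for n
  proof -
    show p: "k n > 0" using k0 by (simp add: k_def)
    have "k n \<ge> 1 / (t_star - d)" "k n \<ge> 1 / e" unfolding k_def k0_def using d e by auto
    then show "1 \<le> k n * (t_star - d)" "1 / k n \<le> e" using d e p by (auto simp: field_simps)
  qed
  have step: "(LINT x|lborel. hk (k n) (radial x0 x) * v x) \<le> (\<Sum>i\<in>UNIV. - (LINT x|lborel. p (k n) (radial x0 x) * ?c i x * v1 i x))" for n
  proof -
    interpret P: radial_profile "p (k n)" "p1 (k n)" "{0, d, t_star - 1 / k n, t_star}" "M + k n * M + 2 * M / d" t_star
      by (rule profile_p[OF kn(1,2)])
    have i: "integrable lborel (\<lambda>x. (p1 (k n) (radial x0 x) * (?c i x)\<^sup>2 + p (k n) (radial x0 x) / 4) * v x)" for i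
      by (rule in_L2_integrable_mult[OF P.in_L2_profile(4) v(1)])
    have "(LINT x|lborel. (p1 (k n) (radial x0 x) * (?c i x)\<^sup>2 + p (k n) (radial x0 x) / 4) * v x)
      = - (LINT x|lborel. p (k n) (radial x0 x) * ?c i x * v1 i x)" for i
      by (rule L2_integration_by_parts[OF P.in_L2_profile(3,4) P.weak_partial_profile_component v(1,2) w(1)])
    then have "(\<Sum>i\<in>UNIV. - (LINT x|lborel. p (k n) (radial x0 x) * ?c i x * v1 i x))
      = (LINT x|lborel. (\<Sum>i\<in>UNIV. (p1 (k n) (radial x0 x) * (?c i x)\<^sup>2 + p (k n) (radial x0 x) / 4) * v x))"
      using i by simp
    also have "\<dots> \<ge> (LINT x|lborel. hk (k n) (radial x0 x) * v x)"
    proof (rule integral_mono)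
      have "in_L2 (\<lambda>x. hk (k n) (radial x0 x) * v x)"
        by (rule in_L2_bounded_mult[OF v(1) _ hk_bound[OF kn(1,2)]]) measurable
      have "in_L2 (\<lambda>x. hk (k n) (radial x0 x))"
        by (rule in_L2_radial_support[where T = t_star and ?x0.0 = x0, OF _ hk_bound[OF kn(1,2)]]) (auto simp: hk_def)
      then show "integrable lborel (\<lambda>x. hk (k n) (radial x0 x) * v x)" by (rule in_L2_integrable_mult[OF _ v(1)])
      fix x
      let ?t = "radial x0 x"
      \<comment> \<open>The squared gradient of \<open>radial\<close> is t / 2, so the divergence of
        the vector field is (t p1 + p) / 2.\<close>
      have "(\<Sum>i\<in>UNIV. (?c i x)\<^sup>2) = ?t / 2"
        unfolding radial_def norm_power2_cart by (simp add: power_divide sum_divide_distrib)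
      then have s: "(\<Sum>i\<in>UNIV. (p1 (k n) ?t * (?c i x)\<^sup>2 + p (k n) ?t / 4) * v x) = (p1 (k n) ?t * (?t / 2) + p (k n) ?t / 2) * v x"
        unfolding sum_distrib_right[symmetric] sum.distrib sum_distrib_left[symmetric] by simp
      have "hk (k n) ?t \<le> p1 (k n) ?t * (?t / 2) + p (k n) ?t / 2"
      proof -
        consider "?t \<ge> t_star" | "?t < t_star" "?t > t_star - 1 / k n" | "?t < t_star" "?t \<le> t_star - 1 / k n" by linarith
        then show ?thesis
        proof cases
          case 2
          note c = cutoff_bound[OF kn(2) 2 kn(1)]
          then have t: "?t > 0" using d by linarith
          have "dual' ?t < 0" using e(2)[of ?t] 2 kn(3)[of n] by auto
          \<comment> \<open>The part of the divergence produced by the ramp has the sign of - dual'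
            and may be dropped because v is nonnegative.\<close>
          then have "k n * ?t * dual' ?t \<le> 0" using kn(1)[of n] t by (simp add: mult_nonneg_nonpos)
          moreover have "p1 (k n) ?t * (?t / 2) + p (k n) ?t / 2
            = k n * (t_star - ?t) * (- dual ?t / 2) - k n * ?t * dual' ?t / 2"
            using 2 t by (simp add: p_def p1_def field_simps)
          moreover have "hk (k n) ?t = k n * (t_star - ?t) * (- dual ?t / 2)" using 2 by (simp add: hk_def)
          ultimately show ?thesis by linarith
        qed (use d in \<open>auto simp: p_def p1_def hk_def field_simps\<close>)
      qed
      then show "hk (k n) ?t * v x \<le> (\<Sum>i\<in>UNIV. (p1 (k n) ?t * (?c i x)\<^sup>2 + p (k n) ?t / 4) * v x)"
        unfolding s using pos[of x] by (rule mult_right_mono)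
    qed (use i in auto)
    finally show ?thesis .
  qed
  have B: "in_L2 (\<lambda>x. M * indicator {x. radial x0 x < t_star} x)"
    by (rule in_L2_radial_support[where T = t_star and ?x0.0 = x0 and B = M]) (auto simp: indicator_def M_nonneg)
  have l1: "(\<lambda>n. LINT x|lborel. hk (k n) (radial x0 x) * v x) \<longlonglongrightarrow> (LINT x|lborel. h (radial x0 x) * v x)"
  proof (rule integral_dominated_convergence)
    note [measurable] = in_L2_measurable[OF v(1)]
    show "(\<lambda>x. h (radial x0 x) * v x) \<in> borel_measurable lborel" "(\<lambda>x. hk (k n) (radial x0 x) * v x) \<in> borel_measurable lborel" for n
      by measurable
    show "integrable lborel (\<lambda>x. M * indicator {x. radial x0 x < t_star} x * v x)"
      by (rule in_L2_integrable_mult[OF B v(1)])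
    show "AE x in lborel. norm (hk (k n) (radial x0 x) * v x) \<le> M * indicator {x. radial x0 x < t_star} x * v x" for n
    proof (rule AE_I2)
      fix x show "norm (hk (k n) (radial x0 x) * v x) \<le> M * indicator {x. radial x0 x < t_star} x * v x"
        using hk_bound[OF kn(1,2), of n "radial x0 x"] pos[of x]
        by (cases "radial x0 x < t_star") (auto simp: abs_mult mult_right_mono hk_def)
    qed
    show "AE x in lborel. (\<lambda>n. hk (k n) (radial x0 x) * v x) \<longlonglongrightarrow> h (radial x0 x) * v x"
    proof (intro AE_I2 tendsto_eventually)
      fix x
      show "\<forall>\<^sub>F n in sequentially. hk (k n) (radial x0 x) * v x = h (radial x0 x) * v x"
      proof (cases "radial x0 x < t_star")
        case True
        from eventually_const[OF k_def k0 True] show ?thesis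
          by eventually_elim (use True in \<open>auto simp: hk_def h_def\<close>)
      qed (auto simp: hk_def h_def)
    qed
  qed
  have l2: "(\<lambda>n. LINT x|lborel. p (k n) (radial x0 x) * ?c i x * v1 i x) \<longlonglongrightarrow> (LINT x|lborel. f1 (radial x0 x) * ?c i x * v1 i x)" for i
  proof (rule integral_dominated_convergence)
    note [measurable] = in_L2_measurable[OF v(2)] F.component_measurable
    show "(\<lambda>x. f1 (radial x0 x) * ?c i x * v1 i x) \<in> borel_measurable lborel"
      "(\<lambda>x. p (k n) (radial x0 x) * ?c i x * v1 i x) \<in> borel_measurable lborel" for n
      by measurable
    show "integrable lborel (\<lambda>x. sqrt (8 * t_star) / 4 * \<bar>M * indicator {x. radial x0 x < t_star} x * v1 i x\<bar>)"
      by (intro integrable_mult_right integrable_abs in_L2_integrable_mult[OF B v(2)])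
    show "AE x in lborel. norm (p (k n) (radial x0 x) * ?c i x * v1 i x)
       \<le> sqrt (8 * t_star) / 4 * \<bar>M * indicator {x. radial x0 x < t_star} x * v1 i x\<bar>" for n
    proof (rule AE_I2)
      fix x show "norm (p (k n) (radial x0 x) * ?c i x * v1 i x)
       \<le> sqrt (8 * t_star) / 4 * \<bar>M * indicator {x. radial x0 x < t_star} x * v1 i x\<bar>"
      proof (cases "radial x0 x < t_star")
        case True
        have "\<bar>?c i x\<bar> \<le> sqrt (8 * t_star) / 4" using radial_less_imp(2)[OF True, of i] by simp
        then have "\<bar>p (k n) (radial x0 x)\<bar> * \<bar>?c i x\<bar> * \<bar>v1 i x\<bar> \<le> M * (sqrt (8 * t_star) / 4) * \<bar>v1 i x\<bar>"
          using p_bound[OF kn(1,2)] M_nonneg by (intro mult_right_mono mult_mono) auto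
        then show ?thesis using True M_nonneg by (simp add: abs_mult mult_ac)
      qed (simp add: p_def)
    qed
    show "AE x in lborel. (\<lambda>n. p (k n) (radial x0 x) * ?c i x * v1 i x) \<longlonglongrightarrow> f1 (radial x0 x) * ?c i x * v1 i x"
    proof (intro AE_I2 tendsto_eventually)
      fix x
      show "\<forall>\<^sub>F n in sequentially. p (k n) (radial x0 x) * ?c i x * v1 i x = f1 (radial x0 x) * ?c i x * v1 i x"
      proof (cases "radial x0 x < t_star")
        case True
        from eventually_const[OF k_def k0 True] show ?thesis
          by eventually_elim (use True in \<open>auto simp: p_def f1_def\<close>)
      qed (auto simp: p_def f1_def)
    qed
  qed
  have "(\<lambda>n. \<Sum>i\<in>UNIV. - (LINT x|lborel. p (k n) (radial x0 x) * ?c i x * v1 i x))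
      \<longlonglongrightarrow> (\<Sum>i\<in>UNIV. - (LINT x|lborel. f1 (radial x0 x) * ?c i x * v1 i x))"
    by (intro tendsto_sum tendsto_minus l2)
  from LIMSEQ_le[OF l1 this] step show ?thesis unfolding lhs by blast
qed

lemma test_square_integral:
  "(LINT x|lborel. (f (radial x0 x))\<^sup>2)
    \<le> 8 * pi * (d * (\<bar>dual d\<bar> + \<bar>d * dual' d\<bar>)\<^sup>2 + (1 / (bF t_star)\<^sup>2 - ((d * dual' d)\<^sup>2 + d * (dual d)\<^sup>2)))"
proof -
  let ?c = "(\<bar>dual d\<bar> + \<bar>d * dual' d\<bar>)\<^sup>2"
  \<comment> \<open>A majorant of f^2 for t >= 0: crude on [0, d), an interval whose length makes it
    negligible in the limit, and exact from d up to t_star.\<close>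
  define g where "g t = ?c * indicator {0..<d} t + (dual t)\<^sup>2 * indicator {d..t_star} t" for t
  have [measurable]: "g \<in> borel_measurable borel" unfolding g_def[abs_def] by measurable
  have "has_bochner_integral lborel (\<lambda>t. ?c * indicator {0..<d} t :: real) (?c * measure lborel {0..<d})"
    using d by (intro has_bochner_integral_mult_right has_bochner_integral_real_indicator) auto
  then have "has_bochner_integral lborel (\<lambda>t. ?c * indicator {0..<d} t + (dual t)\<^sup>2 * indicator {d..t_star} t)
    (d * ?c + (1 / (bF t_star)\<^sup>2 - ((d * dual' d)\<^sup>2 + d * (dual d)\<^sup>2)))"
    using d by (intro has_bochner_integral_add dual_square_integral) (auto simp: mult.commute)
  moreover have "(\<lambda>t. g t * indicator {0..} t) = g" using d by (auto simp: g_def indicator_def fun_eq_iff)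
  ultimately have "has_bochner_integral lborel (\<lambda>t. g t * indicator {0..} t)
    (d * ?c + (1 / (bF t_star)\<^sup>2 - ((d * dual' d)\<^sup>2 + d * (dual d)\<^sup>2)))" by (simp add: g_def[abs_def])
  from has_bochner_integral_radial[OF this, of x0]
  have G: "integrable lborel (\<lambda>x. g (radial x0 x))"
    "(LINT x|lborel. g (radial x0 x)) = 8 * pi * (d * ?c + (1 / (bF t_star)\<^sup>2 - ((d * dual' d)\<^sup>2 + d * (dual d)\<^sup>2)))"
    by (auto simp: has_bochner_integral_iff)
  interpret F: radial_profile f f1 "{0, d, t_star}" "M * (1 + d)" t_star by (rule profile_f)
  have "(LINT x|lborel. (f (radial x0 x))\<^sup>2) \<le> (LINT x|lborel. g (radial x0 x))"
  proof (rule integral_mono[OF in_L2_integrable_square[OF F.in_L2_profile(1)] G(1)])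
    fix x
    let ?t = "radial x0 x"
    consider "?t \<ge> t_star" | "?t < t_star" "?t \<ge> d" | "?t < d" by linarith
    then show "(f ?t)\<^sup>2 \<le> g ?t"
    proof cases
      case 3
      have t0: "?t \<ge> 0" by simp
      have "\<bar>dual d + dual' d * (?t - d)\<bar> \<le> \<bar>dual d\<bar> + \<bar>dual' d\<bar> * \<bar>?t - d\<bar>"
        unfolding abs_mult[symmetric] by (rule abs_triangle_ineq)
      also have "\<dots> \<le> \<bar>dual d\<bar> + \<bar>dual' d\<bar> * d" using 3 t0 d by (intro add_left_mono mult_left_mono) auto
      finally have "\<bar>dual d + dual' d * (?t - d)\<bar> \<le> \<bar>\<bar>dual d\<bar> + \<bar>d * dual' d\<bar>\<bar>" using d by (simp add: abs_mult mult.commute)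
      then have "(dual d + dual' d * (?t - d))\<^sup>2 \<le> ?c" by (simp only: abs_le_square_iff)
      then show ?thesis using 3 d by (simp add: f_def g_def)
    qed (use d in \<open>auto simp: f_def g_def dual_t_star\<close>)
  qed
  then show ?thesis unfolding G(2) .
qed

text \<open>From d on, the equation of the profile makes h v and f v / 2 cancel, so only the disk
  \<open>radial x0 x < d\<close>, of area 8 pi d, contributes. There h is dual' d / 2 and v is at
  least 2 - e; the terms containing f are of lower order as d tends to 0.\<close>

lemma test_lower_bound:
  fixes v :: "real^2 \<Rightarrow> real"
  assumes v: "in_L2 v" "\<And>i. in_L2 (v1 i)" "\<And>i. in_L2 (v2 i)"
    and w: "\<And>i. has_weak_partial i v (v1 i)" "\<And>i. has_weak_partial i (v1 i) (v2 i)"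
    and pos: "\<And>x. v x \<ge> 0" "\<And>x. v x \<le> 2" and near: "\<And>x. radial x0 x < d \<Longrightarrow> v x \<ge> 2 - e"
    and slope: "dual' d \<ge> 0"
  shows "4 * pi * ((2 - e) * (d * dual' d) - 2 * (d * \<bar>dual d\<bar> + d * (d * dual' d)))
    \<le> (LINT x|lborel. f (radial x0 x) * ((\<Sum>i\<in>UNIV. v2 i x) + 1/2 * v x))"
proof -
  interpret F: radial_profile f f1 "{0, d, t_star}" "M * (1 + d)" t_star by (rule profile_f)
  have fi: "integrable lborel (\<lambda>x. f (radial x0 x) * (\<Sum>i\<in>UNIV. v2 i x))" "integrable lborel (\<lambda>x. f (radial x0 x) * v x)"
    using in_L2_integrable_mult[OF F.in_L2_profile(1)] v in_L2_sum[of UNIV v2] by auto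
  have "\<bar>h t\<bar> \<le> M" for t
    using M(1)[of t] M(2)[of d] M_nonneg d unfolding h_def by (auto simp: abs_if split: if_splits)
  then have "in_L2 (\<lambda>x. h (radial x0 x))"
    by (intro in_L2_radial_support[where T = t_star and ?x0.0 = x0 and B = M]) (auto simp: h_def)
  then have hi: "integrable lborel (\<lambda>x. h (radial x0 x) * v x)" by (rule in_L2_integrable_mult[OF _ v(1)])
  \<comment> \<open>The pointwise lower bound of the integrand on the disk
    \<open>radial x0 x < d\<close>.\<close>
  define q where "q = 1/2 * ((2 - e) * dual' d - 2 * (\<bar>dual d\<bar> + d * dual' d))"
  have "has_bochner_integral lborel (\<lambda>t. q * indicator {0..<d} t :: real) (q * measure lborel {0..<d})"
    using d by (intro has_bochner_integral_mult_right has_bochner_integral_real_indicator) auto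
  moreover have "q * indicator {0..<d} t = (q * indicator {..<d} t) * indicator {0..} t" for t :: real by (auto simp: indicator_def)
  ultimately have "has_bochner_integral lborel (\<lambda>t. (q * indicator {..<d} t) * indicator {0..} t :: real) (q * d)" using d by simp
  from has_bochner_integral_radial[OF this, of x0]
  have Q: "integrable lborel (\<lambda>x. q * indicator {..<d} (radial x0 x))"
    "(LINT x|lborel. q * indicator {..<d} (radial x0 x)) = 8 * pi * (q * d)"
    by (auto simp: has_bochner_integral_iff)
  have "8 * pi * (q * d) \<le> (LINT x|lborel. h (radial x0 x) * v x + 1/2 * (f (radial x0 x) * v x))"
    unfolding Q(2)[symmetric]
  proof (rule integral_mono[OF Q(1)])
    show "integrable lborel (\<lambda>x. h (radial x0 x) * v x + 1/2 * (f (radial x0 x) * v x))"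
      using hi fi by (intro Bochner_Integration.integrable_add integrable_mult_right)
    fix x
    let ?t = "radial x0 x"
    consider "?t \<ge> t_star" | "?t < t_star" "?t \<ge> d" | "?t < d" by linarith
    then show "q * indicator {..<d} ?t \<le> h ?t * v x + 1/2 * (f ?t * v x)"
    proof cases
      case 3
      have t0: "?t \<ge> 0" by simp
      have a: "dual' d * v x \<ge> dual' d * (2 - e)" using near[OF 3] slope by (rule mult_left_mono)
      have c: "dual d + dual' d * (?t - d) \<ge> - (\<bar>dual d\<bar> + d * dual' d)"
      proof -
        have "dual' d * ?t \<ge> 0" using slope by simp
        then show ?thesis using abs_ge_minus_self[of "dual d"] by (simp add: algebra_simps)
      qed
      have nn: "\<bar>dual d\<bar> + d * dual' d \<ge> 0" using d slope by simp
      have "(dual d + dual' d * (?t - d)) * v x \<ge> - (\<bar>dual d\<bar> + d * dual' d) * v x"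
        by (rule mult_right_mono[OF c pos(1)])
      moreover have "(\<bar>dual d\<bar> + d * dual' d) * v x \<le> (\<bar>dual d\<bar> + d * dual' d) * 2"
        by (rule mult_left_mono[OF pos(2) nn])
      ultimately have "h ?t * v x + 1/2 * (f ?t * v x) \<ge> q"
        using 3 d a unfolding q_def h_def f_def by (simp add: algebra_simps)
      then show ?thesis using 3 by simp
    qed (use d in \<open>auto simp: h_def f_def\<close>)
  qed
  also have "\<dots> = (LINT x|lborel. h (radial x0 x) * v x) + 1/2 * (LINT x|lborel. f (radial x0 x) * v x)"
    using hi fi by simp
  also have "\<dots> \<le> (LINT x|lborel. f (radial x0 x) * (\<Sum>i\<in>UNIV. v2 i x)) + 1/2 * (LINT x|lborel. f (radial x0 x) * v x)"
    using test_inequality[OF v w pos(1)] by simp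
  also have "\<dots> = (LINT x|lborel. f (radial x0 x) * (\<Sum>i\<in>UNIV. v2 i x) + 1/2 * (f (radial x0 x) * v x))"
    using fi by simp
  also have "\<dots> = (LINT x|lborel. f (radial x0 x) * ((\<Sum>i\<in>UNIV. v2 i x) + 1/2 * v x))"
    by (rule Bochner_Integration.integral_cong) (auto simp: algebra_simps)
  finally show ?thesis unfolding q_def by (simp add: algebra_simps)
qed

lemma test_L2: "in_L2 (\<lambda>x. f (radial x0 x))"
proof -
  interpret F: radial_profile f f1 "{0, d, t_star}" "M * (1 + d)" t_star by (rule profile_f)
  show ?thesis by (rule F.in_L2_profile(1))
qed

end

section \<open>The sharp constant\<close>

lemma dual_test_exists:
  assumes d: "0 < d" "d < t_star"
  obtains M where "dual_test d M"
proof -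
  have "compact (dual ` {d..t_star})" "compact (dual' ` {d..t_star})"
    using continuous_on_subset[OF dual_continuous(1)[OF d(1)]] continuous_on_subset[OF dual_continuous(2)[OF d(1)]]
    by (auto intro!: compact_continuous_image)
  then obtain A B where A: "\<And>y. y \<in> dual ` {d..t_star} \<Longrightarrow> norm y \<le> A" and B: "\<And>y. y \<in> dual' ` {d..t_star} \<Longrightarrow> norm y \<le> B"
    using compact_imp_bounded bounded_iff by metis
  have "dual_test d (max A B)"
    by unfold_locales (use d A B in \<open>force simp: le_max_iff_disj\<close>)+
  then show ?thesis by (rule that)
qed

lemma eventually_at_right_0_I:
  "b > 0 \<Longrightarrow> (\<And>d::real. 0 < d \<Longrightarrow> d < b \<Longrightarrow> P d) \<Longrightarrow> \<forall>\<^sub>F d in at_right 0. P d"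
  by (subst eventually_at_right[of 0 1]) auto

lemma b_star_eq: "b_star = 8 * pi / (1 / (bF t_star)\<^sup>2 - 1)"
proof -
  have "bF t_star \<noteq> 0" using bF_t_star by auto
  then have "1 / (bF t_star)\<^sup>2 - 1 = (1 - (bF t_star)\<^sup>2) / (bF t_star)\<^sup>2" by (simp add: field_simps)
  then show ?thesis unfolding b_star_def bessel_J_0_eq t_star_def[symmetric] by simp
qed

lemma b_star_pos: "b_star > 0"
  unfolding b_star_def bessel_J_0_eq t_star_def[symmetric] using bF_t_star
  by (intro divide_pos_pos mult_pos_pos) auto

text \<open>Cauchy--Schwarz at fixed e and d, then d tends to 0 and finally e. The outcome is 8 pi
  <= sqrt (8 pi B) times the norm of Delta v + v/2, where B = 1 / bF(t_star)^2 - 1; squaring it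
  gives the claim.\<close>

lemma helmholtz_lower_bound:
  fixes v :: "real^2 \<Rightarrow> real"
  assumes v: "in_L2 v" "\<And>i. in_L2 (v1 i)" "\<And>i. in_L2 (v2 i)"
    and w: "\<And>i. has_weak_partial i v (v1 i)" "\<And>i. has_weak_partial i (v1 i) (v2 i)"
    and pos: "\<And>x. v x \<ge> 0" "\<And>x. v x \<le> 2" and x0: "v x0 = 2" "isCont v x0"
  shows "b_star \<le> (LINT x|lborel. ((\<Sum>i\<in>UNIV. v2 i x) + 1/2 * v x)\<^sup>2)"
proof -
  let ?w = "\<lambda>x. (\<Sum>i\<in>UNIV. v2 i x) + 1/2 * v x"
  have wL: "in_L2 ?w" by (intro in_L2_add in_L2_sum v in_L2_cmult)
  define B where "B = 1 / (bF t_star)\<^sup>2 - 1"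
  have B: "B > 0"
  proof -
    have "0 < (bF t_star)\<^sup>2" "(bF t_star)\<^sup>2 < 1" using bF_t_star by auto
    then show ?thesis unfolding B_def by (simp add: field_simps)
  qed
  \<comment> \<open>Both bounds are regrouped so that d enters only through d dual'(d), sqrt d
    dual(d) and factors that tend to 0.\<close>
  let ?A = "\<lambda>e d. 4 * pi * ((2 - e) * (d * dual' d) - 2 * (sqrt d * \<bar>sqrt d * dual d\<bar> + d * (d * dual' d)))"
  let ?B = "\<lambda>d. 8 * pi * ((\<bar>sqrt d * dual d\<bar> + sqrt d * \<bar>d * dual' d\<bar>)\<^sup>2
     + (1 / (bF t_star)\<^sup>2 - ((d * dual' d)\<^sup>2 + (sqrt d * dual d)\<^sup>2)))"
  have main: "4 * pi * (2 - e) \<le> sqrt (8 * pi * B) * L2norm ?w" if e: "e > 0" for e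
  proof -
    have id: "((\<lambda>d::real. d) \<longlongrightarrow> 0) (at_right 0)" "((\<lambda>d::real. sqrt d) \<longlongrightarrow> 0) (at_right 0)"
      by (auto intro!: tendsto_eq_intros)
    have "((\<lambda>d. ?A e d) \<longlongrightarrow> 4 * pi * ((2 - e) * 1 - 2 * (0 * \<bar>0\<bar> + 0 * 1))) (at_right 0)"
      by (intro tendsto_intros id dual_limits)
    then have lA: "((\<lambda>d. ?A e d) \<longlongrightarrow> 4 * pi * (2 - e)) (at_right 0)" by simp
    have "((\<lambda>d. sqrt (?B d) * L2norm ?w) \<longlongrightarrow> sqrt (8 * pi * ((\<bar>0\<bar> + 0 * \<bar>1\<bar>)\<^sup>2
       + (1 / (bF t_star)\<^sup>2 - (1\<^sup>2 + 0\<^sup>2)))) * L2norm ?w) (at_right 0)"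
      by (intro tendsto_intros id dual_limits)
    then have lB: "((\<lambda>d. sqrt (?B d) * L2norm ?w) \<longlongrightarrow> sqrt (8 * pi * B) * L2norm ?w) (at_right 0)"
      by (simp add: B_def)
    obtain r where r: "r > 0" "\<And>x. norm (x - x0) < r \<Longrightarrow> \<bar>v x - v x0\<bar> < e"
      using x0(2) e unfolding continuous_at_eps_delta by (metis dist_norm real_norm_def)
    have "\<forall>\<^sub>F d in at_right 0. d * dual' d > 0" using dual_limits(1) by (rule order_tendstoD(1)) simp
    then obtain d0 where d0: "d0 > 0" "\<And>d. 0 < d \<Longrightarrow> d < d0 \<Longrightarrow> d * dual' d > 0"
      by (subst (asm) eventually_at_right[of 0 1]) auto
    \<comment> \<open>Smallness of d ensures that dual' d is positive, that d is below t_star, and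
      that v is within e of 2 on the disk, since \<open>radial\<close> less than r^2 / 8 means
      distance less than r.\<close>
    have "?A e d \<le> sqrt (?B d) * L2norm ?w" if d: "0 < d" "d < min d0 (min t_star (r\<^sup>2 / 8))" for d
    proof -
      have d': "0 < d" "d < t_star" "d < d0" "d < r\<^sup>2 / 8" using d by auto
      obtain M where "dual_test d M" using dual_test_exists[OF d'(1,2)] .
      then interpret dual_test d M .
      have near: "v x \<ge> 2 - e" if "radial x0 x < d" for x
      proof -
        have "(norm (x - x0))\<^sup>2 < r\<^sup>2" using that d' unfolding radial_def by simp
        then have "norm (x - x0) < r" using r(1) by (simp add: power_less_imp_less_base)
        from r(2)[OF this] show ?thesis using x0(1) by linarith
      qed
      have sl: "dual' d \<ge> 0" using d0(2)[OF d'(1,3)] d' by (simp add: zero_less_mult_iff)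
      have sq: "sqrt d * (sqrt d * y) = d * y" "(sqrt d * y)\<^sup>2 = d * y\<^sup>2" for y
        using d' by (auto simp: power_mult_distrib simp flip: mult.assoc)
      have "4 * pi * ((2 - e) * (d * dual' d) - 2 * (d * \<bar>dual d\<bar> + d * (d * dual' d)))
        \<le> (LINT x|lborel. f (radial x0 x) * ?w x)"
        by (rule test_lower_bound[OF v w pos near sl])
      also have "\<dots> \<le> L2norm (\<lambda>x. f (radial x0 x)) * L2norm ?w"
        using L2_Cauchy_Schwarz[OF test_L2 wL, of x0] by linarith
      also have "\<dots> \<le> sqrt (8 * pi * (d * (\<bar>dual d\<bar> + \<bar>d * dual' d\<bar>)\<^sup>2
          + (1 / (bF t_star)\<^sup>2 - ((d * dual' d)\<^sup>2 + d * (dual d)\<^sup>2)))) * L2norm ?w"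
        unfolding L2norm_def[of "\<lambda>x. f (radial x0 x)"] using test_square_integral[of x0]
        by (intro mult_right_mono) auto
      also have "d * (\<bar>dual d\<bar> + \<bar>d * dual' d\<bar>)\<^sup>2 = (\<bar>sqrt d * dual d\<bar> + sqrt d * \<bar>d * dual' d\<bar>)\<^sup>2"
        unfolding sq(2)[symmetric] using d' by (simp add: abs_mult distrib_left)
      finally show ?thesis using d' by (simp add: sq abs_mult)
    qed
    then have "\<forall>\<^sub>F d in at_right 0. ?A e d \<le> sqrt (?B d) * L2norm ?w"
      using d0(1) t_star(2) r(1) by (intro eventually_at_right_0_I[of "min d0 (min t_star (r\<^sup>2 / 8))"]) auto
    with lA lB show ?thesis by (intro tendsto_le[OF _ lB lA]) auto
  qed
  have "8 * pi \<le> sqrt (8 * pi * B) * L2norm ?w"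
  proof (rule field_le_epsilon)
    fix e :: real assume "e > 0"
    then have "e / (4 * pi) > 0" by simp
    from main[OF this] have "4 * pi * (2 - e / (4 * pi)) \<le> sqrt (8 * pi * B) * L2norm ?w" .
    moreover have "4 * pi * (2 - e / (4 * pi)) = 8 * pi - e" by (simp add: field_simps)
    ultimately show "8 * pi \<le> sqrt (8 * pi * B) * L2norm ?w + e" by linarith
  qed
  then have "(8 * pi)\<^sup>2 \<le> (sqrt (8 * pi * B) * L2norm ?w)\<^sup>2" by (intro power_mono) auto
  also have "\<dots> = (8 * pi * B) * (L2norm ?w)\<^sup>2" using B by (simp add: power_mult_distrib)
  finally have "8 * pi \<le> B * (L2norm ?w)\<^sup>2" by (simp add: power2_eq_square mult.assoc)
  then show ?thesis unfolding b_star_eq B_def[symmetric] L2norm_power2 using B by (simp add: divide_le_eq mult.commute)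
qed

lemma energy_lower_bound:
  assumes m: "m \<in> admissible" and q: "degree_Q m \<noteq> 0"
  shows "energy (1/4) m \<ge> b_star / 2"
proof -
  obtain x0 where x0: "m x0 = - e3" using degree_eq_0_if_avoids_south_pole[OF m] q by blast
  have sph: "m x \<in> sphere 0 1" for x using m unfolding admissible_def by auto
  note comp = admissible_components[OF m, where k = 3]
  have neg: "has_weak_partial i (\<lambda>x. - u x) (\<lambda>x. - u' x)" if "has_weak_partial i u u'" for i :: 2 and u u' :: "real^2 \<Rightarrow> real"
    using has_weak_partial_inner[OF that, of "-1"] by simp
  have "b_star \<le> (LINT x|lborel. ((\<Sum>i\<in>UNIV. - weak_partial i (weak_partial i m) x $ 3) + 1/2 * (- (m x $ 3 - e3 $ 3)))\<^sup>2)"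
  proof (rule helmholtz_lower_bound[where ?v1.0 = "\<lambda>i x. - weak_partial i m x $ 3"])
    show "isCont (\<lambda>x. - (m x $ 3 - e3 $ 3)) x0"
      using uniformly_continuous_imp_continuous[OF admissible_component_uniformly_continuous[OF m, of 3]]
      by (auto simp: continuous_on_eq_continuous_at intro!: continuous_intros)
    show "0 \<le> - (m x $ 3 - e3 $ 3)" "- (m x $ 3 - e3 $ 3) \<le> 2" for x
      using sphere_abs_le[OF sph, of x 3] by auto
    show "- (m x0 $ 3 - e3 $ 3) = 2" using x0 by simp
  qed (intro in_L2_minus neg comp)+
  also have "\<dots> = (LINT x|lborel. (helmholtz m 3 x)\<^sup>2)"
  proof (rule Bochner_Integration.integral_cong[OF refl])
    fix x
    have "(\<Sum>i\<in>UNIV. - weak_partial i (weak_partial i m) x $ 3) + 1/2 * (- (m x $ 3 - e3 $ 3)) = - helmholtz m 3 x"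
      by (simp add: helmholtz_def weak_laplacian_def sum_negf field_simps)
    then show "((\<Sum>i\<in>UNIV. - weak_partial i (weak_partial i m) x $ 3) + 1/2 * (- (m x $ 3 - e3 $ 3)))\<^sup>2 = (helmholtz m 3 x)\<^sup>2"
      by simp
  qed
  \<comment> \<open>The nonnegative contributions of the first two components are discarded; the
    bound sees only m3.\<close>
  also have "\<dots> \<le> (\<Sum>k\<in>UNIV. LINT x|lborel. (helmholtz m k x)\<^sup>2)"
    by (rule member_le_sum) auto
  finally show ?thesis unfolding energy_quarter_eq[OF m] by simp
qed

section \<open>Compactly supported maps of class \<open>C\<^sup>2\<close>\<close>

definition has_partial :: "'n \<Rightarrow> (real^'n \<Rightarrow> 'b::real_normed_vector) \<Rightarrow> (real^'n \<Rightarrow> 'b) \<Rightarrow> bool" where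
  "has_partial i f g \<longleftrightarrow> (\<forall>x. ((\<lambda>t. f (x + t *\<^sub>R axis i 1)) has_vector_derivative g x) (at 0))"

lemma has_partial_line:
  assumes "has_partial i f g"
  shows "((\<lambda>t. f (x + t *\<^sub>R axis i 1)) has_vector_derivative g (x + t *\<^sub>R axis i 1)) (at t)"
proof -
  have "((\<lambda>s. s - t) has_vector_derivative 1) (at t)" by (auto intro!: derivative_eq_intros)
  moreover have "((\<lambda>s. f (x + t *\<^sub>R axis i 1 + s *\<^sub>R axis i 1)) has_vector_derivative g (x + t *\<^sub>R axis i 1)) (at (t - t))"
    using assms unfolding has_partial_def by simp
  ultimately have "((\<lambda>s. f (x + t *\<^sub>R axis i 1 + s *\<^sub>R axis i 1)) \<circ> (\<lambda>s. s - t) has_vector_derivative 1 *\<^sub>R g (x + t *\<^sub>R axis i 1)) (at t)"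
    by (rule vector_diff_chain_at)
  moreover have "(\<lambda>s. f (x + t *\<^sub>R axis i 1 + s *\<^sub>R axis i 1)) \<circ> (\<lambda>s. s - t) = (\<lambda>s. f (x + s *\<^sub>R axis i 1))"
    by (auto simp: fun_eq_iff algebra_simps)
  ultimately show ?thesis by simp
qed

lemma has_partial_eq: "has_partial i f g \<Longrightarrow> (\<And>x. g x = g' x) \<Longrightarrow> has_partial i f g'"
  unfolding has_partial_def by simp

lemma has_partial_const: "has_partial i (\<lambda>x. c) (\<lambda>x. 0)"
  unfolding has_partial_def by simp

lemma has_partial_nth: "has_partial i (\<lambda>x. x $ j) (\<lambda>x. if i = j then 1 else 0 :: real)"
  unfolding has_partial_def has_real_derivative_iff_has_vector_derivative[symmetric]
  by (auto intro!: derivative_eq_intros simp: axis_def)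

lemma has_partial_add: "has_partial i f f' \<Longrightarrow> has_partial i g g' \<Longrightarrow> has_partial i (\<lambda>x. f x + g x) (\<lambda>x. f' x + g' x)"
  unfolding has_partial_def by (auto intro: has_vector_derivative_add)

lemma has_partial_scaleR: "has_partial i f f' \<Longrightarrow> has_partial i (\<lambda>x. f x *\<^sub>R v) (\<lambda>x. f' x *\<^sub>R v)" for f :: "real^'n \<Rightarrow> real"
  unfolding has_partial_def by (auto intro: bounded_linear.has_vector_derivative[OF bounded_linear_scaleR_left])

lemma has_partial_mult:
  fixes f g :: "real^'n \<Rightarrow> real"
  assumes "has_partial i f f'" "has_partial i g g'"
  shows "has_partial i (\<lambda>x. f x * g x) (\<lambda>x. f' x * g x + f x * g' x)"
  using assms unfolding has_partial_def has_real_derivative_iff_has_vector_derivative[symmetric]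
  by (auto intro!: derivative_eq_intros)

lemma has_partial_chain:
  fixes f :: "real^'n \<Rightarrow> real"
  assumes G: "\<And>y. (G has_real_derivative G' y) (at y)" and f: "has_partial i f f'"
  shows "has_partial i (\<lambda>x. G (f x)) (\<lambda>x. G' (f x) * f' x)"
  unfolding has_partial_def has_real_derivative_iff_has_vector_derivative[symmetric]
proof
  fix x
  have "((\<lambda>t. f (x + t *\<^sub>R axis i 1)) has_real_derivative f' x) (at 0)"
    using f unfolding has_partial_def has_real_derivative_iff_has_vector_derivative[symmetric] by blast
  from DERIV_chain2[OF G this]
  show "((\<lambda>t. G (f (x + t *\<^sub>R axis i 1))) has_real_derivative G' (f x) * f' x) (at 0)" by simp
qed

lemma has_partial_translate:
  assumes p: "has_partial i f g" shows "has_partial i (\<lambda>x. f (x + a)) (\<lambda>x. g (x + a))"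
  unfolding has_partial_def
proof
  fix x
  have "((\<lambda>t. f (x + a + t *\<^sub>R axis i 1)) has_vector_derivative g (x + a)) (at 0)"
    using p unfolding has_partial_def by blast
  moreover have "x + t *\<^sub>R axis i 1 + a = x + a + t *\<^sub>R axis i 1" for t by (simp add: algebra_simps)
  ultimately show "((\<lambda>t. f (x + t *\<^sub>R axis i 1 + a)) has_vector_derivative g (x + a)) (at 0)" by (simp only:)
qed

lemma has_partial_support:
  assumes p: "has_partial i f g" and z: "\<And>x. norm x > R \<Longrightarrow> f x = c" and x: "norm x > R"
  shows "g x = 0"
proof -
  have "((\<lambda>t. c) has_vector_derivative g x) (at 0)"
  proof (rule has_vector_derivative_transform_within_open)
    show "((\<lambda>t. f (x + t *\<^sub>R axis i 1)) has_vector_derivative g x) (at 0)" using p unfolding has_partial_def by blast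
    show "open {t. norm (x + t *\<^sub>R axis i 1) > R}" by (intro open_Collect_less continuous_intros)
    show "(0::real) \<in> {t. norm (x + t *\<^sub>R axis i 1) > R}" using x by simp
  qed (use z in auto)
  from vector_derivative_unique_at[OF this has_vector_derivative_const] show ?thesis by simp
qed

lemma bounded_of_compact_support:
  fixes f :: "real^'n \<Rightarrow> 'b::euclidean_space"
  assumes c: "continuous_on UNIV f" and z: "\<And>x. norm x > R \<Longrightarrow> f x = 0"
  obtains B where "B \<ge> 0" "\<And>x. norm (f x) \<le> B"
proof -
  have "bounded (f ` cball 0 R)"
    by (intro compact_imp_bounded compact_continuous_image continuous_on_subset[OF c]) auto
  then obtain B where B: "B > 0" "\<And>y. y \<in> f ` cball 0 R \<Longrightarrow> norm y \<le> B" unfolding bounded_pos by blast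
  have "norm (f x) \<le> B" for x using B z[of x] by (cases "norm x > R") auto
  then show ?thesis using B by (intro that[of B]) auto
qed

lemma in_L2_compact_support:
  fixes f :: "real^'n \<Rightarrow> 'b::euclidean_space"
  assumes c: "continuous_on UNIV f" and z: "\<And>x. norm x > R \<Longrightarrow> f x = 0"
  shows "in_L2 f"
proof -
  obtain B where B: "B \<ge> 0" "\<And>x. norm (f x) \<le> B" using bounded_of_compact_support[OF c z] by blast
  have m: "f \<in> borel_measurable borel" by (rule borel_measurable_continuous_onI[OF c])
  have "in_L2 (\<lambda>x. norm (f x))"
    by (rule in_L2_bounded_support[where R = R and B = B]) (use m B z in auto)
  then show ?thesis using m by (simp add: in_L2_def)
qed

lemma has_weak_partial_classical:
  fixes f g :: "real^'n \<Rightarrow> 'b::euclidean_space"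
  assumes p: "has_partial i f g" and c: "continuous_on UNIV f" "continuous_on UNIV g"
    and z: "\<And>x. norm x > R \<Longrightarrow> f x = 0"
  shows "has_weak_partial i f g"
proof -
  obtain B where B: "\<And>x. norm (f x) \<le> B" using bounded_of_compact_support[OF c(1) z] by blast
  have gz: "norm x > R \<Longrightarrow> g x = 0" for x by (rule has_partial_support[OF p z])
  obtain L where L: "\<And>x. norm (g x) \<le> L" using bounded_of_compact_support[OF c(2) gz] by blast
  show ?thesis
  proof (rule weak_partialI[OF _ _ B])
    show "norm (f (x + t *\<^sub>R axis i 1) - f x) \<le> L * \<bar>t\<bar>" for x t
      using lipschitz_of_line_derivative[OF has_partial_line[OF p] L, where t = t and s = 0, of x] by simp
    show "AE x in lborel. ((\<lambda>t. f (x + t *\<^sub>R axis i 1)) has_vector_derivative g x) (at 0)"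
      using p unfolding has_partial_def by simp
    show "locally_integrable g" by (rule in_L2_locally_integrable[OF in_L2_compact_support[OF c(2) gz]])
  qed (rule borel_measurable_continuous_onI[OF c(1)])
qed

text \<open>The classical derivatives are parameters of the locale: D i is the partial derivative in
  direction i, and DD i j is that of D j. Energy, degree and norms are then computed from continuous
  functions instead of the representatives chosen by \<open>weak_partial\<close>.\<close>

locale compact_map =
  fixes m :: "real^2 \<Rightarrow> real^3" and D :: "2 \<Rightarrow> real^2 \<Rightarrow> real^3" and DD :: "2 \<Rightarrow> 2 \<Rightarrow> real^2 \<Rightarrow> real^3" and R :: real
  assumes sph: "\<And>x. m x \<in> sphere 0 1" and supp: "\<And>x. norm x > R \<Longrightarrow> m x = e3"
    and cont: "continuous_on UNIV m" "\<And>i. continuous_on UNIV (D i)" "\<And>i j. continuous_on UNIV (DD i j)"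
    and D: "\<And>i. has_partial i m (D i)" and DD: "\<And>i j. has_partial i (D j) (DD i j)"
begin

lemma D_supp: "norm x > R \<Longrightarrow> D i x = 0"
  by (rule has_partial_support[OF D supp])

lemma DD_supp: "norm x > R \<Longrightarrow> DD i j x = 0"
  by (rule has_partial_support[OF DD D_supp])

lemma u_D: "has_partial i (\<lambda>x. m x - e3) (D i)"
  using has_partial_add[OF D has_partial_const[of _ "- e3"]] by simp

lemma weak: "has_weak_partial i (\<lambda>x. m x - e3) (D i)" "has_weak_partial j (D i) (DD j i)"
proof -
  show "has_weak_partial i (\<lambda>x. m x - e3) (D i)"
    by (rule has_weak_partial_classical[OF u_D _ cont(2), of R]) (auto intro!: continuous_intros cont simp: supp)
  show "has_weak_partial j (D i) (DD j i)"
    by (rule has_weak_partial_classical[OF DD cont(2,3) D_supp])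
qed

lemma L2: "in_L2 (\<lambda>x. m x - e3)" "in_L2 (D i)" "in_L2 (DD i j)"
  by (rule in_L2_compact_support[of _ R]; auto intro!: continuous_intros cont simp: supp D_supp DD_supp)+

lemma AE_weak:
  "AE x in lborel. weak_partial i (\<lambda>x. m x - e3) x = D i x"
  "AE x in lborel. weak_partial j (weak_partial i (\<lambda>x. m x - e3)) x = DD j i x"
  "AE x in lborel. weak_partial i m x = D i x"
  "AE x in lborel. weak_partial j (weak_partial i m) x = DD j i x"
  using shifted_weak_partials(2,4)[OF weak(1)[of i] weak(2)[of j i], of 0]
    shifted_weak_partials(2,4)[OF weak(1)[of i] weak(2)[of j i], of e3] by simp_all

lemma in_H2: "in_H2 (\<lambda>x. m x - e3)"
proof -
  note s = shifted_weak_partials[OF weak(1) weak(2), where c = 0, simplified]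
  have f: "AE x in lborel. P x = (Q x :: real^3)" if "AE x in lborel. Q x = P x" for P Q :: "real^2 \<Rightarrow> real^3"
    using that by eventually_elim simp
  show ?thesis unfolding in_H2_def weakly_differentiable_def
    using L2(1) s(1,3) in_L2_cong_AE[OF L2(2) has_weak_partial_measurable(2)[OF s(1)] f[OF AE_weak(1)]]
      in_L2_cong_AE[OF L2(3) has_weak_partial_measurable(2)[OF s(3)] f[OF AE_weak(2)]] by blast
qed

lemma admissible: "m \<in> admissible"
proof -
  have ev: "\<forall>\<^sub>F x in at_infinity. m x = e3"
    unfolding eventually_at_infinity by (rule exI[of _ "R + 1"]) (auto intro: supp)
  have lim: "(m \<longlongrightarrow> e3) at_infinity" by (rule tendsto_eventually[OF ev])
  have "uniformly_continuous_on UNIV m"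
    unfolding uniformly_continuous_on_def
  proof (intro allI impI)
    fix e :: real assume e: "e > 0"
    have "uniformly_continuous_on (cball 0 (R + 1)) m"
      by (intro compact_uniformly_continuous continuous_on_subset[OF cont(1)]) auto
    then obtain d where d: "d > 0" "\<And>x y. norm x \<le> R + 1 \<Longrightarrow> norm y \<le> R + 1 \<Longrightarrow> dist y x < d \<Longrightarrow> dist (m y) (m x) < e"
      unfolding uniformly_continuous_on_def using e by (metis mem_cball_0)
    have "dist (m y) (m x) < e" if "dist y x < min d 1" for x y
    proof (cases "norm x \<le> R + 1 \<and> norm y \<le> R + 1")
      case False
      have "norm y \<le> norm x + dist y x" "norm x \<le> norm y + dist y x"
        using norm_triangle_sub[of y x] norm_triangle_sub[of x y] by (auto simp: dist_norm norm_minus_commute)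
      then have "norm x > R" "norm y > R" using False that by auto
      then show ?thesis using e by (simp add: supp)
    qed (use d that in auto)
    then show "\<exists>d>0. \<forall>x\<in>UNIV. \<forall>y\<in>UNIV. dist y x < d \<longrightarrow> dist (m y) (m x) < e"
      using d(1) by (intro exI[of _ "min d 1"]) auto
  qed
  then show ?thesis unfolding admissible_def using sph in_H2 lim by blast
qed

lemma AE_all:
  "AE x in lborel. grad_sq m x = (\<Sum>i\<in>UNIV. (norm (D i x))\<^sup>2) \<and>
     hess_sq m x = (\<Sum>i\<in>UNIV. \<Sum>j\<in>UNIV. (norm (DD i j x))\<^sup>2) \<and>
     grad_sq (\<lambda>x. m x - e3) x = (\<Sum>i\<in>UNIV. (norm (D i x))\<^sup>2) \<and>
     hess_sq (\<lambda>x. m x - e3) x = (\<Sum>i\<in>UNIV. \<Sum>j\<in>UNIV. (norm (DD i j x))\<^sup>2) \<and>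
     weak_laplacian m x = (\<Sum>i\<in>UNIV. DD i i x) \<and>
     (\<forall>i. weak_partial i m x = D i x)"
proof -
  have fin: "AE x in lborel. \<forall>i::2. P i x" if "\<And>i. AE x in lborel. P i x" for P :: "2 \<Rightarrow> real^2 \<Rightarrow> bool"
    using that by (simp add: AE_all_countable)
  have "AE x in lborel. \<forall>i. weak_partial i m x = D i x" by (intro fin AE_weak)
  moreover have "AE x in lborel. \<forall>j. weak_partial j (\<lambda>x. m x - e3) x = D j x" by (intro fin AE_weak)
  moreover have "AE x in lborel. \<forall>i. \<forall>j. weak_partial i (weak_partial j m) x = DD i j x" by (intro fin AE_weak)
  moreover have "AE x in lborel. \<forall>i. \<forall>j. weak_partial i (weak_partial j (\<lambda>x. m x - e3)) x = DD i j x" by (intro fin AE_weak)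
  ultimately show ?thesis
    by eventually_elim (simp add: grad_sq_def hess_sq_def weak_laplacian_def)
qed

definition energy_density where
  "energy_density H x = - (1/2) * (\<Sum>i\<in>UNIV. (norm (D i x))\<^sup>2) + 1/2 * (norm (\<Sum>i\<in>UNIV. DD i i x))\<^sup>2 + H * (1 - m x $ 3)"

definition sobolev_density where
  "sobolev_density x = (norm (m x - e3))\<^sup>2 + (\<Sum>i\<in>UNIV. (norm (D i x))\<^sup>2) + (\<Sum>i\<in>UNIV. \<Sum>j\<in>UNIV. (norm (DD i j x))\<^sup>2)"

lemma meas [measurable]: "m \<in> borel_measurable borel" "D i \<in> borel_measurable borel" "DD i j \<in> borel_measurable borel"
  by (auto intro!: borel_measurable_continuous_onI cont)

lemma continuous_nth: "continuous_on UNIV (\<lambda>x. m x $ k)"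
  by (intro continuous_intros cont)

lemma integrable_compact:
  fixes f :: "real^2 \<Rightarrow> real"
  assumes "continuous_on UNIV f" "\<And>x. norm x > R \<Longrightarrow> f x = 0"
  shows "integrable lborel f"
proof -
  obtain B where "\<And>x. norm (f x) \<le> B" using bounded_of_compact_support[OF assms] by blast
  moreover have "integrable lborel (\<lambda>x::real^2. 1 * (B * indicator (cball 0 R) x))"
    using emeasure_compact_finite[OF compact_cball, of 0 R] by (intro integrable_mult_right integrable_real_indicator) auto
  ultimately show ?thesis
    by (intro Bochner_Integration.integrable_bound[of lborel "\<lambda>x::real^2. B * indicator (cball 0 R) x" f])
      (use assms in \<open>auto intro!: borel_measurable_continuous_onI simp: indicator_def intro: order_trans[OF _ abs_ge_self]\<close>)
qed

lemma integrable_energy_density: "integrable lborel (energy_density H)"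
  unfolding energy_density_def[abs_def]
  by (rule integrable_compact) (auto intro!: continuous_intros cont continuous_nth simp: supp D_supp DD_supp)

lemma continuous_cross: "continuous_on UNIV (\<lambda>x. m x \<bullet> cross3 (D 1 x) (D 2 x))"
  by (intro continuous_intros cont continuous_on_cross)

lemma integrable_degree: "integrable lborel (\<lambda>x. m x \<bullet> cross3 (D 1 x) (D 2 x))"
  by (rule integrable_compact[OF continuous_cross]) (simp add: D_supp cross3_def)

lemma integrable_sobolev_density: "integrable lborel sobolev_density"
  unfolding sobolev_density_def[abs_def]
  by (rule integrable_compact) (auto intro!: continuous_intros cont simp: supp D_supp DD_supp)

lemma energy_eq: "energy H m = (LINT x|lborel. energy_density H x)"
proof -
  have a: "AE x in lborel. - (1/2) * grad_sq m x + 1/2 * (norm (weak_laplacian m x))\<^sup>2 + H * (1 - m x $ 3) = energy_density H x"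
    using AE_all by eventually_elim (simp add: energy_density_def)
  have "(\<lambda>x. - (1/2) * grad_sq m x + 1/2 * (norm (weak_laplacian m x))\<^sup>2 + H * (1 - m x $ 3)) \<in> borel_measurable lborel"
    using integrable_energy_terms[OF admissible] admissible_component_measurable[OF admissible, of 3] by auto
  from integral_cong_AE[OF this _ a] integrable_energy_density show ?thesis unfolding energy_def by auto
qed

lemma degree_eq: "degree_Q m = 1 / (4 * pi) * (LINT x|lborel. m x \<bullet> cross3 (D 1 x) (D 2 x))"
proof -
  have a: "AE x in lborel. m x \<bullet> cross3 (weak_partial 1 m x) (weak_partial 2 m x) = m x \<bullet> cross3 (D 1 x) (D 2 x)"
    using AE_all by eventually_elim simp
  note [measurable] = admissible_component_measurable[OF admissible]
    in_L2_measurable[OF admissible_components(3)[OF admissible]]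
  have "(\<lambda>x. m x \<bullet> cross3 (weak_partial 1 m x) (weak_partial 2 m x)) \<in> borel_measurable lborel"
    unfolding cross3_def inner_vec_def by (simp add: sum_3)
  from integral_cong_AE[OF this _ a] integrable_degree show ?thesis unfolding degree_Q_def by auto
qed

lemma sobolev_eq:
  "H2_norm (\<lambda>x. m x - e3) = sqrt (LINT x|lborel. sobolev_density x)"
  "(LINT x:ball y A|lborel. (norm (m x - e3))\<^sup>2 + grad_sq m x + hess_sq m x) = (LINT x:ball y A|lborel. sobolev_density x)"
proof -
  have i: "integrable lborel (\<lambda>x. (norm (f x))\<^sup>2)" if "in_L2 f" for f :: "real^2 \<Rightarrow> real^3" using that unfolding in_L2_def by auto
  note H = in_H2D[OF in_H2]
  note W = admissible_weak_partials[OF admissible]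
  have [measurable]: "(\<lambda>x. grad_sq (\<lambda>x. m x - e3) x) \<in> borel_measurable lborel" "(\<lambda>x. hess_sq (\<lambda>x. m x - e3) x) \<in> borel_measurable lborel"
    "(\<lambda>x. grad_sq m x) \<in> borel_measurable lborel" "(\<lambda>x. hess_sq m x) \<in> borel_measurable lborel"
    unfolding grad_sq_def hess_sq_def using i[OF H(3)] i[OF H(5)] i[OF W(3)] i[OF W(5)]
    by (auto intro!: borel_measurable_sum dest: borel_measurable_integrable)
  have [measurable]: "sobolev_density \<in> borel_measurable lborel" using integrable_sobolev_density by auto
  have "(LINT x|lborel. (norm (m x - e3))\<^sup>2 + grad_sq (\<lambda>x. m x - e3) x + hess_sq (\<lambda>x. m x - e3) x) = (LINT x|lborel. sobolev_density x)"
  proof (rule integral_cong_AE)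
    show "AE x in lborel. (norm (m x - e3))\<^sup>2 + grad_sq (\<lambda>x. m x - e3) x + hess_sq (\<lambda>x. m x - e3) x = sobolev_density x"
      using AE_all by eventually_elim (simp add: sobolev_density_def)
  qed measurable
  then show "H2_norm (\<lambda>x. m x - e3) = sqrt (LINT x|lborel. sobolev_density x)" unfolding H2_norm_def by simp
  show "(LINT x:ball y A|lborel. (norm (m x - e3))\<^sup>2 + grad_sq m x + hess_sq m x) = (LINT x:ball y A|lborel. sobolev_density x)"
    unfolding set_lebesgue_integral_def
  proof (rule integral_cong_AE)
    have [measurable]: "ball y A \<in> sets borel" by simp
    show "AE x in lborel. indicator (ball y A) x *\<^sub>R ((norm (m x - e3))\<^sup>2 + grad_sq m x + hess_sq m x)
      = indicator (ball y A) x *\<^sub>R sobolev_density x"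
      using AE_all by eventually_elim (simp add: sobolev_density_def)
    show "(\<lambda>x. indicator (ball y A) x *\<^sub>R ((norm (m x - e3))\<^sup>2 + grad_sq m x + hess_sq m x)) \<in> borel_measurable lborel"
      "(\<lambda>x. indicator (ball y A) x *\<^sub>R sobolev_density x) \<in> borel_measurable lborel"
      by measurable
  qed
qed

lemma translate: "compact_map (\<lambda>x. m (x + a)) (\<lambda>i x. D i (x + a)) (\<lambda>i j x. DD i j (x + a)) (R + norm a)"
proof
  have c: "continuous_on UNIV (\<lambda>x. f (x + a))" if "continuous_on UNIV f" for f :: "real^2 \<Rightarrow> real^3"
    by (rule continuous_on_compose2[OF that]) (auto intro!: continuous_intros)
  show "continuous_on UNIV (\<lambda>x. m (x + a))" "continuous_on UNIV (\<lambda>x. D i (x + a))" "continuous_on UNIV (\<lambda>x. DD i j (x + a))" for i j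
    by (intro c cont)+
  show "m (x + a) = e3" if "norm x > R + norm a" for x
    by (rule supp) (use that norm_diff_ineq[of x a] in linarith)
qed (auto simp: sph[unfolded mem_sphere_0, simplified] sph D DD intro!: has_partial_translate)

end

text \<open>The second map is translated until the sets where the maps differ from e3 are disjoint.
  At every point one of the two maps is then locally constant, so the sum m + (n - e3) stays on the
  sphere and all densities add up.\<close>

lemma compact_map_glue:
  assumes m: "compact_map m D DD R" and n: "compact_map n D' DD' R'"
  shows "\<exists>p E EE S. compact_map p E EE S \<and> degree_Q p = degree_Q m + degree_Q n \<and> (\<forall>H. energy H p = energy H m + energy H n)"
proof -
  define a :: "real^2" where "a = (\<bar>R\<bar> + \<bar>R'\<bar> + 1) *\<^sub>R axis 1 1"
  have na: "norm a = \<bar>R\<bar> + \<bar>R'\<bar> + 1" unfolding a_def by (simp add: norm_axis_1)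
  interpret m: compact_map m D DD R by (rule m)
  interpret n: compact_map n D' DD' R' by (rule n)
  interpret t: compact_map "\<lambda>x. n (x + a)" "\<lambda>i x. D' i (x + a)" "\<lambda>i j x. DD' i j (x + a)" "R' + norm a" by (rule n.translate)
  have far: "norm x > R \<or> norm (x + a) > R'" for x
    using norm_diff_ineq[of a x] na by (simp add: add.commute) linarith
  define p where "p x = m x + (n (x + a) - e3)" for x
  have "compact_map p (\<lambda>i x. D i x + D' i (x + a)) (\<lambda>i j x. DD i j x + DD' i j (x + a)) (\<bar>R\<bar> + \<bar>R' + norm a\<bar>)"
  proof
    show "p x \<in> sphere 0 1" for x
      using far[of x] m.sph[of x] n.sph[of "x + a"] m.supp[of x] n.supp[of "x + a"] unfolding p_def by auto
    show "p x = e3" if "norm x > \<bar>R\<bar> + \<bar>R' + norm a\<bar>" for x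
      using m.supp[of x] t.supp[of x] that unfolding p_def by auto
    show "has_partial i p (\<lambda>x. D i x + D' i (x + a))" for i
      unfolding p_def[abs_def] by (intro has_partial_add m.D t.u_D)
  qed (auto simp: p_def intro!: continuous_intros m.cont t.cont has_partial_add m.DD t.DD)
  then interpret p: compact_map p "\<lambda>i x. D i x + D' i (x + a)" "\<lambda>i j x. DD i j x + DD' i j (x + a)" "\<bar>R\<bar> + \<bar>R' + norm a\<bar>" .
  have e: "p.energy_density H x = m.energy_density H x + n.energy_density H (x + a)" for H x
    using far[of x]
    by (auto simp: p.energy_density_def m.energy_density_def n.energy_density_def p_def
        m.supp m.D_supp m.DD_supp n.supp n.D_supp n.DD_supp)
  have q: "p x \<bullet> cross3 (D 1 x + D' 1 (x + a)) (D 2 x + D' 2 (x + a)) = m x \<bullet> cross3 (D 1 x) (D 2 x) + n (x + a) \<bullet> cross3 (D' 1 (x + a)) (D' 2 (x + a))" for x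
    using far[of x] by (auto simp: p_def m.supp m.D_supp n.supp n.D_supp)
  have "energy H p = energy H m + energy H n" for H
  proof -
    have i: "integrable lborel (\<lambda>x. n.energy_density H (x + a))" "(LINT x|lborel. n.energy_density H (x + a)) = (LINT x|lborel. n.energy_density H x)"
      using integral_translate[of "n.energy_density H" a] n.integrable_energy_density[of H] by auto
    show ?thesis unfolding p.energy_eq m.energy_eq n.energy_eq e using i m.integrable_energy_density by simp
  qed
  moreover have "degree_Q p = degree_Q m + degree_Q n"
  proof -
    let ?q = "\<lambda>x. n x \<bullet> cross3 (D' 1 x) (D' 2 x)"
    have i: "integrable lborel (\<lambda>x. ?q (x + a))" "(LINT x|lborel. ?q (x + a)) = (LINT x|lborel. ?q x)"
      using integral_translate[of ?q a] n.integrable_degree by auto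
    show ?thesis unfolding p.degree_eq m.degree_eq n.degree_eq q using i m.integrable_degree
      by (simp add: distrib_left)
  qed
  ultimately show ?thesis using p.compact_map_axioms by blast
qed

section \<open>An explicit map of degree plus or minus one\<close>

definition vec3 :: "real \<Rightarrow> real \<Rightarrow> real \<Rightarrow> real^3" where
  "vec3 a b c = a *\<^sub>R axis 1 1 + b *\<^sub>R axis 2 1 + c *\<^sub>R axis 3 1"

lemma vec3_nth [simp]: "vec3 a b c $ 1 = a" "vec3 a b c $ 2 = b" "vec3 a b c $ 3 = c"
  by (simp_all add: vec3_def axis_def)

lemma norm_vec3: "(norm (vec3 a b c))\<^sup>2 = a\<^sup>2 + b\<^sup>2 + c\<^sup>2"
  by (simp add: norm_power2_cart sum_3)

lemma vec3_eq_iff: "(x :: real^3) = y \<longleftrightarrow> x $ 1 = y $ 1 \<and> x $ 2 = y $ 2 \<and> x $ 3 = y $ 3"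
  by (simp add: vec_eq_iff forall_3)

lemma has_partial_vec3:
  assumes "has_partial i f f'" "has_partial i g g'" "has_partial i h h'"
  shows "has_partial i (\<lambda>x. vec3 (f x) (g x) (h x)) (\<lambda>x. vec3 (f' x) (g' x) (h' x))"
  unfolding vec3_def by (intro has_partial_add has_partial_scaleR assms)

lemma continuous_on_vec3:
  "continuous_on S f \<Longrightarrow> continuous_on S g \<Longrightarrow> continuous_on S h \<Longrightarrow> continuous_on S (\<lambda>x. vec3 (f x) (g x) (h x))"
  unfolding vec3_def by (intro continuous_intros)

definition sq :: "real^2 \<Rightarrow> real" where
  "sq x = (x $ 1)\<^sup>2 + (x $ 2)\<^sup>2"

lemma sq_eq: "sq x = (norm x)\<^sup>2"
  by (simp add: sq_def norm_power2_cart sum_2)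

lemma has_partial_sq: "has_partial i sq (\<lambda>x. 2 * x $ i)"
proof -
  have "has_partial i (\<lambda>x. x $ 1 * x $ 1 + x $ 2 * x $ 2)
    (\<lambda>x. ((if i = 1 then 1 else 0) * x $ 1 + x $ 1 * (if i = 1 then 1 else 0))
      + ((if i = 2 then 1 else 0) * x $ 2 + x $ 2 * (if i = 2 then 1 else 0)))"
    by (intro has_partial_add has_partial_mult has_partial_nth)
  then show ?thesis
    using exhaust_2[of i] by (auto simp: sq_def[abs_def] power2_eq_square elim!: has_partial_eq)
qed

lemma continuous_sq: "continuous_on S sq"
  unfolding sq_def[abs_def] by (intro continuous_intros)

text \<open>The cube of the positive part is twice continuously differentiable, the regularity that
  \<open>compact_map\<close> asks for.\<close>

definition trunc_power :: "nat \<Rightarrow> real \<Rightarrow> real" where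
  "trunc_power n y = (max y 0) ^ n"

lemma trunc_power_deriv:
  assumes n: "n \<ge> 2"
  shows "(trunc_power n has_real_derivative real n * trunc_power (n - 1) y) (at y)"
proof -
  consider "y > 0" | "y < 0" | "y = 0" by linarith
  then show ?thesis
  proof cases
    case 1
    have "((\<lambda>y. y ^ n) has_real_derivative real n * trunc_power (n - 1) y) (at y)"
      using 1 by (auto intro!: derivative_eq_intros simp: trunc_power_def)
    then show ?thesis by (rule has_derivative_cong_open[of _ _ _ "{0<..}"]) (use 1 in \<open>auto simp: trunc_power_def\<close>)
  next
    case 2
    have "((\<lambda>y. 0) has_real_derivative real n * trunc_power (n - 1) y) (at y)"
      using 2 n by (simp add: trunc_power_def zero_power)
    then show ?thesis by (rule has_derivative_cong_open[of _ _ _ "{..<0}"]) (use 2 n in \<open>auto simp: trunc_power_def zero_power\<close>)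
  next
    case 3
    have "((\<lambda>h. trunc_power n h / h) \<longlongrightarrow> 0) (at 0)"
    proof (rule Lim_null_comparison)
      show "((\<lambda>h. \<bar>h\<bar> ^ (n - 1)) \<longlongrightarrow> 0) (at (0::real))" using n by (auto intro!: tendsto_eq_intros simp: zero_power)
      show "\<forall>\<^sub>F h in at 0. norm (trunc_power n h / h) \<le> \<bar>h\<bar> ^ (n - 1)"
      proof (intro eventually_at_filter[THEN iffD2] always_eventually allI impI)
        fix h :: real assume h: "h \<noteq> 0"
        have "\<bar>trunc_power n h\<bar> \<le> \<bar>h\<bar> ^ n" unfolding trunc_power_def power_abs by (intro power_mono) auto
        also have "\<dots> = \<bar>h\<bar> ^ (n - 1) * \<bar>h\<bar>" using n by (metis Suc_diff_1 less_le_trans pos2 power_Suc2)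
        finally show "norm (trunc_power n h / h) \<le> \<bar>h\<bar> ^ (n - 1)" using h by (simp add: abs_divide divide_le_eq)
      qed
    qed
    then show ?thesis using 3 n by (simp add: DERIV_def trunc_power_def zero_power)
  qed
qed

lemma trunc_power_continuous: "continuous_on S f \<Longrightarrow> continuous_on S (\<lambda>x. trunc_power n (f x))"
  unfolding trunc_power_def by (intro continuous_intros)

lemma trunc_power_zero: "y \<le> 0 \<Longrightarrow> n > 0 \<Longrightarrow> trunc_power n y = 0"
  by (simp add: trunc_power_def max_def zero_power)

text \<open>The basic map of degree \<open>\<plusminus>1\<close>: the inverse stereographic projection of \<open>x / (1 - |x|\<^sup>2)\<^sup>3\<close>.\<close>

definition sB :: "real \<Rightarrow> real" where "sB s = trunc_power 3 (1 - s)"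
definition sB' :: "real \<Rightarrow> real" where "sB' s = - 3 * trunc_power 2 (1 - s)"
definition sB'' :: "real \<Rightarrow> real" where "sB'' s = 6 * trunc_power 1 (1 - s)"
text \<open>Numerator of the derivative of sB / (s + sB^2).\<close>

definition sN :: "real \<Rightarrow> real" where "sN s = sB' s * (s + (sB s)\<^sup>2) - sB s * (1 + 2 * sB s * sB' s)"
definition sN' :: "real \<Rightarrow> real" where
  "sN' s = sB'' s * (s + (sB s)\<^sup>2) - sB s * (2 * (sB' s)\<^sup>2 + 2 * sB s * sB'' s)"
text \<open>For z = x / sB(|x|^2) the horizontal part 2 z / (1 + |z|^2) of the inverse stereographic
  projection is sh(|x|^2) x. Clearing sB leaves a denominator that does not vanish where sB
  does.\<close>

definition sh :: "real \<Rightarrow> real" where "sh s = 2 * sB s / (s + (sB s)\<^sup>2)"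
definition sh' :: "real \<Rightarrow> real" where "sh' s = 2 * sN s / (s + (sB s)\<^sup>2)\<^sup>2"
definition sh'' :: "real \<Rightarrow> real" where
  "sh'' s = 2 * (sN' s * (s + (sB s)\<^sup>2) - 2 * sN s * (1 + 2 * sB s * sB' s)) / (s + (sB s)\<^sup>2) ^ 3"
definition sc :: "real \<Rightarrow> real" where "sc s = 1 - sB s * sh s"
definition sc' :: "real \<Rightarrow> real" where "sc' s = - (sB' s * sh s + sB s * sh' s)"
definition sc'' :: "real \<Rightarrow> real" where "sc'' s = - (sB'' s * sh s + 2 * sB' s * sh' s + sB s * sh'' s)"

text \<open>Negative s are not values of \<open>sq\<close>, but positivity there makes the profiles
  differentiable on the whole line, as \<open>has_partial_chain\<close> asks.\<close>

lemma profile_denom_pos: "s + (sB s)\<^sup>2 > 0"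
proof -
  consider "s > 0" | "s = 0" | "s < 0" by linarith
  then show ?thesis
  proof cases
    case 3
    have "(1 - s) ^ 1 \<le> (1 - s) ^ 6" using 3 by (intro power_increasing) auto
    moreover have "(sB s)\<^sup>2 = (1 - s) ^ 6" using 3 by (simp add: sB_def trunc_power_def power_mult[symmetric])
    ultimately show ?thesis by simp
  qed (auto simp: sB_def trunc_power_def add_pos_nonneg)
qed

lemma profile_derivs:
  "(sB has_real_derivative sB' s) (at s)" "(sB' has_real_derivative sB'' s) (at s)"
  "(sh has_real_derivative sh' s) (at s)" "(sh' has_real_derivative sh'' s) (at s)"
  "(sc has_real_derivative sc' s) (at s)" "(sc' has_real_derivative sc'' s) (at s)"
proof -
  have l: "((\<lambda>s. 1 - s) has_real_derivative - 1) (at s)" by (auto intro!: derivative_eq_intros)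
  show B: "(sB has_real_derivative sB' s) (at s)" 
    using DERIV_chain2[OF trunc_power_deriv[of 3] l] by (simp add: sB_def[abs_def] sB'_def)
  show B': "(sB' has_real_derivative sB'' s) (at s)"
    using DERIV_cmult[OF DERIV_chain2[OF trunc_power_deriv[of 2] l], of "- 3"] by (simp add: sB'_def[abs_def] sB''_def)
  let ?D = "\<lambda>s. s + (sB s)\<^sup>2"
  have D: "(?D has_real_derivative 1 + 2 * sB s * sB' s) (at s)"
    by (auto intro!: derivative_eq_intros B)
  have p: "?D s \<noteq> 0" using profile_denom_pos[of s] by linarith
  have "(sh has_real_derivative (2 * sB' s * ?D s - 2 * sB s * (1 + 2 * sB s * sB' s)) / (?D s * ?D s)) (at s)"
    unfolding sh_def[abs_def] by (rule DERIV_divide[OF DERIV_cmult[OF B] D p])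
  also have "(2 * sB' s * ?D s - 2 * sB s * (1 + 2 * sB s * sB' s)) / (?D s * ?D s) = sh' s"
    unfolding sh'_def sN_def power2_eq_square[of "?D s"] by (simp add: algebra_simps)
  finally show h: "(sh has_real_derivative sh' s) (at s)" .
  have N: "(sN has_real_derivative sN' s) (at s)"
    unfolding sN_def[abs_def] sN'_def
    by (rule derivative_eq_intros refl B B' D)+ (simp add: power2_eq_square algebra_simps)
  have "(sh' has_real_derivative (2 * sN' s * (?D s)\<^sup>2 - 2 * sN s * (2 * ?D s * (1 + 2 * sB s * sB' s))) / ((?D s)\<^sup>2 * (?D s)\<^sup>2)) (at s)"
  proof -
    have "((\<lambda>s. (?D s)\<^sup>2) has_real_derivative 2 * ?D s * (1 + 2 * sB s * sB' s)) (at s)"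
      by (rule DERIV_cong[OF DERIV_power[OF D, of 2]]) (simp add: algebra_simps)
    moreover have "(?D s)\<^sup>2 \<noteq> 0" using p by simp
    ultimately show ?thesis
      unfolding sh'_def[abs_def] by (intro DERIV_cong[OF DERIV_divide[OF DERIV_cmult[OF N]]]) (auto simp: mult_ac)
  qed
  also have "(2 * sN' s * (?D s)\<^sup>2 - 2 * sN s * (2 * ?D s * (1 + 2 * sB s * sB' s))) / ((?D s)\<^sup>2 * (?D s)\<^sup>2) = sh'' s"
  proof -
    have "(2 * a * d\<^sup>2 - 2 * b * (2 * d * c)) / (d\<^sup>2 * d\<^sup>2) = 2 * (a * d - 2 * b * c) / d ^ 3" if "d \<noteq> 0" for a b c d :: real
      using that by (simp add: field_simps power2_eq_square power3_eq_cube)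
    from this[OF p] show ?thesis unfolding sh''_def .
  qed
  finally show h': "(sh' has_real_derivative sh'' s) (at s)" .
  show "(sc has_real_derivative sc' s) (at s)"
    unfolding sc_def[abs_def] sc'_def by (rule derivative_eq_intros refl B h)+ (simp add: algebra_simps)
  show "(sc' has_real_derivative sc'' s) (at s)"
    unfolding sc'_def[abs_def] sc''_def by (rule derivative_eq_intros refl B B' h h')+ (simp add: algebra_simps)
qed

lemma profile_continuous:
  "continuous_on S f \<Longrightarrow> continuous_on S (\<lambda>x. sh (f x))" "continuous_on S f \<Longrightarrow> continuous_on S (\<lambda>x. sh' (f x))"
  "continuous_on S f \<Longrightarrow> continuous_on S (\<lambda>x. sh'' (f x))" "continuous_on S f \<Longrightarrow> continuous_on S (\<lambda>x. sc (f x))"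
  "continuous_on S f \<Longrightarrow> continuous_on S (\<lambda>x. sc' (f x))" "continuous_on S f \<Longrightarrow> continuous_on S (\<lambda>x. sc'' (f x))"
proof -
  have p: "s + (sB s)\<^sup>2 \<noteq> 0" for s using profile_denom_pos[of s] by linarith
  have B: "continuous_on UNIV sB" "continuous_on UNIV sB'" "continuous_on UNIV sB''"
    unfolding sB_def[abs_def] sB'_def[abs_def] sB''_def[abs_def] by (intro continuous_intros trunc_power_continuous)+
  have N: "continuous_on UNIV sN" "continuous_on UNIV sN'"
    unfolding sN_def[abs_def] sN'_def[abs_def] by (intro continuous_intros B)+
  have h: "continuous_on UNIV sh" "continuous_on UNIV sh'" "continuous_on UNIV sh''"
    unfolding sh_def[abs_def] sh'_def[abs_def] sh''_def[abs_def] by (intro continuous_intros B N; simp add: p)+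
  have c: "continuous_on UNIV sc" "continuous_on UNIV sc'" "continuous_on UNIV sc''"
    unfolding sc_def[abs_def] sc'_def[abs_def] sc''_def[abs_def] by (intro continuous_intros B h)+
  have *: "continuous_on S (\<lambda>x. G (f x))" if "continuous_on UNIV G" "continuous_on S f" for G :: "real \<Rightarrow> real" and f
    by (rule continuous_on_compose2[OF that]) auto
  show "continuous_on S f \<Longrightarrow> continuous_on S (\<lambda>x. sh (f x))" "continuous_on S f \<Longrightarrow> continuous_on S (\<lambda>x. sh' (f x))"
    "continuous_on S f \<Longrightarrow> continuous_on S (\<lambda>x. sh'' (f x))" "continuous_on S f \<Longrightarrow> continuous_on S (\<lambda>x. sc (f x))"
    "continuous_on S f \<Longrightarrow> continuous_on S (\<lambda>x. sc' (f x))" "continuous_on S f \<Longrightarrow> continuous_on S (\<lambda>x. sc'' (f x))"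
    by (rule *[OF h(1)] *[OF h(2)] *[OF h(3)] *[OF c(1)] *[OF c(2)] *[OF c(3)]; assumption)+
qed

lemma profile_sphere: "(sh s)\<^sup>2 * s + (sc s)\<^sup>2 = 1"
proof -
  define d where "d = s + (sB s)\<^sup>2"
  have d: "d \<noteq> 0" using profile_denom_pos[of s] unfolding d_def by linarith
  have h: "sh s * d = 2 * sB s" unfolding sh_def d_def[symmetric] using d by simp
  have "((sh s)\<^sup>2 * s + (sc s)\<^sup>2 - 1) * d = (sh s * d) * (sh s * s - 2 * sB s + (sB s)\<^sup>2 * sh s)"
    unfolding sc_def by (simp add: power2_eq_square algebra_simps)
  also have "sh s * s - 2 * sB s + (sB s)\<^sup>2 * sh s = sh s * d - 2 * sB s" unfolding d_def by (simp add: algebra_simps)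
  finally have "((sh s)\<^sup>2 * s + (sc s)\<^sup>2 - 1) * d = 0" using h by simp
  then show ?thesis using d by simp
qed

lemma profile_sphere_deriv: "2 * sh s * sh' s * s + (sh s)\<^sup>2 = - 2 * sc s * sc' s"
proof -
  have "((\<lambda>s. (sh s)\<^sup>2 * s + (sc s)\<^sup>2) has_real_derivative 2 * sh s * sh' s * s + (sh s)\<^sup>2 + 2 * sc s * sc' s) (at s)"
    by (auto intro!: derivative_eq_intros profile_derivs)
  then have "((\<lambda>s. 1) has_real_derivative 2 * sh s * sh' s * s + (sh s)\<^sup>2 + 2 * sc s * sc' s) (at s)"
    unfolding profile_sphere .
  from DERIV_unique[OF this DERIV_const] show ?thesis by simp
qed

lemma profile_values: "s \<ge> 1 \<Longrightarrow> sh s = 0" "s \<ge> 1 \<Longrightarrow> sc s = 1" "s \<ge> 1 \<Longrightarrow> sc' s = 0" "sc 0 = - 1"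
  by (simp_all add: sh_def sc_def sc'_def sB_def sB'_def trunc_power_zero) (simp add: trunc_power_def)

text \<open>The degree density is the radial function - 2 sigma sc'(|x|^2), and sc runs from -1 at 0
  to 1 at 1; with |x|^2 = 8 t and area 8 pi dt its integral is - 4 pi sigma. The sign sigma reflects
  the second component and so reverses the orientation.\<close>

lemma unit_degree_map:
  assumes \<sigma>: "\<sigma>\<^sup>2 = (1 :: real)"
  shows "\<exists>m D DD R. compact_map m D DD R \<and> degree_Q m = - \<sigma>"
proof -
  let ?\<delta> = "\<lambda>i j :: 2. if i = j then 1 else (0 :: real)"
  define m where "m x = vec3 (sh (sq x) * x $ 1) (\<sigma> * (sh (sq x) * x $ 2)) (sc (sq x))" for x :: "real^2"
  define g where "g k i x = sh' (sq x) * (2 * x $ i) * x $ k + sh (sq x) * ?\<delta> i k" for k i and x :: "real^2"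
  define gg where "gg k j i x = (sh'' (sq x) * (2 * x $ j) * (2 * x $ i) + sh' (sq x) * (2 * ?\<delta> j i)) * x $ k
     + sh' (sq x) * (2 * x $ i) * ?\<delta> j k + sh' (sq x) * (2 * x $ j) * ?\<delta> i k" for k j i and x :: "real^2"
  define c where "c i x = sc' (sq x) * (2 * x $ i)" for i and x :: "real^2"
  define cc where "cc j i x = sc'' (sq x) * (2 * x $ j) * (2 * x $ i) + sc' (sq x) * (2 * ?\<delta> j i)" for j i and x :: "real^2"
  define D where "D i x = vec3 (g 1 i x) (\<sigma> * g 2 i x) (c i x)" for i x
  define DD where "DD j i x = vec3 (gg 1 j i x) (\<sigma> * gg 2 j i x) (cc j i x)" for j i x
  have two: "has_partial j (\<lambda>x::real^2. 2 * x $ i) (\<lambda>x. 2 * ?\<delta> j i)" for i j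
    using has_partial_mult[OF has_partial_const[of j 2] has_partial_nth[of j i]] by (simp add: eq_commute)
  have gp: "has_partial i (\<lambda>x. sh (sq x) * x $ k) (g k i)" for i k
    using has_partial_mult[OF has_partial_chain[OF profile_derivs(3) has_partial_sq] has_partial_nth[of i k]]
    by (rule has_partial_eq) (simp add: g_def)
  have ggp: "has_partial j (g k i) (gg k j i)" for i j k
  proof -
    have "has_partial j (\<lambda>x. sh' (sq x) * (2 * x $ i) * x $ k + sh (sq x) * ?\<delta> i k)
      (\<lambda>x. ((sh'' (sq x) * (2 * x $ j)) * (2 * x $ i) + sh' (sq x) * (2 * ?\<delta> j i)) * x $ k
        + (sh' (sq x) * (2 * x $ i)) * ?\<delta> j k + ((sh' (sq x) * (2 * x $ j)) * ?\<delta> i k + sh (sq x) * 0))"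
      by (intro has_partial_add has_partial_mult has_partial_chain profile_derivs has_partial_sq has_partial_nth two has_partial_const)
    then show ?thesis unfolding g_def[abs_def] by (rule has_partial_eq) (simp add: gg_def)
  qed
  have cp: "has_partial i (\<lambda>x. sc (sq x)) (c i)" for i
    using has_partial_chain[OF profile_derivs(5) has_partial_sq] unfolding c_def[abs_def] .
  have ccp: "has_partial j (c i) (cc j i)" for i j
    using has_partial_mult[OF has_partial_chain[OF profile_derivs(6) has_partial_sq] two] unfolding c_def[abs_def] cc_def[abs_def] .
  have sgm: "has_partial i (\<lambda>x. \<sigma> * f x) (\<lambda>x. \<sigma> * f' x)" if "has_partial i f f'" for i :: 2 and f f'
    using has_partial_mult[OF has_partial_const[of i \<sigma>] that] by simp
  note cont = continuous_intros continuous_on_vec3 profile_continuous continuous_sq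
  have "compact_map m D DD 1"
  proof
    show "m x \<in> sphere 0 1" for x
    proof -
      have "(sh (sq x) * x $ 1)\<^sup>2 + (\<sigma> * (sh (sq x) * x $ 2))\<^sup>2 = (sh (sq x))\<^sup>2 * sq x"
        using \<sigma> by (simp add: power_mult_distrib sq_def algebra_simps)
      then show ?thesis unfolding sphere_components m_def using profile_sphere[of "sq x"] by simp
    qed
    show "m x = e3" if "norm x > 1" for x
    proof -
      have "sq x \<ge> 1" unfolding sq_eq using that power_mono[of 1 "norm x" 2] by simp
      then show ?thesis by (simp add: m_def vec3_eq_iff profile_values)
    qed
    show "continuous_on UNIV m" "continuous_on UNIV (D i)" "continuous_on UNIV (DD i j)" for i j
      unfolding m_def[abs_def] D_def[abs_def] DD_def[abs_def] g_def gg_def c_def cc_def by (intro cont)+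
    show "has_partial i m (D i)" "has_partial i (D j) (DD i j)" for i j
      unfolding m_def[abs_def] D_def[abs_def] DD_def[abs_def]
      by (intro has_partial_vec3 gp sgm cp ggp ccp)+
  qed
  then interpret compact_map m D DD 1 .
  have dens: "m x \<bullet> cross3 (D 1 x) (D 2 x) = - 2 * \<sigma> * sc' (8 * radial 0 x)" for x
  proof -
    have s: "8 * radial 0 x = sq x" by (simp add: radial_def sq_eq)
    define a b h h1 k k1 where "a = x $ 1" and "b = x $ 2" and "h = sh (sq x)" and "h1 = sh' (sq x)" and "k = sc (sq x)" and "k1 = sc' (sq x)"
    have 1: "h\<^sup>2 * (a\<^sup>2 + b\<^sup>2) + k\<^sup>2 = 1" using profile_sphere[of "sq x"] unfolding a_def b_def h_def k_def sq_def by simp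
    have 2: "2 * h * h1 * (a\<^sup>2 + b\<^sup>2) + h\<^sup>2 = - 2 * k * k1"
      using profile_sphere_deriv[of "sq x"] unfolding a_def b_def h_def h1_def k_def k1_def sq_def by simp
    have "m x \<bullet> cross3 (D 1 x) (D 2 x) = \<sigma> * (- 2 * h\<^sup>2 * (a\<^sup>2 + b\<^sup>2) * k1 + k * (h\<^sup>2 + 2 * h * h1 * (a\<^sup>2 + b\<^sup>2)))"
      unfolding inner_vec_def cross3_def sum_3
      by (simp add: m_def D_def g_def c_def a_def[symmetric] b_def[symmetric] h_def[symmetric] h1_def[symmetric]
          k_def[symmetric] k1_def[symmetric]) (simp add: power2_eq_square algebra_simps)
    \<comment> \<open>By fact \<open>2\<close> the bracket after k is - 2 k k1; by fact
      \<open>1\<close> the terms h^2 (a^2 + b^2) and k^2 then add up to 1.\<close>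
    also have "\<dots> = - 2 * \<sigma> * k1" using 1 2 by algebra
    finally show ?thesis unfolding s k1_def .
  qed
  have "has_bochner_integral lborel (\<lambda>t. sc' (8 * t) * indicator {0..1/8} t) (sc (8 * (1/8)) / 8 - sc (8 * 0) / 8)"
  proof (rule has_bochner_integral_FTC_Icc_real[where F = "\<lambda>t. sc (8 * t) / 8"])
    show "((\<lambda>t. sc (8 * t) / 8) has_real_derivative sc' (8 * t)) (at t)" for t :: real
      by (rule derivative_eq_intros refl DERIV_chain2[OF profile_derivs(5)])+ auto
    show "isCont (\<lambda>t. sc' (8 * t)) t" for t :: real
      using profile_continuous(5)[of UNIV "\<lambda>t. 8 * t"] by (auto simp: continuous_on_eq_continuous_at intro!: continuous_intros)
  qed auto
  \<comment> \<open>As sigma^2 = 1, the factor - sigma / 2 undoes - 2 sigma; the indicator extends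
    to the half-line because sc' vanishes from 1 on.\<close>
  moreover have "sc' (8 * t) * indicator {0..1/8} t = (- 2 * \<sigma> * sc' (8 * t)) * indicator {0..} t * (- \<sigma> / 2)" for t :: real
    using profile_values(3)[of "8 * t"] \<sigma> by (auto simp: indicator_def power2_eq_square)
  ultimately have a: "has_bochner_integral lborel (\<lambda>t. (- 2 * \<sigma> * sc' (8 * t)) * indicator {0..} t * (- \<sigma> / 2)) (1 / 4)"
    using profile_values(2)[of 1] profile_values(4) by simp
  have b: "has_bochner_integral lborel (\<lambda>t. (- 2 * \<sigma> * sc' (8 * t)) * indicator {0..} t) (- \<sigma> / 2)"
  proof -
    have eq: "(- 2 * \<sigma> * sc' (8 * t)) * indicator {0..} t * (- \<sigma> / 2) * (- 2 * \<sigma>) = (- 2 * \<sigma> * sc' (8 * t)) * indicator {0..} t" for t :: real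
      using \<sigma> by (simp add: power2_eq_square)
    from has_bochner_integral_mult_left[OF a, of "- 2 * \<sigma>"]
    have "has_bochner_integral lborel (\<lambda>t. (- 2 * \<sigma> * sc' (8 * t)) * indicator {0..} t) (1 / 4 * (- 2 * \<sigma>))"
      unfolding eq by blast
    then show ?thesis by simp
  qed
  have [measurable]: "sc' \<in> borel_measurable borel"
    using profile_continuous(5)[of UNIV "\<lambda>t. t"] by (intro borel_measurable_continuous_onI) simp
  have "has_bochner_integral lborel (\<lambda>x. - 2 * \<sigma> * sc' (8 * radial 0 x)) (8 * pi * (- \<sigma> / 2))"
    by (rule has_bochner_integral_radial[OF b]) measurable
  moreover have "\<sigma> \<noteq> 0" using \<sigma> by auto
  ultimately have "degree_Q m = - \<sigma>" unfolding degree_eq dens by (simp add: has_bochner_integral_iff)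
  then show ?thesis using compact_map_axioms by blast
qed

lemma constant_map: "compact_map (\<lambda>x. e3) (\<lambda>i x. 0) (\<lambda>i j x. 0) 0" 
proof -
  have "e3 \<in> sphere 0 1" unfolding sphere_components by simp
  then show ?thesis by unfold_locales (auto simp: has_partial_const)
qed

text \<open>Glues |q| copies of a unit map. That map has degree - sigma, so q >= 0 takes sigma =
  -1.\<close>

lemma degree_map_exists:
  "\<exists>m D DD R. compact_map m D DD R \<and> degree_Q m = of_int q"
proof -
  have step: "\<exists>m D DD R. compact_map m D DD R \<and> degree_Q m = - \<sigma> * real n" if "\<sigma>\<^sup>2 = 1" for \<sigma> n
  proof (induction n)
    case 0
    have "degree_Q (\<lambda>x. e3) = 0" using compact_map.degree_eq[OF constant_map] by (simp add: cross3_def)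
    then show ?case using constant_map by auto
  next
    case (Suc n)
    then obtain m D DD R where m: "compact_map m D DD R" "degree_Q m = - \<sigma> * real n" by blast
    obtain m' D' DD' R' where m': "compact_map m' D' DD' R'" "degree_Q m' = - \<sigma>" using unit_degree_map[OF \<open>\<sigma>\<^sup>2 = 1\<close>] by blast
    from compact_map_glue[OF m(1) m'(1)] show ?case using m m' by (auto simp: algebra_simps)
  qed
  show ?thesis
  proof (cases "q \<ge> 0")
    case True
    then show ?thesis using step[of "- 1" "nat q"] by simp
  next
    case False
    then show ?thesis using step[of 1 "nat (- q)"] by simp
  qed
qed

section \<open>Modulated waves\<close>

lemma measure_cball_2: "r \<ge> 0 \<Longrightarrow> measure lborel (cball (c :: real^2) r) = pi * r\<^sup>2"
  unfolding measure_def emeasure_cball[of r] by (simp add: eval_unit_ball_vol)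

lemma integral_le_on_cball:
  fixes f :: "real^2 \<Rightarrow> real"
  assumes f: "integrable lborel f" and b: "\<And>x. norm x \<le> R \<Longrightarrow> f x \<le> K" and z: "\<And>x. norm x > R \<Longrightarrow> f x = 0" and R: "R \<ge> 0"
  shows "(LINT x|lborel. f x) \<le> K * (pi * R\<^sup>2)"
proof -
  have fin: "emeasure lborel (cball (0::real^2) R) < \<infinity>" using emeasure_compact_finite[OF compact_cball, of 0 R] by (simp add: less_top)
  have "(LINT x|lborel. f x) \<le> (LINT x|lborel. K * indicator (cball (0::real^2) R) x)"
  proof (rule integral_mono[OF f])
    show "integrable lborel (\<lambda>x. K * indicator (cball (0::real^2) R) x)"
      using fin by (intro integrable_mult_right integrable_real_indicator) auto
  qed (use b z in \<open>auto simp: indicator_def not_le\<close>)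
  also have "\<dots> = K * (pi * R\<^sup>2)" using measure_cball_2[OF R, of 0] by simp
  finally show ?thesis .
qed

text \<open>A shift by a quarter period turns cos^2 into sin^2. For x in the concentric disk of
  radius r / 2 both points lie in the disk of radius r, so the smaller area pi r^2 / 4 is at most
  twice the integral.\<close>

lemma integral_cos_square:
  fixes \<kappa> r :: real
  assumes \<kappa>: "\<kappa> > 0" and r: "pi / (2 * \<kappa>) \<le> r / 2"
  shows "(LINT x|lborel. indicator (cball 0 r) x * (cos (\<kappa> * (x :: real^2) $ 1))\<^sup>2) \<ge> pi * r\<^sup>2 / 8"
proof -
  have r0: "r \<ge> 0" using r \<kappa> divide_nonneg_pos[of pi "2 * \<kappa>"] pi_ge_zero by linarith
  let ?f = "\<lambda>x :: real^2. indicator (cball 0 r) x * (cos (\<kappa> * x $ 1))\<^sup>2 :: real"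
  define b :: "real^2" where "b = (pi / (2 * \<kappa>)) *\<^sub>R axis 1 1"
  have nb: "norm b = pi / (2 * \<kappa>)" unfolding b_def using \<kappa> by (simp add: norm_axis_1)
  have fin: "emeasure lborel (cball (0::real^2) s) < \<infinity>" for s using emeasure_compact_finite[OF compact_cball, of 0 s] by (simp add: less_top)
  have [measurable]: "cball (0::real^2) r \<in> sets borel" by simp
  have [measurable]: "(\<lambda>x :: real^2. cos (\<kappa> * x $ 1)) \<in> borel_measurable borel"
    by (intro borel_measurable_continuous_onI continuous_intros)
  have fm: "?f \<in> borel_measurable borel" by measurable
  have fi: "integrable lborel ?f"
  proof (rule Bochner_Integration.integrable_bound[of lborel "indicator (cball 0 r)"])
    show "integrable lborel (indicator (cball 0 r) :: real^2 \<Rightarrow> real)" using fin by (intro integrable_real_indicator) auto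
    show "AE x in lborel. norm (?f x) \<le> norm (indicator (cball 0 r) x :: real)"
      by (auto simp: indicator_def abs_square_le_1)
  qed (use fm in simp)
  have t: "integrable lborel (\<lambda>x. ?f (x + b))" "(LINT x|lborel. ?f (x + b)) = (LINT x|lborel. ?f x)"
    using integral_translate[OF fm, of b] fi by auto
  have "pi * (r / 2)\<^sup>2 = (LINT x|lborel. indicator (cball (0::real^2) (r / 2)) x)"
    using measure_cball_2[of "r / 2" 0] r0 by simp
  also have "\<dots> \<le> (LINT x|lborel. ?f x + ?f (x + b))"
  proof (rule integral_mono)
    show "integrable lborel (indicator (cball (0::real^2) (r / 2)) :: _ \<Rightarrow> real)" using fin by (intro integrable_real_indicator) auto
    show "integrable lborel (\<lambda>x. ?f x + ?f (x + b))" using fi t by auto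
    fix x :: "real^2"
    show "indicator (cball 0 (r / 2)) x \<le> ?f x + ?f (x + b)"
    proof (cases "norm x \<le> r / 2")
      case True
      then have n: "norm x \<le> r" "norm (x + b) \<le> r" using norm_triangle_ineq[of x b] nb r r0 by linarith+
      have "\<kappa> * (x + b) $ 1 = \<kappa> * x $ 1 + pi / 2" using \<kappa> by (simp add: b_def axis_def field_simps)
      then have "cos (\<kappa> * (x + b) $ 1) = - sin (\<kappa> * x $ 1)" by (simp only: cos_add cos_pi_half sin_pi_half)
      then show ?thesis using n True by (simp add: indicator_def)
    qed (simp add: indicator_def)
  qed
  also have "\<dots> = 2 * (LINT x|lborel. ?f x)" using fi t by simp
  finally show ?thesis by (simp add: power_divide)
qed

lemma one_minus_cos_le: "1 - cos y \<le> y\<^sup>2 / 2" for y :: real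
proof -
  have "\<bar>sin (y / 2)\<bar> \<le> \<bar>y / 2\<bar>" by (rule abs_sin_x_le_abs_x)
  then have "(sin (y / 2))\<^sup>2 \<le> (y / 2)\<^sup>2" by (simp only: abs_le_square_iff)
  then show ?thesis using cos_double_sin[of "y / 2"] by (simp add: power_divide)
qed

text \<open>The wave number for which C = cos (kap x1) solves Delta C + C / 2 = 0.\<close>

definition kap :: real where "kap = 1 / sqrt 2"

lemma kap: "kap > 0" "kap\<^sup>2 = 1 / 2" "kap \<le> 1"
  by (simp_all add: kap_def power_divide)

text \<open>e is the amplitude and R the radius of the support. In the definitions below, A is the
  envelope, whose derivatives are of order 1 / R, C the plane wave, p the angle, S its squared
  gradient and L the defect Delta p + p / 2.\<close>

locale wave =
  fixes e R :: real
  assumes e: "e > 0" "e \<le> 1" and R: "R \<ge> 1"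
begin

definition Y where "Y x = 1 - sq x / R\<^sup>2"
definition A where "A x = trunc_power 3 (Y x)"
definition a1 where "a1 i x = 3 * trunc_power 2 (Y x) * (- (2 * x $ i) / R\<^sup>2)" for i :: 2
definition a2 where "a2 j i x = 6 * trunc_power 1 (Y x) * ((2 * x $ j) / R\<^sup>2) * ((2 * x $ i) / R\<^sup>2)
  + 3 * trunc_power 2 (Y x) * (- (2 * (if j = i then 1 else 0)) / R\<^sup>2)" for i j :: 2
definition C where "C x = cos (kap * x $ 1)" for x :: "real^2"
definition c1 where "c1 i x = - (kap * sin (kap * x $ 1)) * (if i = 1 then 1 else 0)" for i :: 2 and x :: "real^2"
definition c2 where "c2 j i x = - (kap\<^sup>2 * cos (kap * x $ 1)) * (if j = 1 then 1 else 0) * (if i = 1 then 1 else 0)" for i j :: 2 and x :: "real^2"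
definition p where "p x = e * (A x * C x)"
definition p1 where "p1 i x = e * (a1 i x * C x + A x * c1 i x)"
definition p2 where "p2 j i x = e * (a2 j i x * C x + a1 i x * c1 j x + (a1 j x * c1 i x + A x * c2 j i x))"
definition S where "S x = (p1 1 x)\<^sup>2 + (p1 2 x)\<^sup>2"
definition L where "L x = p2 1 1 x + p2 2 2 x + 1/2 * p x"
text \<open>A map into one great circle; its degree density vanishes identically.\<close>

definition m where "m x = vec3 (sin (p x)) 0 (cos (p x))"
definition D where "D i x = vec3 (cos (p x) * p1 i x) 0 (- (sin (p x) * p1 i x))"
definition DD where "DD j i x = vec3 (- (sin (p x) * p1 j x) * p1 i x + cos (p x) * p2 j i x) 0
   (- ((cos (p x) * p1 j x) * p1 i x + sin (p x) * p2 j i x))"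

lemma cmult: "has_partial i f f' \<Longrightarrow> has_partial i (\<lambda>x. c * f x) (\<lambda>x. c * f' x)" for i :: 2 and f f' :: "real^2 \<Rightarrow> real"
  using has_partial_mult[OF has_partial_const[of i c], of f f'] by simp

lemma Y_partial: "has_partial i Y (\<lambda>x. - (2 * x $ i) / R\<^sup>2)"
  using has_partial_add[OF has_partial_const[of i 1] cmult[OF has_partial_sq, of i "- 1 / R\<^sup>2"]]
  by (simp add: Y_def[abs_def])

lemma A_partial: "has_partial i A (a1 i)"
  using has_partial_chain[OF trunc_power_deriv[of 3] Y_partial] by (simp add: A_def[abs_def] a1_def[abs_def])

lemma a1_partial: "has_partial j (a1 i) (a2 j i)"
proof -
  have x: "has_partial j (\<lambda>x::real^2. (- 2 / R\<^sup>2) * x $ i) (\<lambda>x. (- 2 / R\<^sup>2) * (if j = i then 1 else 0))"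
    by (rule cmult[OF has_partial_nth])
  have "has_partial j (\<lambda>x. (3 * trunc_power 2 (Y x)) * ((- 2 / R\<^sup>2) * x $ i))
     (\<lambda>x. (3 * (2 * trunc_power 1 (Y x) * (- (2 * x $ j) / R\<^sup>2))) * ((- 2 / R\<^sup>2) * x $ i)
       + (3 * trunc_power 2 (Y x)) * ((- 2 / R\<^sup>2) * (if j = i then 1 else 0)))"
    using has_partial_mult[OF cmult[OF has_partial_chain[OF trunc_power_deriv[of 2] Y_partial], of j 3] x] by simp
  then have "has_partial j (\<lambda>x. (3 * trunc_power 2 (Y x)) * ((- 2 / R\<^sup>2) * x $ i)) (a2 j i)"
    by (rule has_partial_eq) (simp add: a2_def)
  moreover have "(\<lambda>x. (3 * trunc_power 2 (Y x)) * ((- 2 / R\<^sup>2) * x $ i)) = a1 i"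
    by (auto simp: a1_def fun_eq_iff)
  ultimately show ?thesis by simp
qed

lemma kx_partial: "has_partial i (\<lambda>x::real^2. kap * x $ 1) (\<lambda>x. kap * (if i = 1 then 1 else 0))"
  by (rule cmult[OF has_partial_nth])

lemma C_partial: "has_partial i C (c1 i)"
  using has_partial_chain[OF DERIV_cos kx_partial] by (simp add: C_def[abs_def] c1_def[abs_def] mult_ac)

lemma c1_partial: "has_partial j (c1 i) (c2 j i)"
proof -
  have "has_partial j (\<lambda>x. (- kap * (if i = 1 then 1 else 0)) * sin (kap * x $ 1))
    (\<lambda>x. (- kap * (if i = 1 then 1 else 0)) * (cos (kap * x $ 1) * (kap * (if j = 1 then 1 else 0))))"
    by (rule cmult[OF has_partial_chain[OF DERIV_sin kx_partial]])
  then have "has_partial j (\<lambda>x. (- kap * (if i = 1 then 1 else 0)) * sin (kap * x $ 1)) (c2 j i)"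
    by (rule has_partial_eq) (simp add: c2_def power2_eq_square)
  moreover have "(\<lambda>x. (- kap * (if i = 1 then 1 else 0)) * sin (kap * x $ 1)) = c1 i"
    by (auto simp: c1_def fun_eq_iff)
  ultimately show ?thesis by simp
qed

lemma p_partial: "has_partial i p (p1 i)"
  unfolding p_def[abs_def] p1_def[abs_def] by (intro cmult has_partial_mult A_partial C_partial)

lemma p1_partial: "has_partial j (p1 i) (p2 j i)"
  unfolding p1_def[abs_def] p2_def[abs_def]
  by (intro cmult has_partial_add has_partial_mult A_partial C_partial a1_partial c1_partial)

lemma p_cont: "continuous_on UNIV p" "continuous_on UNIV (p1 i)" "continuous_on UNIV (p2 j i)"
proof -
  have Y: "continuous_on UNIV Y" unfolding Y_def[abs_def] using R by (intro continuous_intros continuous_sq) auto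
  note c = continuous_intros trunc_power_continuous Y
  have "continuous_on UNIV A" "continuous_on UNIV (a1 i)" "continuous_on UNIV (a2 j i)" "continuous_on UNIV C" "continuous_on UNIV (c1 i)"
    "continuous_on UNIV (c2 j i)" for i j
    unfolding A_def[abs_def] a1_def[abs_def] a2_def[abs_def] C_def[abs_def] c1_def[abs_def] c2_def[abs_def]
    using R by (intro c; simp)+
  note c' = this
  show "continuous_on UNIV p" "continuous_on UNIV (p1 i)" "continuous_on UNIV (p2 j i)"
    unfolding p_def[abs_def] p1_def[abs_def] p2_def[abs_def] by (intro continuous_intros c')+
qed

lemma Y_neg: "norm x > R \<Longrightarrow> Y x \<le> 0"
  unfolding Y_def sq_eq using R power_mono[of R "norm x" 2] by (simp add: le_divide_eq)

lemma p_supp: "norm x > R \<Longrightarrow> p x = 0" "norm x > R \<Longrightarrow> p1 i x = 0" "norm x > R \<Longrightarrow> p2 j i x = 0"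
  using Y_neg[of x] by (simp_all add: p_def p1_def p2_def A_def a1_def a2_def trunc_power_zero)

lemma m_partial: "has_partial i m (D i)" "has_partial j (D i) (DD j i)"
proof -
  have s: "has_partial i (\<lambda>x. sin (p x)) (\<lambda>x. cos (p x) * p1 i x)" for i by (rule has_partial_chain[OF DERIV_sin p_partial])
  have c: "has_partial i (\<lambda>x. cos (p x)) (\<lambda>x. - sin (p x) * p1 i x)" for i by (rule has_partial_chain[OF DERIV_cos p_partial])
  have c': "has_partial i (\<lambda>x. cos (p x)) (\<lambda>x. - (sin (p x) * p1 i x))" for i using c by simp
  have n: "has_partial i (\<lambda>x. - f x) (\<lambda>x. - f' x)" if "has_partial i f f'" for i :: 2 and f f' :: "real^2 \<Rightarrow> real"
    using cmult[OF that, of "- 1"] by simp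
  show "has_partial i m (D i)"
    unfolding m_def[abs_def] D_def[abs_def] by (intro has_partial_vec3 s c' has_partial_const)
  show "has_partial j (D i) (DD j i)"
    unfolding D_def[abs_def] DD_def[abs_def] by (intro has_partial_vec3 n has_partial_mult s c' has_partial_const p1_partial)
qed

sublocale M: compact_map m D DD R
proof
  show "m x \<in> sphere 0 1" for x unfolding sphere_components m_def by simp
  show "m x = e3" if "norm x > R" for x using p_supp(1)[OF that] by (simp add: m_def vec3_eq_iff)
  show "continuous_on UNIV m" "continuous_on UNIV (D i)" "continuous_on UNIV (DD i j)" for i j
    unfolding m_def[abs_def] D_def[abs_def] DD_def[abs_def]
    by (intro continuous_on_vec3 continuous_intros p_cont)+
qed (rule m_partial)+

lemma degree_0: "degree_Q m = 0"
proof -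
  have "m x \<bullet> cross3 (D 1 x) (D 2 x) = 0" for x
    unfolding inner_vec_def cross3_def sum_3 by (simp add: m_def D_def)
  then show ?thesis unfolding M.degree_eq by simp
qed

text \<open>The envelope has first derivatives at most 6 / R and second ones at most 24 / R + 6 / R
  = 30 / R; A, C, c1 and c2 are at most 1. With R >= 1 this gives 7 = 6 + 1 and 43 = 30 + 6 + 6 + 1.
  In L the terms with an undifferentiated envelope cancel by the choice of \<open>kap\<close>, which
  leaves (30 + 30 + 2 * 6) / R = 72 / R.\<close>

lemma bounds:
  assumes x: "norm x \<le> R"
  shows "\<bar>p x\<bar> \<le> e" "\<bar>p1 i x\<bar> \<le> 7 * e" "\<bar>p2 j i x\<bar> \<le> 43 * e" "\<bar>L x\<bar> \<le> 72 * e / R"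
proof -
  have R0: "R > 0" using R by linarith
  have "sq x / R\<^sup>2 \<le> 1" unfolding sq_eq using x R0 by (simp add: divide_le_eq power_mono)
  moreover have "sq x / R\<^sup>2 \<ge> 0" by (simp add: sq_eq)
  ultimately have Y: "0 \<le> Y x" "Y x \<le> 1" unfolding Y_def by auto
  have tp: "\<bar>trunc_power n (Y x)\<bar> \<le> 1" for n using Y by (simp add: trunc_power_def power_le_one)
  have xi: "\<bar>(2 * x $ i) / R\<^sup>2\<bar> \<le> 2 / R" for i
  proof -
    have "\<bar>2 * x $ i\<bar> \<le> 2 * R" using component_le_norm_cart[of x i] x by simp
    then have "\<bar>2 * x $ i\<bar> / R\<^sup>2 \<le> 2 * R / R\<^sup>2" by (rule divide_right_mono) simp
    then show ?thesis using R0 by (simp add: power2_eq_square)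
  qed
  have iR: "1 / R \<le> 1" "2 / R \<le> 2" "1 / R\<^sup>2 \<le> 1 / R" using R by (auto simp: divide_le_eq power2_eq_square frac_le)
  have A: "\<bar>A x\<bar> \<le> 1" unfolding A_def by (rule tp)
  have a1: "\<bar>a1 i x\<bar> \<le> 6 / R" for i
  proof -
    have "\<bar>a1 i x\<bar> = 3 * (\<bar>trunc_power 2 (Y x)\<bar> * \<bar>(2 * x $ i) / R\<^sup>2\<bar>)" by (simp add: a1_def abs_mult)
    also have "\<dots> \<le> 3 * (1 * (2 / R))" using tp xi by (intro mult_left_mono mult_mono) auto
    finally show ?thesis by simp
  qed
  have a2: "\<bar>a2 j i x\<bar> \<le> 30 / R" for j i
  proof -
    have "\<bar>trunc_power 1 (Y x) * ((2 * x $ j) / R\<^sup>2) * ((2 * x $ i) / R\<^sup>2)\<bar> \<le> 1 * (2 / R) * 2"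
      unfolding abs_mult using tp xi R0 order_trans[OF xi iR(2)] by (intro mult_mono) auto
    then have 1: "\<bar>6 * trunc_power 1 (Y x) * ((2 * x $ j) / R\<^sup>2) * ((2 * x $ i) / R\<^sup>2)\<bar> \<le> 24 / R" by (simp add: abs_mult)
    have "\<bar>trunc_power 2 (Y x) * ((if j = i then 1 else 0) / R\<^sup>2)\<bar> \<le> 1 * (1 / R)"
      unfolding abs_mult using tp iR R0 by (intro mult_mono) auto
    then have 2: "\<bar>3 * trunc_power 2 (Y x) * (- (2 * (if j = i then 1 else 0)) / R\<^sup>2)\<bar> \<le> 6 / R" by (simp add: abs_mult)
    show ?thesis unfolding a2_def using abs_triangle_ineq[of "6 * trunc_power 1 (Y x) * ((2 * x $ j) / R\<^sup>2) * ((2 * x $ i) / R\<^sup>2)"] 1 2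
      by (smt (verit) add_divide_distrib)
  qed
  have C: "\<bar>C x\<bar> \<le> 1" "\<bar>c1 i x\<bar> \<le> 1" "\<bar>c2 j i x\<bar> \<le> 1" for i j
  proof -
    show "\<bar>C x\<bar> \<le> 1" by (simp add: C_def)
    have "kap * \<bar>sin (kap * x $ 1)\<bar> \<le> 1 * 1" using kap by (intro mult_mono) auto
    then show "\<bar>c1 i x\<bar> \<le> 1" using kap by (simp add: c1_def abs_mult)
    have "1 / 2 * \<bar>cos (kap * x $ 1)\<bar> \<le> 1 * 1" by (intro mult_mono) auto
    then show "\<bar>c2 j i x\<bar> \<le> 1" by (simp add: c2_def abs_mult kap)
  qed
  have mm: "\<bar>u * v\<bar> \<le> K" if "\<bar>u\<bar> \<le> K" "\<bar>v\<bar> \<le> 1" for u v K :: real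
    using mult_mono[OF that] that by (simp add: abs_mult) 
  have sm: "6 / R \<le> 6" "30 / R \<le> 30" using iR by auto
  show "\<bar>p x\<bar> \<le> e" unfolding p_def abs_mult[of e] using mm[OF A C(1)] e by simp
  have "\<bar>a1 i x * C x + A x * c1 i x\<bar> \<le> 7"
    using mm[OF a1[of i] C(1)] mm[OF A C(2)[of i]] sm(1) by linarith
  then show "\<bar>p1 i x\<bar> \<le> 7 * e" unfolding p1_def abs_mult[of e] using e by (simp add: mult.commute)
  have "\<bar>a2 j i x * C x + a1 i x * c1 j x + (a1 j x * c1 i x + A x * c2 j i x)\<bar> \<le> 43"
    using mm[OF a2[of j i] C(1)] mm[OF a1[of i] C(2)[of j]] mm[OF a1[of j] C(2)[of i]] mm[OF A C(3)[of j i]] sm by linarith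
  then show "\<bar>p2 j i x\<bar> \<le> 43 * e" unfolding p2_def abs_mult[of e] using e by (simp add: mult.commute)
  have "L x = e * (a2 1 1 x * C x + a2 2 2 x * C x + 2 * (a1 1 x * c1 1 x))"
    by (simp add: L_def p2_def p_def c1_def c2_def C_def kap algebra_simps)
  moreover have "\<bar>a2 1 1 x * C x + a2 2 2 x * C x + 2 * (a1 1 x * c1 1 x)\<bar> \<le> 72 / R"
    using mm[OF a2[of 1 1] C(1)] mm[OF a2[of 2 2] C(1)] mm[OF a1[of 1] C(2)[of 1]] by (simp add: abs_if split: if_splits) 
  then have "e * \<bar>a2 1 1 x * C x + a2 2 2 x * C x + 2 * (a1 1 x * c1 1 x)\<bar> \<le> e * (72 / R)"
    using e by (intro mult_left_mono) auto
  ultimately show "\<bar>L x\<bar> \<le> 72 * e / R" using e by (simp add: abs_mult mult.commute)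
qed

lemma S_bound: "norm x \<le> R \<Longrightarrow> S x \<le> 98 * e\<^sup>2"
  using power_mono[OF bounds(2)[of x 1] abs_ge_zero, of 2] power_mono[OF bounds(2)[of x 2] abs_ge_zero, of 2]
  by (simp add: S_def power_mult_distrib)

lemma S_nonneg: "S x \<ge> 0" by (simp add: S_def)

lemma int_p: "integrable lborel (\<lambda>x. (p x)\<^sup>2)" "integrable lborel S" "integrable lborel (\<lambda>x. (S x)\<^sup>2)" "integrable lborel (\<lambda>x. (L x)\<^sup>2)"
   "integrable lborel (\<lambda>x. p x * L x)" "integrable lborel (\<lambda>x. p x * (p2 1 1 x + p2 2 2 x))"
  unfolding S_def[abs_def] L_def[abs_def]
  by (rule M.integrable_compact; auto intro!: continuous_intros p_cont simp: p_supp)+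

text \<open>Green's formula, with Delta p = L - p / 2.\<close>

lemma S_by_parts: "(LINT x|lborel. S x) = 1/2 * (LINT x|lborel. (p x)\<^sup>2) - (LINT x|lborel. p x * L x)"
proof -
  have L2: "in_L2 p" "in_L2 (p1 i)" "in_L2 (p2 j i)" for i j
    by (rule in_L2_compact_support[of _ R]; simp add: p_cont p_supp)+
  have w: "has_weak_partial i p (p1 i)" "has_weak_partial i (p1 i) (p2 i i)" for i
    by (rule has_weak_partial_classical[of _ _ _ R]; simp add: p_partial p1_partial p_cont p_supp)+
  have "(LINT x|lborel. p1 i x * p1 i x) = - (LINT x|lborel. p x * p2 i i x)" for i
    by (rule L2_integration_by_parts[OF L2(1,2) w(1) L2(2,3) w(2)])
  moreover have "(LINT x|lborel. S x) = (LINT x|lborel. p1 1 x * p1 1 x) + (LINT x|lborel. p1 2 x * p1 2 x)"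
    unfolding S_def power2_eq_square using in_L2_integrable_mult[OF L2(2) L2(2)] by simp
  moreover have "(LINT x|lborel. p x * L x) = (LINT x|lborel. p x * p2 1 1 x) + (LINT x|lborel. p x * p2 2 2 x) + 1/2 * (LINT x|lborel. (p x)\<^sup>2)"
  proof -
    have "(LINT x|lborel. p x * L x) = (LINT x|lborel. p x * p2 1 1 x + p x * p2 2 2 x + 1/2 * (p x)\<^sup>2)"
      by (rule Bochner_Integration.integral_cong) (auto simp: L_def power2_eq_square algebra_simps)
    then show ?thesis using in_L2_integrable_mult[OF L2(1) L2(3)] int_p(1) by simp
  qed
  ultimately show ?thesis by simp
qed

text \<open>With the unit tangent tau = (cos p, 0, - sin p), Delta m = (Delta p) tau - |grad p|^2 m,
  and the two terms are orthogonal.\<close>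

lemma density_eq: "M.energy_density H x = - (1/2) * S x + 1/2 * ((L x - 1/2 * p x)\<^sup>2 + (S x)\<^sup>2) + H * (1 - cos (p x))"
proof -
  define s c where "s = sin (p x)" and "c = cos (p x)"
  have sc: "s\<^sup>2 + c\<^sup>2 = 1" unfolding s_def c_def by simp
  have n1: "(norm (D i x))\<^sup>2 = (p1 i x)\<^sup>2" for i
    unfolding D_def norm_vec3 s_def[symmetric] c_def[symmetric] using sc by (simp add: power_mult_distrib) algebra
  have "DD 1 1 x + DD 2 2 x = vec3 (- s * S x + c * (L x - 1/2 * p x)) 0 (- (c * S x + s * (L x - 1/2 * p x)))"
    by (simp add: vec3_eq_iff DD_def S_def L_def s_def c_def power2_eq_square algebra_simps)
  then have n2: "(norm (DD 1 1 x + DD 2 2 x))\<^sup>2 = (L x - 1/2 * p x)\<^sup>2 + (S x)\<^sup>2"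
  proof -
    have "(- s * a + c * b)\<^sup>2 + 0\<^sup>2 + (- (c * a + s * b))\<^sup>2 = (s\<^sup>2 + c\<^sup>2) * (b\<^sup>2 + a\<^sup>2)" for a b
      by (simp add: power2_eq_square algebra_simps)
    then show ?thesis unfolding \<open>DD 1 1 x + DD 2 2 x = _\<close> norm_vec3 sc by simp
  qed
  show ?thesis unfolding M.energy_density_def sum_2 n1 n2 by (simp add: S_def m_def)
qed

text \<open>After 1 - cos p <= p^2 / 2 and \<open>S_by_parts\<close>, the quadratic terms reduce to
  half the integral of L^2 and the term with 1/4 - H; the quartic remainder is half the integral of
  S^2. The constants are 72^2 / 2 and 98^2 / 2, on a disk of area pi R^2.\<close>

lemma energy_le:
  assumes H: "0 \<le> H"
  shows "energy H m \<le> 2592 * pi * e\<^sup>2 + 4802 * pi * e ^ 4 * R\<^sup>2 - 1/2 * (1/4 - H) * (LINT x|lborel. (p x)\<^sup>2)"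
proof -
  have R0: "R > 0" using R by linarith
  have "energy H m \<le> (LINT x|lborel. - (1/2) * S x + 1/2 * (L x)\<^sup>2 - 1/2 * (p x * L x) + 1/8 * (p x)\<^sup>2 + 1/2 * (S x)\<^sup>2 + H / 2 * (p x)\<^sup>2)"
    unfolding M.energy_eq
  proof (rule integral_mono[OF M.integrable_energy_density])
    show "integrable lborel (\<lambda>x. - (1/2) * S x + 1/2 * (L x)\<^sup>2 - 1/2 * (p x * L x) + 1/8 * (p x)\<^sup>2 + 1/2 * (S x)\<^sup>2 + H / 2 * (p x)\<^sup>2)"
      using int_p by (intro Bochner_Integration.integrable_add Bochner_Integration.integrable_diff integrable_mult_right)
    fix x
    have "H * (1 - cos (p x)) \<le> H * ((p x)\<^sup>2 / 2)" using one_minus_cos_le H by (rule mult_left_mono)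
    then show "M.energy_density H x \<le> - (1/2) * S x + 1/2 * (L x)\<^sup>2 - 1/2 * (p x * L x) + 1/8 * (p x)\<^sup>2 + 1/2 * (S x)\<^sup>2 + H / 2 * (p x)\<^sup>2"
      unfolding density_eq by (simp add: power2_eq_square algebra_simps)
  qed
  also have "\<dots> = - (1/2) * (LINT x|lborel. S x) + 1/2 * (LINT x|lborel. (L x)\<^sup>2) - 1/2 * (LINT x|lborel. p x * L x)
     + 1/8 * (LINT x|lborel. (p x)\<^sup>2) + 1/2 * (LINT x|lborel. (S x)\<^sup>2) + H / 2 * (LINT x|lborel. (p x)\<^sup>2)"
    using int_p by simp
  also have "\<dots> = 1/2 * (LINT x|lborel. (L x)\<^sup>2) + 1/2 * (LINT x|lborel. (S x)\<^sup>2) - 1/2 * (1/4 - H) * (LINT x|lborel. (p x)\<^sup>2)"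
    unfolding S_by_parts by (simp add: algebra_simps)
  also have "\<dots> \<le> 1/2 * ((72 * e / R)\<^sup>2 * (pi * R\<^sup>2)) + 1/2 * ((98 * e\<^sup>2)\<^sup>2 * (pi * R\<^sup>2)) - 1/2 * (1/4 - H) * (LINT x|lborel. (p x)\<^sup>2)"
  proof -
    have "(LINT x|lborel. (L x)\<^sup>2) \<le> (72 * e / R)\<^sup>2 * (pi * R\<^sup>2)"
    proof (rule integral_le_on_cball[OF int_p(4)])
      show "(L x)\<^sup>2 \<le> (72 * e / R)\<^sup>2" if "norm x \<le> R" for x using power_mono[OF bounds(4)[OF that] abs_ge_zero, of 2] by simp
    qed (use R0 in \<open>auto simp: L_def p_supp\<close>)
    moreover have "(LINT x|lborel. (S x)\<^sup>2) \<le> (98 * e\<^sup>2)\<^sup>2 * (pi * R\<^sup>2)"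
    proof (rule integral_le_on_cball[OF int_p(3)])
      show "(S x)\<^sup>2 \<le> (98 * e\<^sup>2)\<^sup>2" if "norm x \<le> R" for x by (intro power_mono S_bound that S_nonneg)
    qed (use R0 in \<open>auto simp: S_def p_supp\<close>)
    ultimately show ?thesis by linarith
  qed
  also have "\<dots> = 2592 * pi * e\<^sup>2 + 4802 * pi * e ^ 4 * R\<^sup>2 - 1/2 * (1/4 - H) * (LINT x|lborel. (p x)\<^sup>2)"
    using R0 by (simp add: power_mult_distrib power_divide power_mult[symmetric])
  finally show ?thesis .
qed

text \<open>For |x| <= R / 2 the envelope is at least (3/4)^3 >= 2/5, so p^2 >= 4/25 e^2 C^2 there;
  \<open>integral_cos_square\<close> with r = R / 2 contributes pi R^2 / 32, and 4/25 / 32 = 1/200.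
  The condition R >= 4 pi leaves room for the quarter period.\<close>

lemma p_square_lower:
  assumes large: "R \<ge> 4 * pi"
  shows "(LINT x|lborel. (p x)\<^sup>2) \<ge> e\<^sup>2 * pi * R\<^sup>2 / 200"
proof -
  have R0: "R > 0" using R by linarith
  have "pi / (2 * kap) \<le> (R / 2) / 2"
  proof -
    have "1 \<le> 2 * kap" unfolding kap_def using real_sqrt_le_mono[of 2 4] by (simp add: le_divide_eq)
    then have "pi / (2 * kap) \<le> pi / 1" by (intro divide_left_mono) auto
    then show ?thesis using large by linarith
  qed
  from integral_cos_square[OF kap(1) this]
  have c: "pi * (R / 2)\<^sup>2 / 8 \<le> (LINT x|lborel. indicator (cball 0 (R / 2)) x * (C x)\<^sup>2)" unfolding C_def .
  then have "4 / 25 * e\<^sup>2 * (pi * (R / 2)\<^sup>2 / 8) \<le> 4 / 25 * e\<^sup>2 * (LINT x|lborel. indicator (cball 0 (R / 2)) x * (C x)\<^sup>2)"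
    by (rule mult_left_mono) simp
  also have "\<dots> = (LINT x|lborel. 4 / 25 * e\<^sup>2 * (indicator (cball 0 (R / 2)) x * (C x)\<^sup>2))" by simp
  also have "\<dots> \<le> (LINT x|lborel. (p x)\<^sup>2)"
  proof (rule integral_mono_AE[OF _ int_p(1)])
    have [measurable]: "cball (0::real^2) (R / 2) \<in> sets borel" by simp
    have [measurable]: "C \<in> borel_measurable borel"
      unfolding C_def[abs_def] by (intro borel_measurable_continuous_onI continuous_intros)
    have "emeasure lborel (cball (0::real^2) (R / 2)) < \<infinity>" using emeasure_compact_finite[OF compact_cball, of 0 "R / 2"] by (simp add: less_top)
    then have "integrable lborel (indicator (cball (0::real^2) (R / 2)) :: _ \<Rightarrow> real)" by (intro integrable_real_indicator) auto
    then have "integrable lborel (\<lambda>x. indicator (cball 0 (R / 2)) x * (C x)\<^sup>2)"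
    proof (rule Bochner_Integration.integrable_bound)
      show "(\<lambda>x. indicator (cball 0 (R / 2)) x * (C x)\<^sup>2) \<in> borel_measurable lborel" by measurable
      show "AE x in lborel. norm (indicator (cball 0 (R / 2)) x * (C x)\<^sup>2) \<le> norm (indicator (cball 0 (R / 2)) x :: real)"
        by (auto simp: indicator_def C_def abs_square_le_1)
    qed
    then show "integrable lborel (\<lambda>x. 4 / 25 * e\<^sup>2 * (indicator (cball 0 (R / 2)) x * (C x)\<^sup>2))" by (rule integrable_mult_right)
    show "AE x in lborel. 4 / 25 * e\<^sup>2 * (indicator (cball 0 (R / 2)) x * (C x)\<^sup>2) \<le> (p x)\<^sup>2"
    proof (rule AE_I2)
      fix x :: "real^2"
      show "4 / 25 * e\<^sup>2 * (indicator (cball 0 (R / 2)) x * (C x)\<^sup>2) \<le> (p x)\<^sup>2"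
      proof (cases "norm x \<le> R / 2")
        case True
        have "sq x / R\<^sup>2 \<le> (R / 2)\<^sup>2 / R\<^sup>2" unfolding sq_eq using True by (intro divide_right_mono power_mono) auto
        then have y: "Y x \<ge> 3 / 4" using R0 by (simp add: Y_def power_divide)
        have "(2 / 5) \<le> (3 / 4 :: real) ^ 3" by (simp add: power3_eq_cube)
        also have "\<dots> \<le> A x" unfolding A_def trunc_power_def using y by (intro power_mono) auto
        finally have "(2 / 5)\<^sup>2 \<le> (A x)\<^sup>2" by (intro power_mono) auto
        then have "4 / 25 * (e\<^sup>2 * (C x)\<^sup>2) \<le> (A x)\<^sup>2 * (e\<^sup>2 * (C x)\<^sup>2)" by (intro mult_right_mono) (auto simp: power2_eq_square)
        then show ?thesis using True by (simp add: p_def power_mult_distrib mult_ac)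
      qed simp
    qed
  qed
  finally show ?thesis by (simp add: power_divide field_simps)
qed

text \<open>On a great circle |m - e3|^2 = 2 (1 - cos p), and the second derivatives of m split into
  a tangential part p2 and a normal part p1 p1. The constant is 1 + 98 + 4 (1849 + 2401), where 1849
  = 43^2 and 2401 = 7^4.\<close>

lemma sobolev_density_bounds: "S x \<le> M.sobolev_density x" "M.sobolev_density x \<le> 17099 * e\<^sup>2"
proof -
  define s c where "s = sin (p x)" and "c = cos (p x)"
  have sc: "s\<^sup>2 + c\<^sup>2 = 1" unfolding s_def c_def by simp
  have n0: "(norm (m x - e3))\<^sup>2 = 2 * (1 - cos (p x))"
    unfolding norm_power2_cart sum_3 using sc by (simp add: m_def s_def c_def power2_eq_square algebra_simps)
  have n1: "(norm (D i x))\<^sup>2 = (p1 i x)\<^sup>2" for i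
    unfolding D_def norm_vec3 s_def[symmetric] c_def[symmetric] using sc by (simp add: power_mult_distrib) algebra
  have n2: "(norm (DD j i x))\<^sup>2 = (p2 j i x)\<^sup>2 + (p1 j x)\<^sup>2 * (p1 i x)\<^sup>2" for j i
    unfolding DD_def norm_vec3 s_def[symmetric] c_def[symmetric] using sc by (simp add: power_mult_distrib) algebra
  have eq: "M.sobolev_density x = 2 * (1 - cos (p x)) + S x + (\<Sum>i\<in>UNIV. \<Sum>j\<in>UNIV. (p2 i j x)\<^sup>2 + (p1 i x)\<^sup>2 * (p1 j x)\<^sup>2)"
    unfolding M.sobolev_density_def n0 n1 n2 by (simp add: S_def sum_2)
  have n: "0 \<le> (\<Sum>i\<in>UNIV. \<Sum>j\<in>UNIV. (p2 i j x)\<^sup>2 + (p1 i x)\<^sup>2 * (p1 j x)\<^sup>2)" by (intro sum_nonneg) auto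
  have "0 \<le> 2 * (1 - cos (p x))" by simp
  from add_increasing2[OF n add_increasing[OF this order_refl]] show "S x \<le> M.sobolev_density x" unfolding eq .
  show "M.sobolev_density x \<le> 17099 * e\<^sup>2"
  proof (cases "norm x \<le> R")
    case True
    have a: "2 * (1 - cos (p x)) \<le> e\<^sup>2"
      using one_minus_cos_le[of "p x"] power_mono[OF bounds(1)[OF True] abs_ge_zero, of 2] by simp
    have b: "(p1 i x)\<^sup>2 \<le> 49 * e\<^sup>2" for i
      using power_mono[OF bounds(2)[OF True, where i = i] abs_ge_zero, where n = 2] by (simp add: power_mult_distrib)
    have c: "(p2 j i x)\<^sup>2 \<le> 1849 * e\<^sup>2" for j i
      using power_mono[OF bounds(3)[OF True, where i = i and j = j] abs_ge_zero, where n = 2] by (simp add: power_mult_distrib)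
    have e1: "e\<^sup>2 \<le> 1" using e by (simp add: power_le_one)
    have d: "(p1 i x)\<^sup>2 * (p1 j x)\<^sup>2 \<le> 2401 * e\<^sup>2" for i j
    proof -
      have "(p1 i x)\<^sup>2 * (p1 j x)\<^sup>2 \<le> (49 * e\<^sup>2) * (49 * 1)" using b[of i] order_trans[OF b[of j]] e1 by (intro mult_mono) auto
      then show ?thesis by simp
    qed
    have "(\<Sum>i\<in>UNIV. \<Sum>j\<in>UNIV. (p2 i j x)\<^sup>2 + (p1 i x)\<^sup>2 * (p1 j x)\<^sup>2) \<le> (\<Sum>i\<in>(UNIV::2 set). \<Sum>j\<in>(UNIV::2 set). 4250 * e\<^sup>2)"
      using c d by (intro sum_mono) (smt (verit))
    then show ?thesis unfolding eq using a S_bound[OF True] by simp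
  next
    case False
    then show ?thesis unfolding eq by (simp add: p_supp S_def)
  qed
qed

end

section \<open>The theorem\<close>

text \<open>At a fixed small amplitude the wave has energy of order - R^2: the gain (1/4 - H) e^2
  R^2 beats the quartic loss e^4 R^2. Gluing the wave to a map of degree q keeps the degree.\<close>

lemma energy_unbounded_below:
  assumes H: "0 < H" "H < 1/4"
  shows "min_energy q H = - \<infinity>"
proof -
  obtain m D DD R0 where m: "compact_map m D DD R0" "degree_Q m = of_int q" using degree_map_exists by blast
  define d where "d = 1/4 - H"
  have d: "0 < d" "d < 1" using H by (auto simp: d_def)
  \<comment> \<open>As 3841600 = 800 * 4802, the loss 4802 e^2 R^2 is half of the gain d / 400
    R^2.\<close>
  define e where "e = sqrt (d / 3841600)"
  have e2: "e\<^sup>2 = d / 3841600" unfolding e_def using d by simp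
  have e: "0 < e" "e \<le> 1" unfolding e_def using d by auto
  have bound: "min_energy q H \<le> ereal (energy H m + pi * e\<^sup>2 * (2592 - d / 800 * R\<^sup>2))" if R: "R \<ge> 4 * pi" for R
  proof -
    have "R \<ge> 1" using R pi_gt3 by linarith
    then interpret w: wave e R by unfold_locales (use e in auto)
    obtain p E EE S where p: "compact_map p E EE S" "degree_Q p = degree_Q m + degree_Q w.m"
      "energy H p = energy H m + energy H w.m"
      using compact_map_glue[OF m(1) w.M.compact_map_axioms] by blast
    have "energy H w.m \<le> 2592 * pi * e\<^sup>2 + 4802 * pi * e ^ 4 * R\<^sup>2 - 1/2 * d * (LINT x|lborel. (w.p x)\<^sup>2)"
      using w.energy_le[of H] H unfolding d_def by simp
    also have "\<dots> \<le> 2592 * pi * e\<^sup>2 + 4802 * pi * e ^ 4 * R\<^sup>2 - 1/2 * d * (e\<^sup>2 * pi * R\<^sup>2 / 200)"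
      using w.p_square_lower[OF R] d by (intro diff_left_mono mult_left_mono) auto
    also have "\<dots> = pi * e\<^sup>2 * (2592 + 4802 * e\<^sup>2 * R\<^sup>2 - d / 400 * R\<^sup>2)"
      by (simp add: power4_eq_xxxx power2_eq_square algebra_simps)
    also have "\<dots> = pi * e\<^sup>2 * (2592 - d / 800 * R\<^sup>2)" unfolding e2 by (simp add: field_simps)
    finally have "energy H p \<le> energy H m + pi * e\<^sup>2 * (2592 - d / 800 * R\<^sup>2)" using p(3) by simp
    moreover have "p \<in> admissible_deg q"
      unfolding admissible_deg_def using compact_map.admissible[OF p(1)] p(2) m(2) w.degree_0 by simp
    ultimately show ?thesis unfolding min_energy_def by (intro INF_lower2[of p]) auto
  qed
  have "min_energy q H \<le> ereal B" for B
  proof -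
    define c where "c = pi * e\<^sup>2"
    have c: "c > 0" unfolding c_def using e by simp
    \<comment> \<open>K and R are chosen so that the gain d / 800 R^2 covers the constant 2592 and
      the distance from the energy of m down to B.\<close>
    define K where "K = \<bar>(energy H m - B) / c\<bar> + 2592"
    have K: "K \<ge> 0" unfolding K_def by simp
    define R where "R = 4 * pi + sqrt (800 * K / d)"
    have "R \<ge> 4 * pi" unfolding R_def using K d by simp
    have "800 * K / d \<le> R\<^sup>2"
    proof -
      have "(sqrt (800 * K / d))\<^sup>2 \<le> R\<^sup>2" unfolding R_def using K d by (intro power_mono) auto
      then show ?thesis using K d by simp
    qed
    then have "K \<le> d / 800 * R\<^sup>2" using d by (simp add: field_simps)
    then have "2592 - d / 800 * R\<^sup>2 \<le> - \<bar>(energy H m - B) / c\<bar>" unfolding K_def by linarith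
    also have "\<dots> \<le> - ((energy H m - B) / c)" by (rule le_imp_neg_le[OF abs_ge_self])
    finally have "c * (2592 - d / 800 * R\<^sup>2) \<le> c * (- ((energy H m - B) / c))" using c by (intro mult_left_mono) auto
    then have "energy H m + c * (2592 - d / 800 * R\<^sup>2) \<le> B" using c by simp
    then show ?thesis using bound[OF \<open>R \<ge> 4 * pi\<close>] unfolding c_def[symmetric]
      by (meson ereal_less_eq(3) order_trans)
  qed
  then show ?thesis by (rule ereal_bot)
qed

text \<open>With e = 1 / R the L2 size e R of the wave stays of order 1, while all densities are
  pointwise of order 1 / R^2 and the energy bound e^2 + e^4 R^2 is of the same order.\<close>

lemma vanishing_family:
  "\<exists>(w :: real \<Rightarrow> real^2 \<Rightarrow> real^3) R0.
      (\<forall>R\<ge>R0. w R \<in> admissible_deg 0)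
    \<and> Liminf at_top (\<lambda>R. ereal (H2_norm (\<lambda>x. w R x - e3))) > 0
    \<and> (\<lambda>R. energy (1/4) (w R)) \<in> O[at_top](\<lambda>R. 1 / R\<^sup>2)
    \<and> (\<forall>A>0. ((\<lambda>R. SUP y. ereal (LINT x:ball y A|lborel.
          (norm (w R x - e3))\<^sup>2 + grad_sq (w R) x + hess_sq (w R) x)) \<longlongrightarrow> 0) at_top)"
proof -
  define w where "w R = wave.m (1 / R) R" for R
  have wv: "wave (1 / R) R" if "R \<ge> 1" for R by unfold_locales (use that in auto)
  have adm: "w R \<in> admissible_deg 0" if "R \<ge> 1" for R
  proof -
    interpret wave "1 / R" R by (rule wv[OF that])
    show ?thesis unfolding w_def admissible_deg_def using M.admissible degree_0 by simp
  qed
  \<comment> \<open>The integral of p^2 is at least pi / 200, and that of p L at most 72 pi / R,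
    which is at most pi / 800 for R >= 57600 = 72 * 800; so \<open>S_by_parts\<close> leaves pi /
    400 - pi / 800 for the gradient.\<close>
  have norm_low: "H2_norm (\<lambda>x. w R x - e3) \<ge> sqrt (pi / 800)" if big: "R \<ge> 57600" for R
  proof -
    have R1: "R \<ge> 1" and R4: "R \<ge> 4 * pi" using big pi_less_4 by auto
    interpret wave "1 / R" R by (rule wv[OF R1])
    have "(LINT x|lborel. p x * L x) \<le> (1 / R * (72 * (1 / R) / R)) * (pi * R\<^sup>2)"
    proof (rule integral_le_on_cball[OF int_p(5)])
      fix x :: "real^2" assume x: "norm x \<le> R"
      have "\<bar>p x * L x\<bar> \<le> 1 / R * (72 * (1 / R) / R)" unfolding abs_mult using bounds[OF x] R1 by (intro mult_mono) auto
      then show "p x * L x \<le> 1 / R * (72 * (1 / R) / R)" by linarith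
    qed (use R1 in \<open>auto simp: p_supp\<close>)
    also have "\<dots> = 72 * pi / R" using R1 by (simp add: field_simps power2_eq_square)
    also have "\<dots> \<le> 72 * pi / 57600" using big by (intro divide_left_mono) auto
    finally have pL: "(LINT x|lborel. p x * L x) \<le> pi / 800" by simp
    have "(LINT x|lborel. (p x)\<^sup>2) \<ge> pi / 200" using p_square_lower[OF R4] R1 by (simp add: power_divide)
    then have "pi / 800 \<le> (LINT x|lborel. S x)" unfolding S_by_parts using pL by simp
    also have "\<dots> \<le> (LINT x|lborel. M.sobolev_density x)"
      by (rule integral_mono[OF int_p(2) M.integrable_sobolev_density sobolev_density_bounds(1)])
    finally show ?thesis unfolding w_def M.sobolev_eq(1) by simp
  qed
  have "Liminf at_top (\<lambda>R. ereal (H2_norm (\<lambda>x. w R x - e3))) \<ge> ereal (sqrt (pi / 800))"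
    by (rule Liminf_bounded) (use norm_low in \<open>auto simp: eventually_at_top_linorder\<close>)
  moreover have "ereal (sqrt (pi / 800)) > 0" by simp
  ultimately have low: "Liminf at_top (\<lambda>R. ereal (H2_norm (\<lambda>x. w R x - e3))) > 0" by (rule less_le_trans[rotated])
  have energy: "(\<lambda>R. energy (1/4) (w R)) \<in> O[at_top](\<lambda>R. 1 / R\<^sup>2)"
  proof (rule bigoI)
    show "\<forall>\<^sub>F R in at_top. norm (energy (1/4) (w R)) \<le> (7394 * pi) * norm (1 / R\<^sup>2)"
      using eventually_ge_at_top[of 1]
    proof eventually_elim
      case (elim R)
      interpret wave "1 / R" R by (rule wv[OF elim])
      \<comment> \<open>The norm asks for a two-sided bound; at H = 1/4 the energy is half a sum of
        squares. The upper constant is 7394 = 2592 + 4802.\<close>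
      have "energy (1/4) m \<ge> 0" unfolding energy_quarter_eq[OF M.admissible] by (simp add: sum_nonneg)
      moreover have "energy (1/4) m \<le> 7394 * pi * (1 / R\<^sup>2)"
        using energy_le[of "1/4"] elim by (simp add: power_divide power4_eq_xxxx power2_eq_square field_simps)
      ultimately show ?case unfolding w_def by simp
    qed
  qed
  have loc: "((\<lambda>R. SUP y. ereal (LINT x:ball y A|lborel. (norm (w R x - e3))\<^sup>2 + grad_sq (w R) x + hess_sq (w R) x)) \<longlongrightarrow> 0) at_top"
    if A: "A > 0" for A
  proof -
    let ?F = "\<lambda>R y. LINT x:ball y A|lborel. (norm (w R x - e3))\<^sup>2 + grad_sq (w R) x + hess_sq (w R) x"
    have b: "0 \<le> ?F R y \<and> ?F R y \<le> 17099 * (1 / R)\<^sup>2 * (pi * A\<^sup>2)" if R: "R \<ge> 1" for R y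
    proof -
      interpret wave "1 / R" R by (rule wv[OF R])
      have [measurable]: "ball y A \<in> sets borel" by simp
      have fin: "emeasure lborel (ball y A) < \<infinity>" 
        using emeasure_mono[OF ball_subset_cball, of y A lborel] emeasure_compact_finite[OF compact_cball, of y A]
        by (auto simp: less_top top.extremum_unique intro: le_less_trans)
      have nn: "M.sobolev_density x \<ge> 0" for x using sobolev_density_bounds(1)[of x] S_nonneg[of x] by linarith
      have eq: "?F R y = (LINT x|lborel. indicator (ball y A) x * M.sobolev_density x)"
        unfolding w_def M.sobolev_eq(2) by (simp add: set_lebesgue_integral_def)
      have i: "integrable lborel (\<lambda>x. indicator (ball y A) x * M.sobolev_density x)"
        using integrable_real_mult_indicator[OF _ M.integrable_sobolev_density, of "ball y A"] by (simp add: mult.commute)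
      have "(LINT x|lborel. indicator (ball y A) x * M.sobolev_density x) \<le> (LINT x|lborel. 17099 * (1 / R)\<^sup>2 * indicator (ball y A) x)"
      proof (rule integral_mono[OF i])
        show "integrable lborel (\<lambda>x. 17099 * (1 / R)\<^sup>2 * indicator (ball y A) x)"
          using fin by (intro integrable_mult_right integrable_real_indicator) auto
        show "indicator (ball y A) x * M.sobolev_density x \<le> 17099 * (1 / R)\<^sup>2 * indicator (ball y A) x" for x
          using sobolev_density_bounds(2)[of x] by (auto simp: indicator_def)
      qed
      also have "\<dots> = 17099 * (1 / R)\<^sup>2 * measure lborel (ball y A)" by simp
      also have "measure lborel (ball y A) = pi * A\<^sup>2"
        using A emeasure_ball[of A y] by (simp add: measure_def eval_unit_ball_vol)
      finally show ?thesis unfolding eq using nn by (auto intro!: Bochner_Integration.integral_nonneg)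
    qed
    have up: "((\<lambda>R. ereal (17099 * (1 / R)\<^sup>2 * (pi * A\<^sup>2))) \<longlongrightarrow> 0) at_top"
    proof -
      have "((\<lambda>R::real. 17099 * (1 / R)\<^sup>2 * (pi * A\<^sup>2)) \<longlongrightarrow> 17099 * 0\<^sup>2 * (pi * A\<^sup>2)) at_top"
        by (intro tendsto_intros tendsto_divide_0[OF tendsto_const] filterlim_at_top_imp_at_infinity filterlim_ident)
      then show ?thesis by (simp add: zero_ereal_def)
    qed
    show ?thesis
    proof (rule tendsto_sandwich[OF _ _ tendsto_const up])
      show "\<forall>\<^sub>F R in at_top. 0 \<le> (SUP y. ereal (?F R y))"
        using eventually_ge_at_top[of 1]
      proof eventually_elim
        case (elim R)
        show ?case by (rule SUP_upper2[of 0]) (use b[OF elim, of 0] in auto)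
      qed
      show "\<forall>\<^sub>F R in at_top. (SUP y. ereal (?F R y)) \<le> ereal (17099 * (1 / R)\<^sup>2 * (pi * A\<^sup>2))"
        using eventually_ge_at_top[of 1]
      proof eventually_elim
        case (elim R)
        show ?case by (rule SUP_least) (use b[OF elim] in simp)
      qed
    qed
  qed
  show ?thesis
    by (rule exI[of _ w], rule exI[of _ 1]) (use adm low energy loc in blast)
qed

text \<open>The energy of each map is affine in H, and its slope, the integral of 1 - m3, is
  nonnegative. Monotonicity of the infimum bounds the limit from below; a single map that is nearly
  optimal at H = 1/4 bounds it from above.\<close>

lemma min_energy_tendsto: "((\<lambda>H. min_energy q H) \<longlongrightarrow> min_energy q (1/4)) (at_right (1/4))"
proof (rule order_tendstoI)
  have mono: "min_energy q (1/4) \<le> min_energy q H" if "H > 1/4" for H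
    unfolding min_energy_def
  proof (rule INF_mono)
    fix m assume m: "m \<in> admissible_deg q"
    then have a: "m \<in> admissible" unfolding admissible_deg_def by simp
    have "m x \<in> sphere 0 1" for x using a unfolding admissible_def by auto
    then have "m x $ 3 \<le> 1" for x using sphere_abs_le[of "m x" 3] by force
    then have "(LINT x|lborel. 1 - m x $ 3) \<ge> 0" by simp
    then have "(H - 1/4) * (LINT x|lborel. 1 - m x $ 3) \<ge> 0" using that by simp
    then have "energy (1/4) m \<le> energy H m" using energy_eq_quarter[OF a, of H] by linarith
    then show "\<exists>n\<in>admissible_deg q. ereal (energy (1/4) n) \<le> ereal (energy H m)" using m by auto
  qed
  show "\<forall>\<^sub>F H in at_right (1/4). a < min_energy q H" if "a < min_energy q (1/4)" for a
    unfolding eventually_at_filter using less_le_trans[OF that mono] by (auto intro!: always_eventually)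
  fix a assume "min_energy q (1/4) < a"
  then obtain m where m: "m \<in> admissible_deg q" "ereal (energy (1/4) m) < a"
    unfolding min_energy_def INF_less_iff by blast
  have a: "m \<in> admissible" using m unfolding admissible_deg_def by simp
  have "((\<lambda>H. ereal (energy (1/4) m + (H - 1/4) * (LINT x|lborel. 1 - m x $ 3))) \<longlongrightarrow>
     ereal (energy (1/4) m + (1/4 - 1/4) * (LINT x|lborel. 1 - m x $ 3))) (at_right (1/4))"
    by (intro tendsto_intros)
  then have "((\<lambda>H. ereal (energy H m)) \<longlongrightarrow> ereal (energy (1/4) m)) (at_right (1/4))"
    by (subst energy_eq_quarter[OF a]) simp
  from order_tendstoD(2)[OF this m(2)] show "\<forall>\<^sub>F H in at_right (1/4). min_energy q H < a"
  proof eventually_elim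
    case (elim H)
    have "min_energy q H \<le> ereal (energy H m)" unfolding min_energy_def by (rule INF_lower[OF m(1)])
    then show ?case using elim by (rule le_less_trans)
  qed
qed

theorem theorem1p2:
  shows "(\<forall>H q. 0 < H \<and> H < 1/4 \<longrightarrow> min_energy q H = -\<infinity>)
    \<and> (\<forall>m \<in> admissible. degree_Q m \<noteq> 0 \<longrightarrow> energy (1/4) m \<ge> b_star / 2)
    \<and> (\<exists>(w :: real \<Rightarrow> real^2 \<Rightarrow> real^3) R0.
          (\<forall>R\<ge>R0. w R \<in> admissible_deg 0)
        \<and> Liminf at_top (\<lambda>R. ereal (H2_norm (\<lambda>x. w R x - e3))) > 0
        \<and> (\<lambda>R. energy (1/4) (w R)) \<in> O[at_top](\<lambda>R. 1 / R\<^sup>2)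
        \<and> (\<forall>A>0. ((\<lambda>R. SUP y. ereal (LINT x:ball y A|lborel.
              (norm (w R x - e3))\<^sup>2 + grad_sq (w R) x + hess_sq (w R) x)) \<longlongrightarrow> 0) at_top))
    \<and> (((\<lambda>H. min_energy (-1) H) \<longlongrightarrow> min_energy (-1) (1/4)) (at_right (1/4))
        \<and> min_energy (-1) (1/4) \<ge> ereal (b_star / 2) \<and> b_star / 2 > 0)"
proof (intro conjI)
  show "\<forall>H q. 0 < H \<and> H < 1/4 \<longrightarrow> min_energy q H = -\<infinity>" using energy_unbounded_below by blast
  show "\<forall>m \<in> admissible. degree_Q m \<noteq> 0 \<longrightarrow> energy (1/4) m \<ge> b_star / 2" using energy_lower_bound by blast
  show "min_energy (-1) (1/4) \<ge> ereal (b_star / 2)"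
    unfolding min_energy_def
  proof (rule INF_greatest)
    fix m assume "m \<in> admissible_deg (- 1)"
    then show "ereal (b_star / 2) \<le> ereal (energy (1/4) m)"
      using energy_lower_bound[of m] by (simp add: admissible_deg_def)
  qed
  show "b_star / 2 > 0" using b_star_pos by simp
qed (fact vanishing_family min_energy_tendsto)+

end
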